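(* Let $D$ be a Platonic surface tiled by regular Euclidean $p$-gons, let $\tilde D$ be its unfolding, and let $\pi_{\Pi}:\tilde D\to\Pi_p$ be the associated branched covering of the $p$-gon surface ($p$ even) or double $p$-gon surface ($p$ odd). Then the monodromy group $\mathrm{Mon}(\pi_{\Pi})$ (equivalently, the deck group of $\pi_\Pi$) is isomorphic to a normal subgroup $N$ of the rotation group $\mathrm{Rot}(D)$. Furthermore, $\mathrm{Rot}(D)/N$ is a cyclic group.
   Context: **Platonic surfaces.** Let $p\ge 3$. Take finitely many congruent regular Euclidean $p$-gons (the faces) and glue their sides isometrically in pairs so that the result $D$ is a connected closed oriented surface. A flag is a triple $(f,e,v)$ with $f$ a face, $e$ one of the $p$ boundary sides of the polygon $f$ (if one edge of the surface occurs twice on the boundary of $f$, these are two different sides of $f$), and $v$ an endpoint of that side. An automorphism of $D$ is a Euclidean isometry of $D$ carrying faces to faces; $\mathrm{Aut}(D)$ acts on flags. $D$ is a Platonic surface if $\mathrm{Aut}(D)$ is transitive on flags. It has Schläfli symbol $\{p,q\}$ if every face has $p$ sides and every vertex has degree $q$. $\mathrm{Rot}(D)\le\mathrm{Aut}(D)$ is the subgroup of orientation-preserving automorphisms. **Unfolding.** $D$ minus its vertices is flat, and the holonomy of a closed curve in it is the change of angle when a tangent vector is parallel transported around the curve. The unfolding $\pi_D:\tilde D\to D$ is the smallest connected cover of $D$, branched only over vertices, such that every closed curve in $\tilde D$ avoiding the vertices has holonomy in $2\pi\mathbb{Z}$ (i.e. the completion of the covering of $D$ minus vertices corresponding to the kernel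 of the holonomy homomorphism to $\mathbb{R}/2\pi\mathbb{Z}$). $\tilde D$ is tiled by the lifts of the faces of $D$; directions are globally defined on $\tilde D$, and one fixes a horizontal direction on $\tilde D$ in which some side of some face is horizontal. **$\Pi_p$ and $\pi_\Pi$.** For $p$ even, $\Pi_p$ is a regular $p$-gon with a horizontal side whose opposite parallel sides are identified by translations. For $p$ odd, $\Pi_p$ is the union of a regular $p$-gon $P$ with a horizontal side and its rotation $-P$ by angle $\pi$, with each side of $P$ identified by translation with the parallel side of $-P$. Each face of $\tilde D$ is a translate of a unique polygon of $\Pi_p$, and $\pi_\Pi:\tilde D\to\Pi_p$ is the resulting branched covering, mapping each face by translation onto the corresponding polygon; it is branched only over vertices. **Monodromy group.** $\mathrm{Mon}(\pi_\Pi)$ is the image of the monodromy representation $\pi_1(\Pi_p\setminus\{\text{vertices}\},x_0)\to S_n$, $n=\deg\pi_\Pi$, recording how lifts of loops permute the sheets of $\pi_\Pi$. *)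

theory Defs
  imports "HOL-Analysis.Analysis" "HOL-Algebra.Bij" "HOL-Algebra.Elementary_Groups"
begin

section \<open>Regular polygons\<close>

text \<open>The reference polygon has centre \<^term>\<open>0::complex\<close> and circumradius 1. Its vertices are listed
  counterclockwise (indices are read modulo \<open>p\<close>), and side \<open>k\<close> runs from vertex \<open>k\<close> to vertex
  \<open>k + 1\<close>. The phase makes side 0 the horizontal bottom side.\<close>

definition vert :: "nat \<Rightarrow> nat \<Rightarrow> complex" where
  "vert p k = cis (2 * pi * real k / real p - pi / 2 - pi / real p)"

definition polygon :: "nat \<Rightarrow> complex set" where
  "polygon p = convex hull (vert p ` {..<p})"

definition side :: "nat \<Rightarrow> nat \<Rightarrow> complex set" where
  "side p k = closed_segment (vert p k) (vert p (k + 1))"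

definition side_vec :: "nat \<Rightarrow> nat \<Rightarrow> complex" where
  "side_vec p k = vert p (k + 1) - vert p k"

text \<open>An isometric gluing of side \<open>k\<close> of one polygon to side \<open>l\<close> of another yields an oriented
  surface iff it reverses the boundary orientations. It is then the restriction of a unique
  orientation-preserving isometry of the plane: the one taking vertex \<open>k\<close> to vertex \<open>l + 1\<close> and
  vertex \<open>k + 1\<close> to vertex \<open>l\<close>. Its linear part \<open>glue_rot\<close> is parallel transport from the chart of
  the first polygon to the chart of the second across the common side.\<close>

definition glue_rot :: "nat \<Rightarrow> nat \<Rightarrow> nat \<Rightarrow> complex" where
  "glue_rot p k l = - side_vec p l / side_vec p k"

definition glue_map :: "nat \<Rightarrow> nat \<Rightarrow> nat \<Rightarrow> complex \<Rightarrow> complex" where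
  "glue_map p k l z = vert p (l + 1) + glue_rot p k l * (z - vert p k)"


section \<open>Surfaces glued from regular polygons\<close>

text \<open>Every face is a copy of the reference polygon, identified with it by an
  orientation-preserving isometry. \<open>glue S (f, k) = (g, l)\<close> means that side \<open>k\<close> of \<open>f\<close> is glued to
  side \<open>l\<close> of \<open>g\<close>; here \<open>f = g\<close> is allowed.\<close>

record 'f polysurf =
  gon :: nat
  faces :: "'f set"
  glue :: "'f \<times> nat \<Rightarrow> 'f \<times> nat"

abbreviation poly_of :: "'f polysurf \<Rightarrow> complex set" where
  "poly_of S \<equiv> polygon (gon S)"

definition glue_rel :: "'f polysurf \<Rightarrow> (('f \<times> complex) \<times> ('f \<times> complex)) set" where
  "glue_rel S = {((f, x), (g, y)). \<exists>k l. f \<in> faces S \<and> k < gon S \<and> glue S (f, k) = (g, l) \<and>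
      x \<in> side (gon S) k \<and> y = glue_map (gon S) k l x}"

text \<open>The generated equivalence relation; \<^const>\<open>glue_rel\<close> is symmetric because sides are paired by
  an involution. The transitive closure matters only at vertices.\<close>

definition same_point :: "'f polysurf \<Rightarrow> (('f \<times> complex) \<times> ('f \<times> complex)) set" where
  "same_point S = (glue_rel S)\<^sup>* \<inter> ((faces S \<times> poly_of S) \<times> (faces S \<times> poly_of S))"

definition points :: "'f polysurf \<Rightarrow> ('f \<times> complex) set set" where
  "points S = (faces S \<times> poly_of S) // same_point S"

definition pt :: "'f polysurf \<Rightarrow> 'f \<Rightarrow> complex \<Rightarrow> ('f \<times> complex) set" where
  "pt S f x = same_point S `` {(f, x)}"

text \<open>Quotient topology of the disjoint union of the polygons.\<close>

definition surf_top :: "'f polysurf \<Rightarrow> ('f \<times> complex) set topology" where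
  "surf_top S = topology (\<lambda>U. U \<subseteq> points S \<and>
      openin (sum_topology (\<lambda>_. top_of_set (poly_of S)) (faces S)) (\<Union>U))"

definition vertices :: "'f polysurf \<Rightarrow> ('f \<times> complex) set set" where
  "vertices S = {pt S f (vert (gon S) k) | f k. f \<in> faces S \<and> k < gon S}"

definition punctured :: "'f polysurf \<Rightarrow> ('f \<times> complex) set topology" where
  "punctured S = subtopology (surf_top S) (points S - vertices S)"

definition connected_surface :: "'f polysurf \<Rightarrow> bool" where
  "connected_surface S \<longleftrightarrow> gon S \<ge> 3 \<and> faces S \<noteq> {} \<and>
     (\<forall>s \<in> faces S \<times> {..<gon S}.
        glue S s \<in> faces S \<times> {..<gon S} \<and> glue S s \<noteq> s \<and> glue S (glue S s) = s) \<and>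
     connected_space (surf_top S)"


section \<open>Automorphisms and Platonic surfaces\<close>

text \<open>\<open>carries S T \<phi> f g A\<close>: the map \<open>\<phi>\<close> takes the face \<open>f\<close> of \<open>S\<close> isometrically onto the face \<open>g\<close>
  of \<open>T\<close>, and it is \<open>A\<close> in the charts of these faces.\<close>

definition carries :: "'f polysurf \<Rightarrow> 'g polysurf \<Rightarrow> (('f \<times> complex) set \<Rightarrow> ('g \<times> complex) set)
    \<Rightarrow> 'f \<Rightarrow> 'g \<Rightarrow> (complex \<Rightarrow> complex) \<Rightarrow> bool" where
  "carries S T \<phi> f g A \<longleftrightarrow> f \<in> faces S \<and> g \<in> faces T \<and> A ` poly_of S = poly_of T \<and>
     (\<forall>x \<in> poly_of S. \<forall>y \<in> poly_of S. dist (A x) (A y) = dist x y) \<and>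
     (\<forall>x \<in> poly_of S. \<phi> (pt S f x) = pt T g (A x))"

definition orientation_preserving_on :: "complex set \<Rightarrow> (complex \<Rightarrow> complex) \<Rightarrow> bool" where
  "orientation_preserving_on P A \<longleftrightarrow> (\<exists>a b. cmod a = 1 \<and> (\<forall>x \<in> P. A x = a * x + b))"

definition Aut_set :: "'f polysurf \<Rightarrow> (('f \<times> complex) set \<Rightarrow> ('f \<times> complex) set) set" where
  "Aut_set S = {\<phi> \<in> Bij (points S). homeomorphic_map (surf_top S) (surf_top S) \<phi> \<and>
     (\<forall>f \<in> faces S. \<exists>g A. carries S S \<phi> f g A)}"

definition Rot_set :: "'f polysurf \<Rightarrow> (('f \<times> complex) set \<Rightarrow> ('f \<times> complex) set) set" where
  "Rot_set S = {\<phi> \<in> Aut_set S.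
     \<forall>f \<in> faces S. \<exists>g A. carries S S \<phi> f g A \<and> orientation_preserving_on (poly_of S) A}"

definition Rot :: "'f polysurf \<Rightarrow> (('f \<times> complex) set \<Rightarrow> ('f \<times> complex) set) monoid" where
  "Rot S = (BijGroup (points S))\<lparr>carrier := Rot_set S\<rparr>"

text \<open>In a flag \<open>(f, k, v)\<close> the side \<open>k\<close> and its endpoint \<open>v\<close> belong to the polygon \<open>f\<close>, not to its
  image in the surface, where different sides or vertices of \<open>f\<close> may coincide.\<close>

definition flags :: "'f polysurf \<Rightarrow> ('f \<times> nat \<times> complex) set" where
  "flags S = {(f, k, v). f \<in> faces S \<and> k < gon S \<and>
     v \<in> {vert (gon S) k, vert (gon S) (k + 1)}}"

definition maps_flag :: "'f polysurf \<Rightarrow> (('f \<times> complex) set \<Rightarrow> ('f \<times> complex) set)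
    \<Rightarrow> 'f \<times> nat \<times> complex \<Rightarrow> 'f \<times> nat \<times> complex \<Rightarrow> bool" where
  "maps_flag S \<phi> = (\<lambda>(f, k, v) (g, l, w).
     \<exists>A. carries S S \<phi> f g A \<and> A ` side (gon S) k = side (gon S) l \<and> A v = w)"

definition platonic_surface :: "'f polysurf \<Rightarrow> bool" where
  "platonic_surface S \<longleftrightarrow> connected_surface S \<and> finite (faces S) \<and>
     (\<forall>F \<in> flags S. \<forall>G \<in> flags S. \<exists>\<phi> \<in> Aut_set S. maps_flag S \<phi> F G)"


section \<open>Holonomy\<close>

text \<open>A vector field along a path \<open>\<gamma>\<close> is a function \<open>V\<close> such that \<open>V t (f, x)\<close> is the vector at time
  \<open>t\<close> in the chart of the face \<open>f\<close>, for every representative \<open>(f, x)\<close> of the point \<open>\<gamma> t\<close>. An interior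
  point of an edge has two representatives; the first condition says that these give the same
  tangent vector. The second one says that in charts the vector is locally constant. The bound
  on \<open>dist x x'\<close> is there because the two representatives of an edge point may lie in one
  face, and then only the one near \<open>x\<close> is relevant.\<close>

definition parallel_along :: "'f polysurf \<Rightarrow> (real \<Rightarrow> ('f \<times> complex) set)
    \<Rightarrow> (real \<Rightarrow> 'f \<times> complex \<Rightarrow> complex) \<Rightarrow> bool" where
  "parallel_along S \<gamma> V \<longleftrightarrow>
     (\<forall>t \<in> {0..1}. \<forall>f x k g l. (f, x) \<in> \<gamma> t \<and> k < gon S \<and> x \<in> side (gon S) k \<and> glue S (f, k) = (g, l)
        \<longrightarrow> V t (g, glue_map (gon S) k l x) = glue_rot (gon S) k l * V t (f, x)) \<and>
     (\<forall>t \<in> {0..1}. \<exists>\<epsilon>>0. \<forall>s \<in> {0..1}. \<bar>s - t\<bar> < \<epsilon> \<longrightarrow>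
        (\<forall>f x x'. (f, x) \<in> \<gamma> s \<and> (f, x') \<in> \<gamma> t \<and> dist x x' < \<epsilon> \<longrightarrow> V s (f, x) = V t (f, x')))"

text \<open>For a closed path \<open>\<gamma>\<close> avoiding the vertices. Only the class of \<open>\<theta>\<close> modulo \<open>2\<pi>\<close> matters.\<close>

definition has_holonomy :: "'f polysurf \<Rightarrow> (real \<Rightarrow> ('f \<times> complex) set) \<Rightarrow> real \<Rightarrow> bool" where
  "has_holonomy S \<gamma> \<theta> \<longleftrightarrow> (\<exists>V. parallel_along S \<gamma> V \<and>
     (\<forall>q \<in> \<gamma> 0. V 0 q \<noteq> 0 \<and> V 1 q = cis \<theta> * V 0 q))"


section \<open>The unfolding\<close>

text \<open>\<^const>\<open>covering_space\<close> for abstract topologies.\<close>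

definition covering_map :: "'a topology \<Rightarrow> 'b topology \<Rightarrow> ('a \<Rightarrow> 'b) \<Rightarrow> bool" where
  "covering_map X Y h \<longleftrightarrow> continuous_map X Y h \<and> h ` topspace X = topspace Y \<and>
     (\<forall>y \<in> topspace Y. \<exists>V. y \<in> V \<and> openin Y V \<and>
        (\<exists>\<U>. \<Union>\<U> = {x \<in> topspace X. h x \<in> V} \<and> (\<forall>U \<in> \<U>. openin X U) \<and> pairwise disjnt \<U> \<and>
             (\<forall>U \<in> \<U>. homeomorphic_map (subtopology X U) (subtopology Y V) h)))"

text \<open>\<open>\<pi>\<^sub>D\<close> is a connected covering branched only over vertices, tiled by the lifts of the faces of
  \<open>D\<close>. The last clause says that it corresponds to the kernel of the holonomy homomorphism: for
  every base point, the loops in \<open>D\<close> whose lift is closed are exactly those of holonomy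
  \<open>0\<close> modulo \<open>2\<pi>\<close>.\<close>

definition is_unfolding ::
  "'f polysurf \<Rightarrow> 'g polysurf \<Rightarrow> (('g \<times> complex) set \<Rightarrow> ('f \<times> complex) set) \<Rightarrow> bool" where
  "is_unfolding D E \<pi>\<^sub>D \<longleftrightarrow> connected_surface E \<and> gon E = gon D \<and>
     (\<forall>f \<in> faces E. \<exists>g A. carries E D \<pi>\<^sub>D f g A \<and> orientation_preserving_on (poly_of E) A) \<and>
     continuous_map (surf_top E) (surf_top D) \<pi>\<^sub>D \<and>
     covering_map (punctured E) (punctured D) \<pi>\<^sub>D \<and>
     (\<forall>c. pathin (punctured E) c \<longrightarrow>
        (c 0 = c 1 \<longleftrightarrow> \<pi>\<^sub>D (c 0) = \<pi>\<^sub>D (c 1) \<and> has_holonomy D (\<pi>\<^sub>D \<circ> c) 0))"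

text \<open>A global choice of directions: \<open>d f\<close> is the rotation from the chart of the face \<open>f\<close> to the
  global directions. The second clause says that \<open>d f\<close> and \<open>d g\<close> agree across a common side of
  \<open>f\<close> and \<open>g\<close>, which the two boundary orientations traverse in opposite senses; the last one
  that some side of some face is horizontal.\<close>

definition horizontal_directions :: "'f polysurf \<Rightarrow> ('f \<Rightarrow> complex) \<Rightarrow> bool" where
  "horizontal_directions S d \<longleftrightarrow> (\<forall>f \<in> faces S. cmod (d f) = 1) \<and>
     (\<forall>f \<in> faces S. \<forall>k < gon S. \<forall>g l. glue S (f, k) = (g, l) \<longrightarrow>
        d g * side_vec (gon S) l = - (d f * side_vec (gon S) k)) \<and>
     (\<exists>f \<in> faces S. \<exists>k < gon S. Im (d f * side_vec (gon S) k) = 0)"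


section \<open>The (double) \<open>p\<close>-gon surface\<close>

text \<open>The face \<open>u\<close> is the polygon \<open>u\<cdot>P\<close> in the plane (\<open>u = 1\<close>, or \<open>u = \<plusminus>1\<close> for odd \<open>p\<close>), with
  chart \<open>x \<mapsto> u\<cdot>x\<close>. In the plane, the side of \<open>P\<close> parallel to side \<open>k\<close> is side \<open>k + p/2\<close> if \<open>p\<close> is
  even, and the side of \<open>-P\<close> parallel to side \<open>k\<close> of \<open>P\<close> is the image of side \<open>k\<close> under \<open>-1\<close>.
  The maps \<^const>\<open>glue_map\<close> become translations in the plane.\<close>

definition Pi_surface :: "nat \<Rightarrow> complex polysurf" where
  "Pi_surface p = (if even p
     then \<lparr>gon = p, faces = {1}, glue = (\<lambda>(u, k). (u, (k + p div 2) mod p))\<rparr>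
     else \<lparr>gon = p, faces = {1, -1}, glue = (\<lambda>(u, k). (-u, k))\<rparr>)"

text \<open>With respect to the directions \<open>d\<close> the face \<open>f\<close> of \<open>E\<close> is a translate of \<open>d f\<cdot>P\<close>. As all polygons
  are centred at 0, the translation onto the polygon \<open>u\<cdot>P\<close> takes the point with chart coordinate
  \<open>x\<close> to the point \<open>d f\<cdot>x\<close> of the plane, whose coordinate in the chart of the face \<open>u\<close>
  is \<open>d f\<cdot>x/u\<close>.\<close>

definition is_translation_cover :: "'g polysurf \<Rightarrow> ('g \<Rightarrow> complex)
    \<Rightarrow> (('g \<times> complex) set \<Rightarrow> (complex \<times> complex) set) \<Rightarrow> bool" where
  "is_translation_cover E d h \<longleftrightarrow> (\<forall>f \<in> faces E. \<exists>u \<in> faces (Pi_surface (gon E)).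
     (\<lambda>x. d f * x) ` poly_of E = (\<lambda>x. u * x) ` poly_of E \<and>
     (\<forall>x \<in> poly_of E. h (pt E f x) = pt (Pi_surface (gon E)) u (d f * x / u)))"


section \<open>Monodromy and deck groups\<close>

definition fibre :: "'g polysurf \<Rightarrow> (('g \<times> complex) set \<Rightarrow> 'b) \<Rightarrow> 'b \<Rightarrow> ('g \<times> complex) set set" where
  "fibre E h x\<^sub>0 = {y \<in> points E. h y = x\<^sub>0}"

definition lift_end :: "'g polysurf \<Rightarrow> (('g \<times> complex) set \<Rightarrow> 'b) \<Rightarrow> (real \<Rightarrow> 'b)
    \<Rightarrow> ('g \<times> complex) set \<Rightarrow> ('g \<times> complex) set" where
  "lift_end E h \<gamma> y = (THE z. \<exists>c. pathin (punctured E) c \<and> (\<forall>t \<in> {0..1}. h (c t) = \<gamma> t) \<and>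
     c 0 = y \<and> c 1 = z)"

definition Mon :: "'g polysurf \<Rightarrow> 'h polysurf \<Rightarrow> (('g \<times> complex) set \<Rightarrow> ('h \<times> complex) set)
    \<Rightarrow> ('h \<times> complex) set \<Rightarrow> (('g \<times> complex) set \<Rightarrow> ('g \<times> complex) set) monoid" where
  "Mon E T h x\<^sub>0 = (BijGroup (fibre E h x\<^sub>0))\<lparr>carrier :=
     {\<lambda>y \<in> fibre E h x\<^sub>0. lift_end E h \<gamma> y | \<gamma>. pathin (punctured T) \<gamma> \<and> \<gamma> 0 = x\<^sub>0 \<and> \<gamma> 1 = x\<^sub>0}\<rparr>"

definition Deck :: "'g polysurf \<Rightarrow> (('g \<times> complex) set \<Rightarrow> 'b)
    \<Rightarrow> (('g \<times> complex) set \<Rightarrow> ('g \<times> complex) set) monoid" where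
  "Deck E h = (BijGroup (points E))\<lparr>carrier :=
     {\<phi> \<in> Bij (points E). homeomorphic_map (surf_top E) (surf_top E) \<phi> \<and>
        (\<forall>y \<in> points E. h (\<phi> y) = h y)}\<rparr>"

end

theory Submission
  imports Defs
begin

text \<open>A \<^emph>\<open>dart\<close> is a side of a face. The darts of a surface carry two operations, turning inside a face and
  passing to the glued side, and a connected surface has no proper nonempty set of darts closed under both.
  Rotations of \<open>D\<close> and of \<open>E\<close>, the unfolding \<open>E \<rightarrow> D\<close> and the translation covering \<open>E \<rightarrow> \<Pi>\<close> all come
  from maps of darts commuting with these operations; such a map is determined by its value at one dart. Each
  dart of \<open>E\<close> has a direction, and two darts of \<open>E\<close> have the same image in \<open>\<Pi>\<close> iff their directions agree.
  Because the unfolding belongs to the kernel of holonomy, a dart of \<open>E\<close> is determined by its image in \<open>D\<close>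
  together with its direction. Flag transitivity of \<open>D\<close> therefore lifts: \<open>Rot(E)\<close> acts simply transitively on
  the darts of \<open>E\<close>, it maps onto \<open>Rot(D)\<close>, and each of its elements multiplies all directions by a constant,
  which defines a character with cyclic image. The kernel \<open>K\<close> of this character is the deck group of
  \<open>E \<rightarrow> \<Pi>\<close>. It embeds into \<open>Rot(D)\<close>, with normal image \<open>N\<close> since \<open>K\<close> is normal in \<open>Rot(E)\<close>, and
  \<open>Rot(D)/N\<close> is a quotient of the cyclic group \<open>Rot(E)/K\<close>. Finally \<open>K\<close> is simply transitive on the fibres of
  \<open>E \<rightarrow> \<Pi>\<close>, and the monodromy group consists of all maps of a fibre that commute with \<open>K\<close>, hence it is
  isomorphic to \<open>K\<close>.\<close>

section \<open>Regular polygons\<close>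

text \<open>Hypotheses and conclusion are topological, so each has to be brought to darts and back.
  Off the vertices a point has at most two representatives, exchanged by the gluing, while nothing
  bounds the class of a vertex. The points that test a map are therefore centres of faces, inner
  points of spokes and inner points of sides. Flag transitivity is lifted without the lifting
  criterion for coverings. A dart is related to \<open>r\<close> if it lies over the prescribed
  image of \<open>r\<close> and its direction is a fixed multiple of that of \<open>r\<close>.
  Gluing negates every direction, turning by one side multiplies every direction by
  \<open>zeta p\<close>; as these factors do not depend on the dart, the relation survives both
  operations. Connectedness makes it total, and uniqueness of darts over a given image and direction
  makes it single-valued. The same constancy makes the multiplier a character. Two degenerations
  have to be kept out. An isometry of a face could be a reflection, which is excluded because the
  polygon lies to the left of each of its sides. Faces may be glued to themselves, which is harmless
  because no side is its own partner.\<close>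

definition zeta :: "nat \<Rightarrow> complex" where
  "zeta p = cis (2 * pi / real p)"

text \<open>The open cone seen from the centre between two consecutive vertices. For
  \<open>p \<ge> 3\<close> its angle is below \<pi>, so the signs of two cross products describe it;
  openness and behaviour under rotation can be read off from them.\<close>

definition sector :: "nat \<Rightarrow> nat \<Rightarrow> complex set" where
  "sector p k = {x. Im (x * cnj (vert p k)) > 0 \<and> Im (vert p (k + 1) * cnj x) > 0}"

text \<open>Affine parameter along a side. In these coordinates a rotation only shifts the index,
  and a gluing is \<open>s\<close> to \<open>1 - s\<close>.\<close>

definition side_pt :: "nat \<Rightarrow> nat \<Rightarrow> real \<Rightarrow> complex" where
  "side_pt p k s = vert p k + of_real s * side_vec p k"

section \<open>Roots of unity and indices modulo \<open>p\<close>\<close>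

lemma zeta_power: "zeta p ^ n = cis (2 * pi * real n / real p)"
proof -
  have "zeta p ^ n = cis (real n * (2 * pi / real p))"
    by (simp only: zeta_def Complex.DeMoivre)
  also have "real n * (2 * pi / real p) = 2 * pi * real n / real p" by simp
  finally show ?thesis .
qed

lemma zeta_nonzero [simp]: "zeta p \<noteq> 0"
  by (simp add: zeta_def)

lemma norm_zeta [simp]: "cmod (zeta p) = 1"
  by (simp add: zeta_def)

lemma zeta_power_self: "p > 0 \<Longrightarrow> zeta p ^ p = 1"
  by (simp add: zeta_power)

lemma zeta_power_mod: "p > 0 \<Longrightarrow> zeta p ^ (n mod p) = zeta p ^ n"
proof -
  assume "p > 0"
  have "zeta p ^ n = zeta p ^ (p * (n div p) + n mod p)" by simp
  also have "\<dots> = zeta p ^ (n mod p)"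
    unfolding power_add power_mult using zeta_power_self[OF \<open>p > 0\<close>] by simp
  finally show ?thesis by simp
qed

lemma cos_less_1:
  assumes "0 < x" "x < 2 * pi"
  shows "cos x < 1"
proof -
  have "cos x \<noteq> 1"
  proof
    assume "cos x = 1"
    then obtain n :: int where n: "x = of_int n * (2 * pi)"
      using cos_one_2pi_int[of x] by (auto simp: mult.assoc)
    then have "0 < n" "real_of_int n < 1"
      using assms by (simp_all add: zero_less_mult_iff mult_less_cancel_right2)
    then show False by simp
  qed
  then show ?thesis by (simp add: order_less_le)
qed

lemma zeta_power_inj:
  assumes "zeta p ^ m = zeta p ^ n" "m < p" "n < p"
  shows "m = n"
proof (rule ccontr)
  assume "m \<noteq> n"
  have *: "zeta p ^ m \<noteq> zeta p ^ n" if "m < n" "n < p" for m n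
  proof
    assume "zeta p ^ m = zeta p ^ n"
    then have "zeta p ^ (n - m) = 1"
      using \<open>m < n\<close> power_add[of "zeta p" m "n - m"] by simp
    then have "cos (2 * pi * real (n - m) / real p) = 1"
      unfolding zeta_power by (metis cis.sel(1) one_complex.sel(1))
    moreover have "0 < 2 * pi * real (n - m) / real p" "2 * pi * real (n - m) / real p < 2 * pi"
      using that by (simp_all add: pos_divide_less_eq)
    ultimately show False
      using cos_less_1[of "2 * pi * real (n - m) / real p"] by linarith
  qed
  show False
    using *[of m n] *[of n m] assms \<open>m \<noteq> n\<close> by (metis linorder_neqE_nat)
qed

lemma vert_eq: "vert p k = zeta p ^ k * vert p 0"
  unfolding zeta_power vert_def by (simp add: cis_mult algebra_simps)

lemma vert_add: "vert p (k + n) = zeta p ^ n * vert p k"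
  using vert_eq[of p "k + n"] vert_eq[of p k] by (simp add: power_add)

lemma vert_mod: "p > 0 \<Longrightarrow> vert p (k mod p) = vert p k"
  by (metis vert_eq zeta_power_mod)

lemma norm_vert [simp]: "cmod (vert p k) = 1"
  by (simp add: vert_def)

lemma vert_nonzero [simp]: "vert p k \<noteq> 0"
  by (metis norm_vert norm_zero zero_neq_one)

lemma side_vec_add: "side_vec p (k + n) = zeta p ^ n * side_vec p k"
  using vert_add[of p "k + 1" n] vert_add[of p k n] by (simp add: side_vec_def algebra_simps)

lemma side_vec_eq: "side_vec p k = zeta p ^ k * side_vec p 0"
  using side_vec_add[of p 0 k] by simp

lemma side_vec_mod: "p > 0 \<Longrightarrow> side_vec p (k mod p) = side_vec p k"
  by (metis side_vec_eq zeta_power_mod)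

lemma vert_Suc_mod: "p > 0 \<Longrightarrow> vert p (k mod p + 1) = vert p (k + 1)"
  using vert_add[of p "k mod p" 1] vert_add[of p k 1] vert_mod[of p k] by simp

lemma side_pt_add: "side_pt p (k + n) s = zeta p ^ n * side_pt p k s"
  by (simp add: side_pt_def vert_add side_vec_add algebra_simps)

lemma side_pt_mod: "p > 0 \<Longrightarrow> side_pt p (k mod p) s = side_pt p k s"
  by (simp add: side_pt_def vert_mod side_vec_mod)

lemma sector_add: "sector p (k + n) = (\<lambda>x. zeta p ^ n * x) ` sector p k"
proof -
  have *: "zeta p ^ n * x \<in> sector p (k + n) \<longleftrightarrow> x \<in> sector p k" for x
  proof -
    have u: "zeta p ^ n * cnj (zeta p ^ n) = 1"
      using complex_norm_square[of "zeta p ^ n"] by (simp add: norm_power)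
    have "zeta p ^ n * x * cnj (vert p (k + n)) = (zeta p ^ n * cnj (zeta p ^ n)) * (x * cnj (vert p k))"
      unfolding vert_add by (simp add: algebra_simps)
    moreover have "vert p (k + n + 1) * cnj (zeta p ^ n * x) = (zeta p ^ n * cnj (zeta p ^ n)) * (vert p (k + 1) * cnj x)"
      using vert_add[of p "k + 1" n] by (simp add: algebra_simps)
    ultimately show ?thesis unfolding u sector_def mem_Collect_eq by (simp only: mult_1)
  qed
  have "x \<in> (\<lambda>x. zeta p ^ n * x) ` sector p k" if "x \<in> sector p (k + n)" for x
    using *[of "x / zeta p ^ n"] that by (intro image_eqI[of _ _ "x / zeta p ^ n"]) auto
  with * show ?thesis by auto
qed

lemma sector_mod: "p > 0 \<Longrightarrow> sector p (k mod p) = sector p k"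
  unfolding sector_def vert_Suc_mod vert_mod ..

lemma open_sector: "open (sector p k)"
  unfolding sector_def by (intro open_Collect_conj open_Collect_less continuous_intros)

section \<open>Cross products, sides and sectors\<close>

lemma Im_vert_cnj: "Im (vert p i * cnj (vert p j)) = sin (2 * pi * (real i - real j) / real p)"
proof -
  have "vert p i * cnj (vert p j) = cis (2 * pi * (real i - real j) / real p)"
    unfolding vert_def cis_cnj cis_mult by (simp add: algebra_simps diff_divide_distrib)
  then show ?thesis by simp
qed


lemma side_eq: "side p k = side_pt p k ` {0..1}"
proof -
  have "side_pt p k s = (1 - s) *\<^sub>R vert p k + s *\<^sub>R vert p (k + 1)" for s
    by (simp add: side_pt_def side_vec_def scaleR_conv_of_real algebra_simps)
  then show ?thesis
    unfolding side_def closed_segment_def by auto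
qed

lemma side_pt_0 [simp]: "side_pt p k 0 = vert p k"
  and side_pt_1 [simp]: "side_pt p k 1 = vert p (k + 1)"
  by (simp_all add: side_pt_def side_vec_def)

lemma side_vec_nonzero:
  assumes "p \<ge> 3"
  shows "side_vec p k \<noteq> 0"
proof
  assume "side_vec p k = 0"
  then have "zeta p ^ 1 = zeta p ^ 0"
    using vert_add[of p k 1] by (simp add: side_vec_def)
  then show False
    using zeta_power_inj[of p 1 0] assms by simp
qed

lemma side_pt_inj: "p \<ge> 3 \<Longrightarrow> side_pt p k s = side_pt p k t \<Longrightarrow> s = t"
  using side_vec_nonzero[of p k] by (simp add: side_pt_def)

lemma glue_map_side_pt: "p \<ge> 3 \<Longrightarrow> glue_map p k l (side_pt p k s) = side_pt p l (1 - s)"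
proof -
  assume "p \<ge> 3"
  then have "glue_rot p k l * (of_real s * side_vec p k) = - of_real s * side_vec p l"
    using side_vec_nonzero[of p k] by (simp add: glue_rot_def)
  then show ?thesis
    by (simp add: glue_map_def side_pt_def) (simp add: side_vec_def algebra_simps)
qed

lemma Im_mult_of_real: "Im (of_real a * z) = a * Im z"
  by simp

lemma Im_side_pt:
  "Im (side_pt p j s * cnj (vert p k)) =
     (1 - s) * sin (2 * pi * (real j - real k) / real p) + s * sin (2 * pi * (real j + 1 - real k) / real p)"
  "Im (vert p k * cnj (side_pt p j s)) =
     (1 - s) * sin (2 * pi * (real k - real j) / real p) + s * sin (2 * pi * (real k - real j - 1) / real p)"
proof -
  have e: "side_pt p j s = of_real (1 - s) * vert p j + of_real s * vert p (j + 1)"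
    by (simp add: side_pt_def side_vec_def algebra_simps)
  have "side_pt p j s * cnj (vert p k) =
      of_real (1 - s) * (vert p j * cnj (vert p k)) + of_real s * (vert p (j + 1) * cnj (vert p k))"
    unfolding e by (simp add: algebra_simps)
  then have "Im (side_pt p j s * cnj (vert p k)) =
      (1 - s) * Im (vert p j * cnj (vert p k)) + s * Im (vert p (j + 1) * cnj (vert p k))"
    by (simp only: plus_complex.sel Im_mult_of_real)
  then show "Im (side_pt p j s * cnj (vert p k)) =
     (1 - s) * sin (2 * pi * (real j - real k) / real p) + s * sin (2 * pi * (real j + 1 - real k) / real p)"
    unfolding Im_vert_cnj by (simp add: algebra_simps)
  have "vert p k * cnj (side_pt p j s) =
      of_real (1 - s) * (vert p k * cnj (vert p j)) + of_real s * (vert p k * cnj (vert p (j + 1)))"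
    unfolding e by (simp add: algebra_simps)
  then have "Im (vert p k * cnj (side_pt p j s)) =
      (1 - s) * Im (vert p k * cnj (vert p j)) + s * Im (vert p k * cnj (vert p (j + 1)))"
    by (simp only: plus_complex.sel Im_mult_of_real)
  then show "Im (vert p k * cnj (side_pt p j s)) =
     (1 - s) * sin (2 * pi * (real k - real j) / real p) + s * sin (2 * pi * (real k - real j - 1) / real p)"
    unfolding Im_vert_cnj by (simp add: algebra_simps)
qed

lemma side_pt_in_sector:
  assumes "p \<ge> 3" "0 < s" "s < 1"
  shows "side_pt p k s \<in> sector p k"
proof -
  have "0 < sin (2 * pi / real p)"
    by (rule sin_gt_zero) (use assms in \<open>simp_all add: pos_divide_less_eq\<close>)
  then show ?thesis
    using assms by (simp only: sector_def mem_Collect_eq Im_side_pt) simp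
qed

text \<open>Every other side lies on the wrong side of one of the two bounding rays. If
  \<open>2 * m\<close> is at least \<open>p\<close>, both ends of side \<open>m\<close> have angle
  between \<pi> and 2\<pi> from vertex 0, so they are not to its left; otherwise both have angle
  between 0 and \<pi> from vertex 1, so they are not to its right.\<close>

lemma side_pt_notin_sector_0:
  assumes "0 < m" "m < p" "0 \<le> s" "s \<le> 1"
  shows "side_pt p m s \<notin> sector p 0"
proof (cases "p \<le> 2 * m")
  case True
  let ?a = "2 * pi * real m / real p" and ?b = "2 * pi * (real m + 1) / real p"
  have "real p \<le> 2 * real m" "real m + 1 \<le> real p" using True assms by linarith+
  then have a: "pi \<le> ?a" "?a \<le> 2 * pi" and b: "pi \<le> ?b" "?b \<le> 2 * pi"
    using assms by (simp_all add: pos_le_divide_eq pos_divide_le_eq)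
  have neg: "sin x \<le> 0" if "pi \<le> x" "x \<le> 2 * pi" for x
    using sin_ge_zero[of "x - pi"] that by simp
  have "Im (side_pt p m s * cnj (vert p 0)) \<le> 0"
    unfolding Im_side_pt using neg[OF a] neg[OF b] assms
    by (simp add: add_nonpos_nonpos mult_nonneg_nonpos)
  then show ?thesis by (auto simp: sector_def)
next
  case False
  let ?a = "2 * pi * (real m - 1) / real p" and ?b = "2 * pi * real m / real p"
  have "2 * real m \<le> real p" "1 \<le> real m" using False assms by linarith+
  then have "2 * (real m - 1) \<le> real p" "2 * real m \<le> real p" "real p > 0" using assms by simp_all
  then have "pi * (2 * (real m - 1)) \<le> pi * real p" "pi * (2 * real m) \<le> pi * real p"
    by (intro mult_left_mono; simp)+
  with \<open>1 \<le> real m\<close> \<open>real p > 0\<close> have a: "0 \<le> ?a" "?a \<le> pi" and b: "0 \<le> ?b" "?b \<le> pi"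
    by (simp_all add: pos_divide_le_eq mult.assoc mult.left_commute)
  have e: "2 * pi * (real (0 + 1) - real m) / real p = - ?a"
     "2 * pi * (real (0 + 1) - real m - 1) / real p = - ?b" by (simp_all add: algebra_simps diff_divide_distrib)
  have "Im (vert p (0 + 1) * cnj (side_pt p m s)) \<le> 0"
    unfolding Im_side_pt e sin_minus using sin_ge_zero[OF a] sin_ge_zero[OF b] assms
    by (intro add_nonpos_nonpos mult_nonneg_nonpos) simp_all
  then show ?thesis by (simp add: sector_def)
qed

lemma side_pt_notin_sector:
  assumes "j < p" "k < p" "j \<noteq> k" "0 \<le> s" "s \<le> 1"
  shows "side_pt p j s \<notin> sector p k"
proof
  assume "side_pt p j s \<in> sector p k"
  \<comment> \<open>Rotating back by \<open>k\<close> reduces to sector 0; adding \<open>p\<close>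
    first keeps the difference of the indices a natural number.\<close>
  moreover have "side_pt p j s = side_pt p ((j + p - k) + k) s"
    using side_pt_mod[of p "j + p" s] side_pt_mod[of p j s] assms by simp
  ultimately have "zeta p ^ k * side_pt p (j + p - k) s \<in> (\<lambda>x. zeta p ^ k * x) ` sector p 0"
    using sector_add[of p 0 k] side_pt_add[of p "j + p - k" k s] by simp
  then have "side_pt p ((j + p - k) mod p) s \<in> sector p 0"
    using assms by (auto simp: side_pt_mod)
  moreover have "(j + p - k) mod p \<noteq> 0"
  proof (cases "k \<le> j")
    case True
    then have "(j + p - k) mod p = j - k" using assms by (simp add: mod_if)
    with True assms show ?thesis by simp
  next
    case False
    with assms show ?thesis by simp
  qed
  ultimately show False
    using side_pt_notin_sector_0[of "(j + p - k) mod p" p s] assms by simp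
qed

lemma vert_notin_sector:
  assumes "k < p"
  shows "vert p j \<notin> sector p k"
proof (cases "j mod p = k")
  case True
  then have "vert p j = vert p k" using vert_mod[of p j] assms by simp
  then show ?thesis by (simp add: sector_def)
next
  case False
  then show ?thesis
    using side_pt_notin_sector[of "j mod p" p k 0] assms by (simp add: vert_mod)
qed

lemma scale_in_sector: "0 < r \<Longrightarrow> of_real r * x \<in> sector p k \<longleftrightarrow> x \<in> sector p k"
proof -
  have "of_real r * x * cnj y = of_real r * (x * cnj y)" "y * cnj (of_real r * x) = of_real r * (y * cnj x)" for y
    by simp_all
  moreover assume "0 < r"
  ultimately show ?thesis
    unfolding sector_def mem_Collect_eq by (simp only: Im_mult_of_real zero_less_mult_iff) auto
qed

lemma zero_notin_sector: "0 \<notin> sector p k"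
  by (simp add: sector_def)

text \<open>By Cramer's rule a point of sector \<open>j\<close> is a combination of the two vertices
  with positive coefficients, hence a positive multiple of an inner point of side \<open>j\<close>.
  Sectors are cones, so a common point would put that side point into sector
  \<open>k\<close>.\<close>

lemma disjoint_sectors:
  assumes "p \<ge> 3" "j < p" "k < p" "j \<noteq> k"
  shows "sector p j \<inter> sector p k = {}"
proof (rule ccontr)
  assume "sector p j \<inter> sector p k \<noteq> {}"
  then obtain x where x: "x \<in> sector p j" "x \<in> sector p k" by auto
  define \<alpha> \<beta> where "\<alpha> = Im (vert p (j + 1) * cnj x)" and "\<beta> = Im (x * cnj (vert p j))"
  define c where "c = Im (vert p (j + 1) * cnj (vert p j))"
  have pos: "\<alpha> > 0" "\<beta> > 0"
    using x(1) by (auto simp only: sector_def mem_Collect_eq \<alpha>_def \<beta>_def)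
  have "of_real c * x = of_real \<alpha> * vert p j + of_real \<beta> * vert p (j + 1)"
    unfolding c_def \<alpha>_def \<beta>_def complex_eq_iff by (simp add: algebra_simps)
  also have "\<dots> = of_real (\<alpha> + \<beta>) * side_pt p j (\<beta> / (\<alpha> + \<beta>))"
  proof -
    have "of_real (\<alpha> + \<beta>) * (of_real (\<beta> / (\<alpha> + \<beta>)) :: complex) = of_real \<beta>"
      using pos unfolding of_real_mult[symmetric] by simp
    then have "of_real (\<alpha> + \<beta>) * (of_real (\<beta> / (\<alpha> + \<beta>)) * side_vec p j) = of_real \<beta> * side_vec p j"
      by (metis mult.assoc)
    then show ?thesis
      by (simp only: side_pt_def ring_distribs) (simp add: side_vec_def algebra_simps)
  qed
  finally have e: "of_real c * x = of_real (\<alpha> + \<beta>) * side_pt p j (\<beta> / (\<alpha> + \<beta>))" .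
  have "c = sin (2 * pi / real p)"
    unfolding c_def Im_vert_cnj by simp
  also have "\<dots> > 0"
    by (rule sin_gt_zero) (use assms in \<open>simp_all add: pos_divide_less_eq\<close>)
  finally have "c > 0" .
  then have "of_real c * x \<in> sector p k"
    using x(2) scale_in_sector by blast
  then have "side_pt p j (\<beta> / (\<alpha> + \<beta>)) \<in> sector p k"
    unfolding e using scale_in_sector[of "\<alpha> + \<beta>"] pos by simp
  then show False
    using side_pt_notin_sector[of j p k "\<beta> / (\<alpha> + \<beta>)"] assms pos by simp
qed

section \<open>The polygon as a convex set\<close>

lemma polygon_vert: "p > 0 \<Longrightarrow> vert p k \<in> polygon p"
  unfolding polygon_def by (rule hull_inc) (metis imageI lessThan_iff mod_less_divisor vert_mod)

lemma convex_polygon: "convex (polygon p)"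
  by (simp add: polygon_def)

lemma side_subset_polygon: "p > 0 \<Longrightarrow> side p k \<subseteq> polygon p"
  unfolding side_def by (intro closed_segment_subset convex_polygon polygon_vert)

lemma side_pt_in_polygon: "p > 0 \<Longrightarrow> 0 \<le> s \<Longrightarrow> s \<le> 1 \<Longrightarrow> side_pt p k s \<in> polygon p"
  using side_subset_polygon[of p k] by (auto simp: side_eq)

lemma rotate_polygon:
  assumes "p > 0"
  shows "(\<lambda>x. zeta p ^ n * x) ` polygon p = polygon p"
proof -
  have "(\<lambda>x. zeta p ^ n * x) ` vert p ` {..<p} = vert p ` {..<p}"
  proof (rule card_seteq[of "vert p ` {..<p}"])
    show "(\<lambda>x. zeta p ^ n * x) ` vert p ` {..<p} \<subseteq> vert p ` {..<p}"
    proof clarify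
      fix k
      have "zeta p ^ n * vert p k = vert p ((k + n) mod p)"
        using assms by (simp add: vert_mod vert_add)
      then show "zeta p ^ n * vert p k \<in> vert p ` {..<p}" using assms by simp
    qed
    have "inj_on (\<lambda>x. zeta p ^ n * x) (vert p ` {..<p})" by (auto simp: inj_on_def)
    then show "card (vert p ` {..<p}) \<le> card ((\<lambda>x. zeta p ^ n * x) ` vert p ` {..<p})"
      by (simp add: card_image)
  qed auto
  then show ?thesis
    unfolding polygon_def
    using convex_hull_linear_image[of "\<lambda>x. zeta p ^ n * x" "vert p ` {..<p}"]
    by (simp add: bounded_linear.linear bounded_linear_mult_right)
qed

lemma rotate_in_polygon: "p > 0 \<Longrightarrow> zeta p ^ n * x \<in> polygon p \<longleftrightarrow> x \<in> polygon p"
  using rotate_polygon[of p n] inj_image_mem_iff[of "\<lambda>x. zeta p ^ n * x" x "polygon p"]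
  by (simp add: inj_def)

lemma sum_vert:
  assumes "p \<ge> 2"
  shows "(\<Sum>k<p. vert p k) = 0"
proof -
  have "zeta p \<noteq> 1"
    using zeta_power_inj[of p 1 0] assms by auto
  then have "(\<Sum>k<p. zeta p ^ k) = 0"
    using assms by (simp add: geometric_sum zeta_power_self)
  moreover have "(\<Sum>k<p. vert p k) = (\<Sum>k<p. zeta p ^ k) * vert p 0"
    unfolding sum_distrib_right by (rule sum.cong) (rule refl, rule vert_eq)
  ultimately show ?thesis by simp
qed

lemma zero_in_polygon:
  assumes "p \<ge> 3"
  shows "0 \<in> polygon p"
proof -
  have "(\<Sum>k<p. (1 / real p) *\<^sub>R vert p k) \<in> polygon p"
    using assms by (intro convex_sum convex_polygon polygon_vert) auto
  also have "(\<Sum>k<p. (1 / real p) *\<^sub>R vert p k) = 0"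
    unfolding scaleR_sum_right[symmetric] using sum_vert[of p] assms by simp
  finally show ?thesis .
qed

lemma scale_in_polygon:
  assumes "p \<ge> 3" "x \<in> polygon p" "0 \<le> r" "r \<le> 1"
  shows "of_real r * x \<in> polygon p"
  using convexD[OF convex_polygon assms(2) zero_in_polygon[OF assms(1)], of r "1 - r"] assms
  by (simp add: scaleR_conv_of_real)

lemma polygon_subset_cball: "polygon p \<subseteq> cball 0 1"
  unfolding polygon_def by (intro hull_minimal) auto

text \<open>The disc is strictly convex, so a point of the polygon on the unit circle is extreme,
  and the extreme points of a convex hull are among its generators.\<close>

lemma polygon_norm_1:
  assumes "x \<in> polygon p" "cmod x = 1"
  obtains k where "k < p" "x = vert p k"
proof -
  have "x extreme_point_of polygon p"
    unfolding extreme_point_of_def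
  proof (intro conjI ballI notI assms)
    fix a b assume "a \<in> polygon p" "b \<in> polygon p" "x \<in> open_segment a b"
    then have "cmod a \<le> 1" "cmod b \<le> 1" "cmod x < cmod a \<or> cmod x < cmod b"
      using polygon_subset_cball[of p] dist_decreases_open_segment[of x a b 0] by auto
    with assms show False by auto
  qed
  then show thesis
    using extreme_point_of_convex_hull[of x "vert p ` {..<p}"] that unfolding polygon_def by blast
qed


section \<open>Isometries of the polygon\<close>

lemma polygon_left_of_side:
  assumes "p \<ge> 3" "x \<in> polygon p" and l: "l < p"
  shows "0 \<le> Im ((x - vert p l) * cnj (side_vec p l))"
proof -
  let ?H = "{x. 0 \<le> Im ((x - vert p l) * cnj (side_vec p l))}"
  have "convex ?H"
  proof -
    have "?H = (\<lambda>x. Im (x * cnj (side_vec p l))) -` {Im (vert p l * cnj (side_vec p l))..}"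
      by (auto simp: algebra_simps)
    moreover have "linear (\<lambda>x. Im (x * cnj (side_vec p l)))"
      by (rule linearI) (simp_all add: algebra_simps)
    ultimately show ?thesis
      by (simp add: convex_linear_vimage)
  qed
  moreover have "vert p j \<in> ?H" if "j < p" for j
  proof -
    define u v where "u = pi * (real j - real l) / real p" and "v = pi / real p"
    have "Im ((vert p j - vert p l) * cnj (side_vec p l)) =
        Im (vert p j * cnj (vert p (l + 1))) - Im (vert p j * cnj (vert p l))
        - Im (vert p l * cnj (vert p (l + 1))) + Im (vert p l * cnj (vert p l))"
      by (simp add: side_vec_def algebra_simps)
    also have "\<dots> = sin (2 * u - 2 * v) - sin (2 * u) + sin (2 * v)"
      unfolding Im_vert_cnj u_def v_def
      by (simp add: algebra_simps diff_divide_distrib add_divide_distrib)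
    \<comment> \<open>In this product \<open>u\<close> and \<open>u - v\<close> are \<pi>/p times
      \<open>j - l\<close> and \<open>j - l - 1\<close>. No integer lies strictly between
      \<open>l\<close> and \<open>l + 1\<close>, so both angles are in [0, \<pi>] or both in
      [-\<pi>, 0], and their sines have the same sign.\<close>
    also have "\<dots> = 4 * sin v * (sin u * sin (u - v))"
      unfolding sin_diff sin_double cos_double_sin by (simp add: power2_eq_square algebra_simps)
    finally have Im: "Im ((vert p j - vert p l) * cnj (side_vec p l)) = 4 * sin v * (sin u * sin (u - v))" .
    have "0 \<le> 4 * sin v * (sin u * sin (u - v))"
    proof (rule mult_nonneg_nonneg)
      have "0 \<le> sin v"
        unfolding v_def using assms by (intro sin_ge_zero) (simp_all add: pos_divide_le_eq)
      then show "0 \<le> 4 * sin v" by simp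
      have uv: "u - v = pi * (real j - real l - 1) / real p"
        by (simp add: u_def v_def diff_divide_distrib add_divide_distrib algebra_simps)
      show "0 \<le> sin u * sin (u - v)"
      proof (cases "l < j")
        case True
        then have "0 \<le> u" "u \<le> pi" "0 \<le> u - v" "u - v \<le> pi"
          unfolding uv unfolding u_def using assms that by (auto simp: pos_divide_le_eq)
        then show ?thesis by (intro mult_nonneg_nonneg sin_ge_zero)
      next
        case False
        have neg: "- u = pi * (real l - real j) / real p" "- (u - v) = pi * (real l + 1 - real j) / real p"
          unfolding uv unfolding u_def by (simp_all add: minus_divide_left algebra_simps)
        have "0 \<le> real l - real j" "real l - real j \<le> real p" "0 \<le> real l + 1 - real j" "real l + 1 - real j \<le> real p"
          using False l by linarith+
        then have "0 \<le> - u" "- u \<le> pi" "0 \<le> - (u - v)" "- (u - v) \<le> pi"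
          unfolding neg using assms by (simp_all add: pos_divide_le_eq)
        then have "0 \<le> sin (- u) * sin (- (u - v))" by (intro mult_nonneg_nonneg sin_ge_zero)
        then show ?thesis unfolding sin_minus by simp
      qed
    qed
    then show ?thesis unfolding mem_Collect_eq Im .
  qed
  ultimately have "polygon p \<subseteq> ?H"
    unfolding polygon_def by (intro hull_minimal) auto
  with assms show ?thesis by auto
qed

text \<open>The distances to two points of a line determine a point up to reflection in the line.
  Here the line contains a side and the polygon lies on one side of it, so the reflected position is
  ruled out. Parameters \<open>s\<close> and \<open>t\<close> are kept general: sometimes the ends
  of the side are known, sometimes only inner points.\<close>

lemma isometry_eq_rotation:
  assumes p: "p \<ge> 3" and A: "A ` polygon p \<subseteq> polygon p"
    and iso: "\<And>x y. x \<in> polygon p \<Longrightarrow> y \<in> polygon p \<Longrightarrow> dist (A x) (A y) = dist x y"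
    and s: "0 \<le> s" "s \<le> 1" "0 \<le> t" "t \<le> 1" "s < t"
    and eq: "A (side_pt p l s) = zeta p ^ n * side_pt p l s" "A (side_pt p l t) = zeta p ^ n * side_pt p l t"
    and x: "x \<in> polygon p" and l: "l < p"
  shows "A x = zeta p ^ n * x"
proof -
  define y where "y = A x / zeta p ^ n"
  have Ay: "A x = zeta p ^ n * y" by (simp add: y_def)
  have "zeta p ^ n * y \<in> polygon p" using A x Ay by auto
  then have y: "y \<in> polygon p" using p by (simp add: rotate_in_polygon)
  have rot: "dist (zeta p ^ n * a) (zeta p ^ n * b) = dist a b" for a b
    by (simp add: dist_norm norm_mult norm_power flip: right_diff_distrib)
  have d: "dist y (side_pt p l r) = dist x (side_pt p l r)" if "r = s \<or> r = t" for r
  proof -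
    have "dist x (side_pt p l r) = dist (A x) (A (side_pt p l r))"
      using iso[OF x side_pt_in_polygon, of r l] p s that by auto
    also have "\<dots> = dist (zeta p ^ n * y) (zeta p ^ n * side_pt p l r)"
      using eq that Ay by auto
    finally show ?thesis by (simp add: rot)
  qed
  \<comment> \<open>Coordinates with origin at vertex \<open>l\<close> and the side as real axis,
    scaled by the length of the side; \<open>r * L\<close> is then the position of the point with
    parameter \<open>r\<close>.\<close>
  define X Y where "X = (x - vert p l) * cnj (side_vec p l)" and "Y = (y - vert p l) * cnj (side_vec p l)"
  define L where "L = (cmod (side_vec p l))\<^sup>2"
  have L: "L > 0" using side_vec_nonzero[OF p] by (simp add: L_def)
  have scal: "cmod (z - side_pt p l r) * cmod (side_vec p l) =
      cmod ((z - vert p l) * cnj (side_vec p l) - of_real (r * L))" for z r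
  proof -
    have "(z - side_pt p l r) * cnj (side_vec p l) =
        (z - vert p l) * cnj (side_vec p l) - of_real r * (side_vec p l * cnj (side_vec p l))"
      by (simp add: side_pt_def algebra_simps)
    then show ?thesis
      by (metis L_def complex_mod_cnj complex_norm_square norm_mult of_real_mult)
  qed
  have "cmod (X - of_real (r * L)) = cmod (Y - of_real (r * L))" if "r = s \<or> r = t" for r
    using d[OF that] scal[of x r] scal[of y r] by (simp add: X_def Y_def dist_norm)
  then have q: "(Re X - r * L)\<^sup>2 + (Im X)\<^sup>2 = (Re Y - r * L)\<^sup>2 + (Im Y)\<^sup>2" if "r = s \<or> r = t" for r
    using that by (metis Im_complex_of_real Re_complex_of_real cmod_power2 diff_zero minus_complex.sel)
  have "2 * (t - s) * L * Re X = 2 * (t - s) * L * Re Y"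
    using q[of s] q[of t] by (simp add: power2_eq_square algebra_simps)
  then have "Re X = Re Y" using L s by simp
  have "(Im X)\<^sup>2 = (Im Y)\<^sup>2"
    using q[of s] unfolding \<open>Re X = Re Y\<close> by simp
  then have "Im X = Im Y"
    by (rule power2_eq_imp_eq)
      (use polygon_left_of_side[OF p x l] polygon_left_of_side[OF p y l] in \<open>simp_all only: X_def Y_def\<close>)
  with \<open>Re X = Re Y\<close> have "X = Y" by (rule complex_eqI)
  then have "x = y" using side_vec_nonzero[OF p, of l] by (simp add: X_def Y_def)
  with Ay show ?thesis by simp
qed

text \<open>The translation part vanishes by averaging: the polygon is contained in the unit disc
  around \<open>b\<close>, whereas the mean of the squared distances of the vertices from
  \<open>b\<close> is \<open>1 + (cmod b)\<^sup>2\<close>, because the vertices sum to 0. The linear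
  part then sends vertex 0 to a point of norm 1 in the polygon, that is, to a vertex.\<close>

lemma orientation_preserving_rotation:
  assumes p: "p \<ge> 3" and A: "A ` polygon p = polygon p" and op: "orientation_preserving_on (polygon p) A"
  obtains n where "n < p" "\<And>x. x \<in> polygon p \<Longrightarrow> A x = zeta p ^ n * x"
proof -
  obtain a b where ab: "cmod a = 1" "\<And>x. x \<in> polygon p \<Longrightarrow> A x = a * x + b"
    using op unfolding orientation_preserving_on_def by auto
  have "polygon p \<subseteq> cball b 1"
  proof
    fix y assume "y \<in> polygon p"
    then obtain x where "x \<in> polygon p" "y = a * x + b" using A ab by (metis imageE)
    then show "y \<in> cball b 1"
      using polygon_subset_cball[of p] ab by (auto simp: dist_norm norm_mult)
  qed
  then have le: "(cmod (vert p k - b))\<^sup>2 \<le> 1" for k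
    using polygon_vert[of p k] p by (auto simp: dist_norm norm_minus_commute abs_square_le_1)
  have sq: "(cmod (vert p k - b))\<^sup>2 = 1 + (cmod b)\<^sup>2 - 2 * Re (vert p k * cnj b)" for k
  proof -
    have "(Re (vert p k))\<^sup>2 + (Im (vert p k))\<^sup>2 = 1"
      by (metis cmod_power2 norm_vert one_power2)
    then show ?thesis
      unfolding cmod_power2 by (simp add: power2_eq_square algebra_simps)
  qed
  have "(\<Sum>k<p. Re (vert p k * cnj b)) = Re ((\<Sum>k<p. vert p k) * cnj b)"
    by (simp add: sum_distrib_right)
  then have "(\<Sum>k<p. (cmod (vert p k - b))\<^sup>2) = real p * (1 + (cmod b)\<^sup>2)"
    unfolding sq sum_subtractf sum_distrib_left[symmetric] using p by (simp add: sum_vert)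
  moreover have "(\<Sum>k<p. (cmod (vert p k - b))\<^sup>2) \<le> (\<Sum>k<p. 1)"
    by (intro sum_mono le)
  ultimately have "real p * (1 + (cmod b)\<^sup>2) \<le> real p * 1" by simp
  then have "1 + (cmod b)\<^sup>2 \<le> 1" using p by (subst (asm) mult_le_cancel_left_pos) simp_all
  then have "(cmod b)\<^sup>2 \<le> 0" by linarith
  then have b: "b = 0" by simp
  have "a * vert p 0 \<in> polygon p"
  proof -
    have "A (vert p 0) \<in> A ` polygon p" using p by (intro imageI polygon_vert) simp
    then show ?thesis using ab(2)[OF polygon_vert[of p 0]] p b unfolding A by simp
  qed
  then obtain k where k: "k < p" "a * vert p 0 = vert p k"
    using polygon_norm_1[of "a * vert p 0" p] ab(1) by (metis norm_mult norm_vert mult_1)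
  then have "a = zeta p ^ k"
    using vert_eq[of p k] by (metis mult_right_cancel vert_nonzero)
  with that[of k] k ab b show thesis by auto
qed

text \<open>Inner points of sides lie in open sectors, and spokes run along the boundaries of
  sectors; the ends of a side have norm 1. This supplies points with a single representative: the
  centre for \<open>r = 0\<close>, and points that detect a rotation for
  \<open>r > 0\<close>.\<close>

lemma spoke_notin_side:
  assumes "p \<ge> 3" "0 \<le> r" "r < 1"
  shows "of_real r * vert p j \<notin> side p k"
proof
  assume "of_real r * vert p j \<in> side p k"
  then obtain s where s: "0 \<le> s" "s \<le> 1" "of_real r * vert p j = side_pt p (k mod p) s"
    using assms by (auto simp: side_eq side_pt_mod)
  have n: "cmod (of_real r * vert p j) < 1" using assms by (simp add: norm_mult)
  have "s \<noteq> 0" "s \<noteq> 1" using s n by (auto simp del: norm_of_real)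
  then have "of_real r * vert p j \<in> sector p (k mod p)"
    unfolding s(3) using s assms by (intro side_pt_in_sector) auto
  then have "vert p j \<in> sector p (k mod p)"
    using assms scale_in_sector[of r] zero_notin_sector by (cases "r = 0") auto
  then show False
    using vert_notin_sector[of "k mod p" p j] assms by simp
qed

section \<open>Points of a glued surface\<close>

definition darts :: "'f polysurf \<Rightarrow> ('f \<times> nat) set" where
  "darts S = faces S \<times> {..<gon S}"

text \<open>The conditions of \<open>connected_surface\<close> on the pairing of sides, without the
  topological one, so that \<open>Pi_surface\<close> is covered as well; its connectedness is
  checked on darts.\<close>

definition gluing :: "'f polysurf \<Rightarrow> bool" where
  "gluing S \<longleftrightarrow> gon S \<ge> 3 \<and>
     (\<forall>s \<in> darts S. glue S s \<in> darts S \<and> glue S s \<noteq> s \<and> glue S (glue S s) = s)"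

definition cells :: "'f polysurf \<Rightarrow> ('f \<times> complex) set" where
  "cells S = faces S \<times> poly_of S"

definition corners :: "nat \<Rightarrow> complex set" where
  "corners p = vert p ` {..<p}"

lemma gluing_gon: "gluing S \<Longrightarrow> gon S \<ge> 3"
  by (simp add: gluing_def)

lemma connected_surface_gluing: "connected_surface S \<Longrightarrow> gluing S"
  by (auto simp: connected_surface_def gluing_def darts_def)

lemma glue_dart:
  assumes "gluing S" "f \<in> faces S" "k < gon S" "glue S (f, k) = (g, l)"
  shows "g \<in> faces S" "l < gon S" "glue S (g, l) = (f, k)" "(g, l) \<noteq> (f, k)"
proof -
  have "(f, k) \<in> darts S" using assms by (simp add: darts_def)
  then have "glue S (f, k) \<in> darts S \<and> glue S (f, k) \<noteq> (f, k) \<and> glue S (glue S (f, k)) = (f, k)"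
    using assms(1) unfolding gluing_def by blast
  then show "g \<in> faces S" "l < gon S" "glue S (g, l) = (f, k)" "(g, l) \<noteq> (f, k)"
    unfolding assms(4) by (auto simp: darts_def)
qed

text \<open>The sector over a side contains the inner points of that side and no point of another
  side. Hence only one of the two parameters has to be an inner one.\<close>

lemma side_pt_unique:
  assumes "p \<ge> 3" "j < p" "k < p" "0 < s" "s < 1" "0 \<le> t" "t \<le> 1" "side_pt p k s = side_pt p j t"
  shows "j = k" "t = s"
proof -
  have "side_pt p j t \<in> sector p k"
    using assms by (metis side_pt_in_sector)
  then show "j = k" using side_pt_notin_sector assms by blast
  with assms show "t = s" using side_pt_inj by blast
qed

lemma corner_vert: "p > 0 \<Longrightarrow> vert p k \<in> corners p"
  unfolding corners_def by (metis imageI lessThan_iff mod_less_divisor vert_mod)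

lemma side_pt_corner_iff:
  assumes "p \<ge> 3" "k < p" "0 \<le> s" "s \<le> 1"
  shows "side_pt p k s \<in> corners p \<longleftrightarrow> s = 0 \<or> s = 1"
proof
  assume "side_pt p k s \<in> corners p"
  then have "side_pt p k s \<notin> sector p k"
    using vert_notin_sector assms by (auto simp: corners_def)
  then show "s = 0 \<or> s = 1"
    using side_pt_in_sector[of p s k] assms by fastforce
next
  assume "s = 0 \<or> s = 1"
  then show "side_pt p k s \<in> corners p"
    using corner_vert[of p k] corner_vert[of p "k + 1"] assms by auto
qed

lemma rotate_corner: "p > 0 \<Longrightarrow> x \<in> corners p \<Longrightarrow> zeta p ^ n * x \<in> corners p"
  using corner_vert[of p] by (auto simp: corners_def vert_add[symmetric]) 

section \<open>Chains of gluings and the points of the surface\<close>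

lemma glue_relI:
  assumes "gluing S" "f \<in> faces S" "k < gon S" "glue S (f, k) = (g, l)" "0 \<le> s" "s \<le> 1"
  shows "((f, side_pt (gon S) k s), (g, side_pt (gon S) l (1 - s))) \<in> glue_rel S"
  using assms gluing_gon[of S] unfolding glue_rel_def by (auto simp: side_eq glue_map_side_pt)

lemma glue_relE:
  assumes "gluing S" "(q, r) \<in> glue_rel S"
  obtains f k g l s where "f \<in> faces S" "k < gon S" "glue S (f, k) = (g, l)" "0 \<le> s" "s \<le> 1"
    "q = (f, side_pt (gon S) k s)" "r = (g, side_pt (gon S) l (1 - s))"
proof -
  obtain f x g y where e: "q = (f, x)" "r = (g, y)" by fastforce
  with assms(2) obtain k l where "f \<in> faces S" "k < gon S" "glue S (f, k) = (g, l)"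
      "x \<in> side (gon S) k" "y = glue_map (gon S) k l x"
    unfolding glue_rel_def by blast
  moreover from this obtain s where "x = side_pt (gon S) k s" "0 \<le> s" "s \<le> 1"
    by (auto simp: side_eq)
  ultimately show thesis
    using that[of f k g l s] e glue_map_side_pt[OF gluing_gon[OF assms(1)]] by simp
qed

lemma glue_rel_sym:
  assumes "gluing S" "(q, r) \<in> glue_rel S"
  shows "(r, q) \<in> glue_rel S"
proof -
  obtain f k g l s where fk: "f \<in> faces S" "k < gon S" "glue S (f, k) = (g, l)" and s: "0 \<le> s" "s \<le> 1"
    and e: "q = (f, side_pt (gon S) k s)" "r = (g, side_pt (gon S) l (1 - s))"
    using glue_relE[OF assms] .
  show ?thesis
    using glue_relI[of S g l f k "1 - s"] glue_dart[OF assms(1) fk] s assms(1) e by simp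
qed

lemma glue_rel_cells:
  assumes "gluing S" "(q, r) \<in> glue_rel S"
  shows "q \<in> cells S" "r \<in> cells S"
proof -
  have "q \<in> cells S" if qr: "(q, r) \<in> glue_rel S" for q r
  proof -
    obtain f k g l s where "f \<in> faces S" "k < gon S" "0 \<le> s" "s \<le> 1" "q = (f, side_pt (gon S) k s)"
      using glue_relE[OF assms(1) qr] by metis
    then show ?thesis
      using gluing_gon[OF assms(1)] by (auto simp: cells_def intro!: side_pt_in_polygon)
  qed
  then show "q \<in> cells S" "r \<in> cells S" using assms glue_rel_sym by blast+
qed

lemma rtrancl_glue_rel_cells: "gluing S \<Longrightarrow> (q, r) \<in> (glue_rel S)\<^sup>* \<Longrightarrow> q \<in> cells S \<Longrightarrow> r \<in> cells S"
  by (erule rtrancl_induct) (auto dest: glue_rel_cells)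

lemma rtrancl_glue_rel_sym: "gluing S \<Longrightarrow> (q, r) \<in> (glue_rel S)\<^sup>* \<Longrightarrow> (r, q) \<in> (glue_rel S)\<^sup>*"
  by (meson glue_rel_sym symI sym_rtrancl symD)

lemma pt_eq: "gluing S \<Longrightarrow> f \<in> faces S \<Longrightarrow> x \<in> poly_of S \<Longrightarrow> pt S f x = {r. ((f, x), r) \<in> (glue_rel S)\<^sup>*}"
  using rtrancl_glue_rel_cells[of S "(f, x)"] by (auto simp: pt_def same_point_def cells_def)

lemma pt_eq_iff:
  assumes "gluing S" "f \<in> faces S" "x \<in> poly_of S" "g \<in> faces S" "y \<in> poly_of S"
  shows "pt S f x = pt S g y \<longleftrightarrow> ((f, x), (g, y)) \<in> (glue_rel S)\<^sup>*"
proof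
  assume "pt S f x = pt S g y"
  then have "(g, y) \<in> pt S f x" using assms by (simp add: pt_eq)
  then show "((f, x), (g, y)) \<in> (glue_rel S)\<^sup>*" using assms by (simp add: pt_eq)
next
  assume *: "((f, x), (g, y)) \<in> (glue_rel S)\<^sup>*"
  then have "((f, x), r) \<in> (glue_rel S)\<^sup>* \<longleftrightarrow> ((g, y), r) \<in> (glue_rel S)\<^sup>*" for r
    using rtrancl_trans rtrancl_glue_rel_sym[OF assms(1) *] by metis
  then show "pt S f x = pt S g y" using assms by (simp add: pt_eq)
qed

lemma in_pt_iff:
  assumes "gluing S" "f \<in> faces S" "x \<in> poly_of S"
  shows "(g, y) \<in> pt S f x \<longleftrightarrow> g \<in> faces S \<and> y \<in> poly_of S \<and> pt S g y = pt S f x"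
proof
  assume "(g, y) \<in> pt S f x"
  then have *: "((f, x), (g, y)) \<in> (glue_rel S)\<^sup>*" using assms by (simp add: pt_eq)
  then have "(g, y) \<in> cells S"
    by (rule rtrancl_glue_rel_cells[OF assms(1)]) (use assms in \<open>simp add: cells_def\<close>)
  then show "g \<in> faces S \<and> y \<in> poly_of S \<and> pt S g y = pt S f x"
    using * assms pt_eq_iff[of S f x g y] by (simp add: cells_def)
next
  assume "g \<in> faces S \<and> y \<in> poly_of S \<and> pt S g y = pt S f x"
  then show "(g, y) \<in> pt S f x" using assms pt_eq_iff[of S f x g y] by (simp add: pt_eq)
qed

lemma points_eq: "points S = {pt S f x | f x. f \<in> faces S \<and> x \<in> poly_of S}"
  by (auto simp: points_def quotient_def pt_def)

lemma pt_in_points: "f \<in> faces S \<Longrightarrow> x \<in> poly_of S \<Longrightarrow> pt S f x \<in> points S"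
  by (auto simp: points_eq)

lemma glue_rel_pt: "gluing S \<Longrightarrow> ((f, x), (g, y)) \<in> glue_rel S \<Longrightarrow> pt S f x = pt S g y"
  using glue_rel_cells[of S "(f, x)" "(g, y)"] by (auto simp: cells_def pt_eq_iff)

lemma pt_side_pt:
  assumes "gluing S" "f \<in> faces S" "k < gon S" "glue S (f, k) = (g, l)" "0 \<le> s" "s \<le> 1"
  shows "pt S f (side_pt (gon S) k s) = pt S g (side_pt (gon S) l (1 - s))"
  using glue_rel_pt glue_relI assms by metis

lemma glue_rel_corner:
  assumes "gluing S" "((f, x), (g, y)) \<in> glue_rel S"
  shows "x \<in> corners (gon S) \<longleftrightarrow> y \<in> corners (gon S)"
proof -
  obtain f' k g' l s where 1: "f' \<in> faces S" "k < gon S" "glue S (f', k) = (g', l)" "0 \<le> s" "s \<le> 1"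
    and e: "(f, x) = (f', side_pt (gon S) k s)" "(g, y) = (g', side_pt (gon S) l (1 - s))"
    using glue_relE[OF assms] .
  show ?thesis
    using e 1 glue_dart(2)[OF assms(1) 1(1-3)] gluing_gon[OF assms(1)] by (auto simp: side_pt_corner_iff)
qed

text \<open>A point of the polygon that is not a corner lies on at most one side, and its parameter
  there is unique, so at most one gluing applies to it.\<close>

lemma glue_rel_functional:
  assumes S: "gluing S" and "(q, r) \<in> glue_rel S" "(q, r') \<in> glue_rel S" "snd q \<notin> corners (gon S)"
  shows "r = r'"
proof -
  obtain f k g l s where 1: "f \<in> faces S" "k < gon S" "glue S (f, k) = (g, l)" "0 \<le> s" "s \<le> 1"
    "q = (f, side_pt (gon S) k s)" "r = (g, side_pt (gon S) l (1 - s))"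
    using glue_relE[OF assms(1,2)] .
  obtain f' k' g' l' s' where 2: "f' \<in> faces S" "k' < gon S" "glue S (f', k') = (g', l')" "0 \<le> s'" "s' \<le> 1"
    "q = (f', side_pt (gon S) k' s')" "r' = (g', side_pt (gon S) l' (1 - s'))"
    using glue_relE[OF assms(1,3)] .
  have "s \<noteq> 0 \<and> s \<noteq> 1" using assms(4) 1 gluing_gon[OF S] by (auto simp: side_pt_corner_iff)
  then have "k' = k" "s' = s" "f' = f"
    using side_pt_unique[of "gon S" k' k s s'] 1 2 gluing_gon[OF S] by auto
  with 1 2 show ?thesis by auto
qed

text \<open>The gluing applied to a partner leads back to the start, and no other gluing applies, so
  a chain of gluings merely goes to and fro.\<close>

lemma nonvertex_class:
  assumes S: "gluing S" and "x \<notin> corners (gon S)"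
  shows "((f, x), r) \<in> (glue_rel S)\<^sup>* \<longleftrightarrow> r = (f, x) \<or> ((f, x), r) \<in> glue_rel S"
proof
  assume "((f, x), r) \<in> (glue_rel S)\<^sup>*"
  then show "r = (f, x) \<or> ((f, x), r) \<in> glue_rel S"
  proof (induction rule: rtrancl_induct)
    case (step y z)
    show ?case
    proof (cases "y = (f, x)")
      case True
      with step show ?thesis by simp
    next
      case False
      with step have y: "((f, x), y) \<in> glue_rel S" by simp
      then have "(y, (f, x)) \<in> glue_rel S" by (rule glue_rel_sym[OF S])
      moreover have "snd y \<notin> corners (gon S)"
        using y glue_rel_corner[OF S, of f x "fst y" "snd y"] assms(2) by simp
      ultimately show ?thesis
        using glue_rel_functional[OF S step.hyps(2)] by simp
    qed
  qed simp
qed auto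

lemma rtrancl_glue_rel_corner:
  assumes S: "gluing S" and "(q, r) \<in> (glue_rel S)\<^sup>*"
  shows "snd q \<in> corners (gon S) \<longleftrightarrow> snd r \<in> corners (gon S)"
  using assms(2)
proof (induction rule: rtrancl_induct)
  case (step y z)
  then show ?case
    using glue_rel_corner[OF S, of "fst y" "snd y" "fst z" "snd z"] by simp
qed simp

lemma pt_in_vertices_iff:
  assumes "gluing S" "f \<in> faces S" "x \<in> poly_of S"
  shows "pt S f x \<in> vertices S \<longleftrightarrow> x \<in> corners (gon S)"
proof
  assume "pt S f x \<in> vertices S"
  then obtain g k where "g \<in> faces S" "k < gon S" "pt S f x = pt S g (vert (gon S) k)"
    by (auto simp: vertices_def)
  then show "x \<in> corners (gon S)"
    using rtrancl_glue_rel_corner[of S "(f, x)" "(g, vert (gon S) k)"] assms gluing_gon[of S] polygon_vert[of "gon S" k]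
      corner_vert[of "gon S" k] by (simp add: pt_eq_iff)
next
  assume "x \<in> corners (gon S)"
  with assms show "pt S f x \<in> vertices S" by (auto simp: vertices_def corners_def)
qed

subsection \<open>The quotient topology\<close>

text \<open>The trace of \<open>\<Union>U\<close> in the chart of \<open>f\<close> is the preimage
  of \<open>U\<close> under \<open>pt S f\<close>, so the quotient topology is the final topology of
  the charts. Since \<open>surf_top\<close> is given through \<open>topology\<close>, its predicate
  must be shown to be a topology before membership can be unfolded.\<close>

lemma openin_surf_top:
  assumes S: "gluing S"
  shows "openin (surf_top S) U \<longleftrightarrow>
    U \<subseteq> points S \<and> (\<forall>f \<in> faces S. openin (top_of_set (poly_of S)) {x \<in> poly_of S. pt S f x \<in> U})"
proof -
  let ?P = "\<lambda>U. U \<subseteq> points S \<and>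
    (\<forall>f \<in> faces S. openin (top_of_set (poly_of S)) {x \<in> poly_of S. pt S f x \<in> U})"
  have "openin (sum_topology (\<lambda>_. top_of_set (poly_of S)) (faces S)) (\<Union>U) \<longleftrightarrow>
     (\<forall>f \<in> faces S. openin (top_of_set (poly_of S)) {x \<in> poly_of S. pt S f x \<in> U})"
    if U: "U \<subseteq> points S" for U
  proof -
    have un: "(f, x) \<in> \<Union>U \<longleftrightarrow> f \<in> faces S \<and> x \<in> poly_of S \<and> pt S f x \<in> U" for f x
    proof
      assume "(f, x) \<in> \<Union>U"
      then obtain g y where "g \<in> faces S" "y \<in> poly_of S" "pt S g y \<in> U" "(f, x) \<in> pt S g y"
        using U by (auto simp: points_eq)
      then show "f \<in> faces S \<and> x \<in> poly_of S \<and> pt S f x \<in> U"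
        using in_pt_iff[OF S] by auto
    next
      assume "f \<in> faces S \<and> x \<in> poly_of S \<and> pt S f x \<in> U"
      then show "(f, x) \<in> \<Union>U" using in_pt_iff[OF S, of f x f x] by blast
    qed
    then have "\<Union>U \<subseteq> Sigma (faces S) (topspace \<circ> (\<lambda>_. top_of_set (poly_of S)))" by auto
    moreover have "{x. (f, x) \<in> \<Union>U} = {x \<in> poly_of S. pt S f x \<in> U}" if "f \<in> faces S" for f
      using that un by auto
    ultimately show ?thesis unfolding openin_sum_topology by auto
  qed
  then have P: "(\<lambda>U. U \<subseteq> points S \<and> openin (sum_topology (\<lambda>_. top_of_set (poly_of S)) (faces S)) (\<Union>U)) = ?P"
    by (intro ext) blast
  have "?P (U \<inter> V)" if UV: "?P U" "?P V" for U V
  proof -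
    have "{x \<in> poly_of S. pt S f x \<in> U \<inter> V} = {x \<in> poly_of S. pt S f x \<in> U} \<inter> {x \<in> poly_of S. pt S f x \<in> V}" for f
      by auto
    with UV show ?thesis by (auto intro: openin_Int)
  qed
  moreover have "?P (\<Union>K)" if K: "\<forall>U\<in>K. ?P U" for K
  proof -
    have "{x \<in> poly_of S. pt S f x \<in> \<Union>K} = \<Union>((\<lambda>U. {x \<in> poly_of S. pt S f x \<in> U}) ` K)" for f
      by auto
    with K show ?thesis by (auto intro!: openin_Union)
  qed
  ultimately have "istopology ?P"
    unfolding istopology_def by blast
  then show ?thesis
    unfolding surf_top_def P by (simp add: topology_inverse')
qed

lemma topspace_surf_top: "gluing S \<Longrightarrow> topspace (surf_top S) = points S"
proof -
  assume S: "gluing S"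
  have "openin (surf_top S) (points S)"
  proof -
    have "{x \<in> poly_of S. pt S f x \<in> points S} = poly_of S" if "f \<in> faces S" for f
      using that by (auto simp: pt_in_points)
    then show ?thesis by (auto simp: openin_surf_top[OF S])
  qed
  then show ?thesis
    by (metis S openin_subset openin_surf_top openin_topspace subset_antisym)
qed

lemma continuous_map_surf_top_iff:
  assumes S: "gluing S"
  shows "continuous_map (surf_top S) Y h \<longleftrightarrow>
    (\<forall>f \<in> faces S. continuous_map (top_of_set (poly_of S)) Y (\<lambda>x. h (pt S f x)))"
proof -
  have "(h \<in> points S \<rightarrow> topspace Y) \<longleftrightarrow> (\<forall>f \<in> faces S. (\<lambda>x. h (pt S f x)) \<in> poly_of S \<rightarrow> topspace Y)"
    by (auto simp: points_eq)
  moreover have "openin (surf_top S) {x \<in> points S. h x \<in> U} \<longleftrightarrow>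
      (\<forall>f \<in> faces S. openin (top_of_set (poly_of S)) {x \<in> poly_of S. h (pt S f x) \<in> U})" for U
  proof -
    have "{x \<in> poly_of S. pt S f x \<in> {x \<in> points S. h x \<in> U}} = {x \<in> poly_of S. h (pt S f x) \<in> U}"
      if "f \<in> faces S" for f
      using that by (auto simp: pt_in_points)
    then show ?thesis by (auto simp: openin_surf_top[OF S])
  qed
  ultimately show ?thesis
    unfolding continuous_map_def topspace_surf_top[OF S] topspace_euclidean_subtopology
    by (simp add: all_conj_distrib ball_conj_distrib) meson
qed

lemma continuous_map_pt:
  assumes "gluing S" "f \<in> faces S"
  shows "continuous_map (top_of_set (poly_of S)) (surf_top S) (pt S f)"
  using continuous_map_surf_top_iff[OF assms(1), of "surf_top S" "\<lambda>x. x"] assms by auto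

definition pts_of :: "'f polysurf \<Rightarrow> ('f \<times> complex) set \<Rightarrow> ('f \<times> complex) set set" where
  "pts_of S W = (\<lambda>(f, x). pt S f x) ` W"

definition saturated :: "'f polysurf \<Rightarrow> ('f \<times> complex) set \<Rightarrow> bool" where
  "saturated S W \<longleftrightarrow> W \<subseteq> cells S \<and> (\<forall>q r. q \<in> W \<longrightarrow> (q, r) \<in> glue_rel S \<longrightarrow> r \<in> W)"

lemma pt_in_pts_of_iff:
  assumes S: "gluing S" and W: "saturated S W" and f: "f \<in> faces S" "x \<in> poly_of S"
  shows "pt S f x \<in> pts_of S W \<longleftrightarrow> (f, x) \<in> W"
proof
  assume "pt S f x \<in> pts_of S W"
  then obtain g y where gy: "(g, y) \<in> W" "pt S f x = pt S g y" by (auto simp: pts_of_def)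
  then have "g \<in> faces S" "y \<in> poly_of S" using W by (auto simp: saturated_def cells_def)
  with gy f have "((g, y), (f, x)) \<in> (glue_rel S)\<^sup>*" using pt_eq_iff[OF S, of g y f x] by simp
  then show "(f, x) \<in> W"
    by (induction rule: rtrancl_induct) (use gy W in \<open>auto simp: saturated_def\<close>)
next
  assume "(f, x) \<in> W"
  then show "pt S f x \<in> pts_of S W" by (force simp: pts_of_def)
qed

lemma openin_pts_of:
  assumes S: "gluing S" and W: "saturated S W"
    and op: "\<And>f. f \<in> faces S \<Longrightarrow> openin (top_of_set (poly_of S)) {x. (f, x) \<in> W}"
  shows "openin (surf_top S) (pts_of S W)"
proof -
  have "{x \<in> poly_of S. pt S f x \<in> pts_of S W} = {x. (f, x) \<in> W}" if "f \<in> faces S" for f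
    using pt_in_pts_of_iff[OF S W that] W by (auto simp: saturated_def cells_def)
  moreover have "pts_of S W \<subseteq> points S"
    using W by (auto simp: pts_of_def saturated_def cells_def pt_in_points)
  ultimately show ?thesis
    using op by (simp add: openin_surf_top[OF S])
qed

section \<open>Maps of darts\<close>

definition turn :: "nat \<Rightarrow> nat \<Rightarrow> 'f \<times> nat \<Rightarrow> 'f \<times> nat" where
  "turn p n s = (fst s, (snd s + n) mod p)"

text \<open>Morphisms of combinatorial maps. Turning goes counterclockwise in both surfaces, so
  orientation-reversing maps are excluded from the start.\<close>

definition dart_map :: "'f polysurf \<Rightarrow> 'g polysurf \<Rightarrow> ('f \<times> nat \<Rightarrow> 'g \<times> nat) \<Rightarrow> bool" where
  "dart_map S T \<alpha> \<longleftrightarrow> gon S = gon T \<and> (\<forall>s \<in> darts S. \<alpha> s \<in> darts T \<and>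
     \<alpha> (glue S s) = glue T (\<alpha> s) \<and> (\<forall>n. \<alpha> (turn (gon S) n s) = turn (gon S) n (\<alpha> s)))"

definition face_map :: "('f \<times> nat \<Rightarrow> 'g \<times> nat) \<Rightarrow> 'f \<Rightarrow> 'g" where
  "face_map \<alpha> f = fst (\<alpha> (f, 0))"

text \<open>As a dart map commutes with turning, it shifts all indices of a face by the same amount
  modulo \<open>p\<close>. The shift is read off at side 0 and determines the rotation of the
  chart.\<close>

definition rot_of :: "nat \<Rightarrow> ('f \<times> nat \<Rightarrow> 'g \<times> nat) \<Rightarrow> 'f \<Rightarrow> complex" where
  "rot_of p \<alpha> f = zeta p ^ snd (\<alpha> (f, 0))"

definition act :: "nat \<Rightarrow> ('f \<times> nat \<Rightarrow> 'g \<times> nat) \<Rightarrow> 'f \<times> complex \<Rightarrow> 'g \<times> complex" where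
  "act p \<alpha> q = (face_map \<alpha> (fst q), rot_of p \<alpha> (fst q) * snd q)"

text \<open>Nothing is required of \<open>\<phi>\<close> outside \<open>points S\<close>, so the
  notion applies both to extensional bijections and to the given covering maps.\<close>

definition induces ::
  "'f polysurf \<Rightarrow> 'g polysurf \<Rightarrow> ('f \<times> nat \<Rightarrow> 'g \<times> nat) \<Rightarrow> (('f \<times> complex) set \<Rightarrow> ('g \<times> complex) set) \<Rightarrow> bool" where
  "induces S T \<alpha> \<phi> \<longleftrightarrow>
     (\<forall>f \<in> faces S. \<forall>x \<in> poly_of S. \<phi> (pt S f x) = pt T (face_map \<alpha> f) (rot_of (gon S) \<alpha> f * x))"

lemma rot_of_nonzero [simp]: "rot_of p \<alpha> f \<noteq> 0"
  by (simp add: rot_of_def)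

lemma norm_rot_of [simp]: "cmod (rot_of p \<alpha> f) = 1"
  by (simp add: rot_of_def norm_power)

lemma rot_of_in_polygon: "p > 0 \<Longrightarrow> rot_of p \<alpha> f * x \<in> polygon p \<longleftrightarrow> x \<in> polygon p"
  by (simp add: rot_of_def rotate_in_polygon)

lemma dart_mapD:
  assumes "dart_map S T \<alpha>"
  shows "gon T = gon S" "s \<in> darts S \<Longrightarrow> \<alpha> s \<in> darts T" "s \<in> darts S \<Longrightarrow> \<alpha> (glue S s) = glue T (\<alpha> s)"
    "s \<in> darts S \<Longrightarrow> \<alpha> (turn (gon S) n s) = turn (gon S) n (\<alpha> s)"
  using assms by (auto simp: dart_map_def)

lemma face_map_in:
  assumes "dart_map S T \<alpha>" "gluing S" "f \<in> faces S"
  shows "face_map \<alpha> f \<in> faces T"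
  using dart_mapD(2)[OF assms(1), of "(f, 0)"] assms gluing_gon[OF assms(2)]
  by (auto simp: darts_def face_map_def mem_Times_iff)

lemma dart_map_apply:
  assumes "dart_map S T \<alpha>" "gluing S" "f \<in> faces S" "k < gon S"
  shows "\<alpha> (f, k) = (face_map \<alpha> f, (k + snd (\<alpha> (f, 0))) mod gon S)"
  using dart_mapD(4)[OF assms(1), of "(f, 0)" k] assms gluing_gon[OF assms(2)]
  by (simp add: darts_def turn_def face_map_def add.commute)

lemma dart_map_rot:
  assumes "dart_map S T \<alpha>" "gluing S" "f \<in> faces S" "k < gon S"
  shows "fst (\<alpha> (f, k)) = face_map \<alpha> f" "snd (\<alpha> (f, k)) < gon S"
    "zeta (gon S) ^ snd (\<alpha> (f, k)) = rot_of (gon S) \<alpha> f * zeta (gon S) ^ k"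
    "side_pt (gon S) (snd (\<alpha> (f, k))) s = rot_of (gon S) \<alpha> f * side_pt (gon S) k s"
    "side_vec (gon S) (snd (\<alpha> (f, k))) = rot_of (gon S) \<alpha> f * side_vec (gon S) k"
    "sector (gon S) (snd (\<alpha> (f, k))) = (\<lambda>x. rot_of (gon S) \<alpha> f * x) ` sector (gon S) k"
  using gluing_gon[OF assms(2)] unfolding dart_map_apply[OF assms] rot_of_def
  by (simp_all add: zeta_power_mod side_pt_mod side_vec_mod sector_mod power_add
      side_pt_add side_vec_add sector_add)

lemma dart_map_sector:
  assumes "dart_map S T \<alpha>" "gluing S" "f \<in> faces S" "k < gon S"
  shows "rot_of (gon S) \<alpha> f * x \<in> sector (gon S) (snd (\<alpha> (f, k))) \<longleftrightarrow> x \<in> sector (gon S) k"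
  unfolding dart_map_rot(6)[OF assms] by (auto simp: image_iff)

lemma dart_map_index:
  assumes "dart_map S T \<alpha>" "gluing S" "f \<in> faces S" "m < gon S"
  obtains k where "k < gon S" "\<alpha> (f, k) = (face_map \<alpha> f, m)"
proof -
  define n where "n = snd (\<alpha> (f, 0))"
  have "n < gon S" unfolding n_def
    using dart_map_rot(2)[OF assms(1-3), of 0] gluing_gon[OF assms(2)] by simp
  define k where "k = (m + (gon S - n)) mod gon S"
  have "(k + n) mod gon S = (m + gon S) mod gon S"
    using \<open>n < gon S\<close> by (simp add: k_def mod_simps)
  then have "(k + n) mod gon S = m" using assms by simp
  moreover have k: "k < gon S" using assms by (simp add: k_def)
  ultimately have "\<alpha> (f, k) = (face_map \<alpha> f, m)"
    unfolding dart_map_apply[OF assms(1-3) k] n_def[symmetric] by simp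
  with k show thesis by (rule that)
qed

lemma act_in_cells:
  "dart_map S T \<alpha> \<Longrightarrow> gluing S \<Longrightarrow> q \<in> cells S \<Longrightarrow> act (gon S) \<alpha> q \<in> cells T"
  using face_map_in[of S T \<alpha> "fst q"] gluing_gon[of S] dart_mapD(1)[of S T \<alpha>]
  by (auto simp: act_def cells_def rot_of_in_polygon mem_Times_iff)

lemma act_glue_rel:
  assumes \<alpha>: "dart_map S T \<alpha>" and S: "gluing S" and T: "gluing T" and "(q, r) \<in> glue_rel S"
  shows "(act (gon S) \<alpha> q, act (gon S) \<alpha> r) \<in> glue_rel T"
proof -
  obtain f k g l s where 1: "f \<in> faces S" "k < gon S" "glue S (f, k) = (g, l)" and s: "0 \<le> s" "s \<le> 1"
    and e: "q = (f, side_pt (gon S) k s)" "r = (g, side_pt (gon S) l (1 - s))"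
    using glue_relE[OF S assms(4)] .
  note 2 = glue_dart[OF S 1]
  have "(f, k) \<in> darts S" using 1 by (simp add: darts_def)
  then have g: "glue T (\<alpha> (f, k)) = \<alpha> (g, l)" and d: "\<alpha> (f, k) \<in> darts T"
    using dart_mapD[OF \<alpha>] 1(3) by metis+
  have "\<alpha> (f, k) = (face_map \<alpha> f, snd (\<alpha> (f, k)))" "\<alpha> (g, l) = (face_map \<alpha> g, snd (\<alpha> (g, l)))"
    using dart_map_rot(1)[OF \<alpha> S] 1 2 by (simp_all add: prod_eq_iff)
  with g have g': "glue T (face_map \<alpha> f, snd (\<alpha> (f, k))) = (face_map \<alpha> g, snd (\<alpha> (g, l)))" by simp
  have "((face_map \<alpha> f, side_pt (gon T) (snd (\<alpha> (f, k))) s), (face_map \<alpha> g, side_pt (gon T) (snd (\<alpha> (g, l))) (1 - s)))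
      \<in> glue_rel T"
    by (rule glue_relI[OF T]) (use g' d s dart_map_rot(1,2)[OF \<alpha> S 1(1,2)] dart_mapD(1)[OF \<alpha>]
        in \<open>simp_all add: darts_def mem_Times_iff\<close>)
  then show ?thesis
    using dart_map_rot(4)[OF \<alpha> S] 1 2 dart_mapD(1)[OF \<alpha>] by (simp add: act_def e)
qed

lemma act_rtrancl:
  assumes \<alpha>: "dart_map S T \<alpha>" and S: "gluing S" and T: "gluing T" and "(q, r) \<in> (glue_rel S)\<^sup>*"
  shows "(act (gon S) \<alpha> q, act (gon S) \<alpha> r) \<in> (glue_rel T)\<^sup>*"
  using assms(4) by (induction rule: rtrancl_induct) (auto intro: rtrancl_into_rtrancl act_glue_rel[OF \<alpha> S T])

text \<open>Combinatorial lifting of one gluing step. Among the sides of the face of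
  \<open>q\<close>, exactly one has the prescribed image index, and \<open>\<alpha>\<close> carries
  its partner to the partner of the image. Iterated, this replaces path lifting for classes of
  representatives, and it is valid at vertices too.\<close>

lemma act_lift_glue_rel:
  assumes \<alpha>: "dart_map S T \<alpha>" and S: "gluing S" and T: "gluing T"
    and q: "q \<in> cells S" and r: "(act (gon S) \<alpha> q, r) \<in> glue_rel T"
  obtains r' where "(q, r') \<in> glue_rel S" "act (gon S) \<alpha> r' = r"
proof -
  obtain f x where fx: "q = (f, x)" "f \<in> faces S" using q by (auto simp: cells_def)
  obtain f' k' g' l' s where 1: "f' \<in> faces T" "k' < gon T" "glue T (f', k') = (g', l')" and s: "0 \<le> s" "s \<le> 1"
    and e: "act (gon S) \<alpha> q = (f', side_pt (gon T) k' s)" "r = (g', side_pt (gon T) l' (1 - s))"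
    using glue_relE[OF T r] .
  note pT = dart_mapD(1)[OF \<alpha>]
  obtain k where k: "k < gon S" "\<alpha> (f, k) = (face_map \<alpha> f, k')"
    using dart_map_index[OF \<alpha> S fx(2), of k'] 1 pT by auto
  have f': "f' = face_map \<alpha> f" using e fx by (simp add: act_def)
  have "rot_of (gon S) \<alpha> f * x = rot_of (gon S) \<alpha> f * side_pt (gon S) k s"
    using dart_map_rot(4)[OF \<alpha> S fx(2) k(1), of s] k(2) e(1) fx pT by (simp add: act_def)
  then have x: "x = side_pt (gon S) k s" by simp
  obtain g l where gl: "glue S (f, k) = (g, l)" by fastforce
  note 2 = glue_dart[OF S fx(2) k(1) gl]
  have "\<alpha> (g, l) = (g', l')"
    using dart_mapD(3)[OF \<alpha>, of "(f, k)"] fx k gl 1 f' by (simp add: darts_def)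
  then have "act (gon S) \<alpha> (g, side_pt (gon S) l (1 - s)) = r"
    using dart_map_rot[OF \<alpha> S 2(1,2)] e pT by (simp add: act_def)
  moreover have "(q, (g, side_pt (gon S) l (1 - s))) \<in> glue_rel S"
    using glue_relI[OF S fx(2) k(1) gl s] fx x by simp
  ultimately show thesis using that by blast
qed

lemma act_lift_rtrancl:
  assumes \<alpha>: "dart_map S T \<alpha>" and S: "gluing S" and T: "gluing T"
    and q: "q \<in> cells S" and r: "(act (gon S) \<alpha> q, r) \<in> (glue_rel T)\<^sup>*"
  obtains r' where "(q, r') \<in> (glue_rel S)\<^sup>*" "act (gon S) \<alpha> r' = r"
proof -
  from r have "\<exists>r'. (q, r') \<in> (glue_rel S)\<^sup>* \<and> act (gon S) \<alpha> r' = r"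
  proof (induction rule: rtrancl_induct)
    case (step y z)
    then obtain y' where y': "(q, y') \<in> (glue_rel S)\<^sup>*" "act (gon S) \<alpha> y' = y" by blast
    have "y' \<in> cells S" using rtrancl_glue_rel_cells[OF S y'(1) q] .
    then obtain z' where "(y', z') \<in> glue_rel S" "act (gon S) \<alpha> z' = z"
      using act_lift_glue_rel[OF \<alpha> S T, of y' z] step.hyps(2) y'(2) by blast
    with y'(1) have "(q, z') \<in> (glue_rel S)\<^sup>*" by (simp add: rtrancl.rtrancl_into_rtrancl)
    with \<open>act (gon S) \<alpha> z' = z\<close> show ?case by blast
  qed blast
  with that show thesis by blast
qed

text \<open>Away from the vertices no two representatives of a point have the same image: otherwise a side
  would be glued to itself.\<close>

lemma act_inj_on_class:
  assumes \<alpha>: "dart_map S T \<alpha>" and S: "gluing S" and T: "gluing T"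
    and q: "q \<in> cells S" "snd q \<notin> corners (gon S)" and r: "(q, r) \<in> (glue_rel S)\<^sup>*"
    and e: "act (gon S) \<alpha> q = act (gon S) \<alpha> r"
  shows "q = r"
proof (rule ccontr)
  assume "q \<noteq> r"
  then have "(q, r) \<in> glue_rel S"
    using r q(2) nonvertex_class[OF S, of "snd q" "fst q" r] by simp
  then obtain f k g l s where 1: "f \<in> faces S" "k < gon S" "glue S (f, k) = (g, l)" and s: "0 \<le> s" "s \<le> 1"
    and qr: "q = (f, side_pt (gon S) k s)" "r = (g, side_pt (gon S) l (1 - s))"
    using glue_relE[OF S] by metis
  note 2 = glue_dart[OF S 1] and pT = dart_mapD(1)[OF \<alpha>]
  have s': "0 < s" "s < 1"
    using q(2) s qr side_pt_corner_iff[OF gluing_gon[OF S] 1(2) s] by auto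
  have "side_pt (gon S) (snd (\<alpha> (f, k))) s = side_pt (gon S) (snd (\<alpha> (g, l))) (1 - s)"
    and F: "face_map \<alpha> f = face_map \<alpha> g"
    using e dart_map_rot(4)[OF \<alpha> S] 1 2 by (simp_all add: act_def qr)
  then have "snd (\<alpha> (f, k)) = snd (\<alpha> (g, l))"
    using side_pt_unique(1)[OF gluing_gon[OF S] dart_map_rot(2)[OF \<alpha> S 2(1,2)] dart_map_rot(2)[OF \<alpha> S 1(1,2)] s', of "1 - s"]
      s by simp
  then have "\<alpha> (f, k) = \<alpha> (g, l)"
    using F dart_map_rot(1)[OF \<alpha> S] 1 2 by (simp add: prod_eq_iff)
  moreover have "\<alpha> (g, l) = glue T (\<alpha> (f, k))" "\<alpha> (f, k) \<in> darts T"
    using dart_mapD(2,3)[OF \<alpha>, of "(f, k)"] 1 by (simp_all add: darts_def)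
  ultimately show False using T by (auto simp: gluing_def)
qed

section \<open>Maps of surfaces induced by maps of darts\<close>

lemma inducesD: "induces S T \<alpha> \<phi> \<Longrightarrow> f \<in> faces S \<Longrightarrow> x \<in> poly_of S \<Longrightarrow>
    \<phi> (pt S f x) = pt T (face_map \<alpha> f) (rot_of (gon S) \<alpha> f * x)"
  by (simp add: induces_def)

text \<open>The action on representatives respects gluing, so the chosen representative does not
  matter. Extensionality is asked for because elements of \<open>Bij\<close> are
  extensional.\<close>

lemma induces_exists:
  assumes \<alpha>: "dart_map S T \<alpha>" and S: "gluing S" and T: "gluing T"
  obtains \<phi> where "induces S T \<alpha> \<phi>" "\<phi> \<in> extensional (points S)"
proof -
  define h where "h q = (\<lambda>(g, y). pt T g y) (act (gon S) \<alpha> q)" for q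
  define \<phi> where "\<phi> = (\<lambda>y\<in>points S. h (SOME q. q \<in> y))"
  have hq: "h q = h r" if "(q, r) \<in> (glue_rel S)\<^sup>*" "q \<in> cells S" for q r
  proof -
    have "act (gon S) \<alpha> q \<in> cells T" "act (gon S) \<alpha> r \<in> cells T"
      using that rtrancl_glue_rel_cells[OF S] act_in_cells[OF \<alpha> S] by blast+
    then show ?thesis
      using act_rtrancl[OF \<alpha> S T that(1)]
        pt_eq_iff[OF T, of "fst (act (gon S) \<alpha> q)" "snd (act (gon S) \<alpha> q)" "fst (act (gon S) \<alpha> r)" "snd (act (gon S) \<alpha> r)"]
      by (simp add: h_def cells_def mem_Times_iff split_beta)
  qed
  have "\<phi> (pt S f x) = pt T (face_map \<alpha> f) (rot_of (gon S) \<alpha> f * x)" if f: "f \<in> faces S" "x \<in> poly_of S" for f x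
  proof -
    have e: "pt S f x = {r. ((f, x), r) \<in> (glue_rel S)\<^sup>*}" using pt_eq[OF S f] .
    then have "(f, x) \<in> pt S f x" by simp
    then have "(SOME q. q \<in> pt S f x) \<in> pt S f x" by (rule someI)
    then have "h (f, x) = h (SOME q. q \<in> pt S f x)"
      using hq[of "(f, x)"] e f by (auto simp: cells_def)
    then show ?thesis
      using f pt_in_points[OF f] by (simp add: \<phi>_def h_def act_def)
  qed
  then have "induces S T \<alpha> \<phi>" by (simp add: induces_def)
  then show thesis using that by (auto simp: \<phi>_def)
qed

lemma induces_points:
  assumes "induces S T \<alpha> \<phi>" "dart_map S T \<alpha>" "gluing S" "q \<in> points S"
  shows "\<phi> q \<in> points T"
proof -
  obtain f x where "f \<in> faces S" "x \<in> poly_of S" "q = pt S f x" using assms(4) by (auto simp: points_eq)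
  then show ?thesis
    using act_in_cells[OF assms(2,3), of "(f, x)"] inducesD[OF assms(1)]
    by (auto simp: cells_def act_def intro!: pt_in_points)
qed

lemma rot_of_corner_iff:
  assumes "p \<ge> 3"
  shows "rot_of p \<alpha> f * x \<in> corners p \<longleftrightarrow> x \<in> corners p"
proof -
  have *: "zeta p ^ n * x \<in> corners p \<longleftrightarrow> x \<in> corners p" for n
  proof
    assume x: "zeta p ^ n * x \<in> corners p"
    have "zeta p ^ (n * (p - 1)) * (zeta p ^ n * x) \<in> corners p"
      by (rule rotate_corner[OF _ x]) (use assms in simp)
    moreover have "zeta p ^ (n * (p - 1)) * zeta p ^ n = 1"
    proof -
      have "n * (p - 1) + n = p * n" using assms by (cases p) simp_all
      then have "zeta p ^ (n * (p - 1)) * zeta p ^ n = (zeta p ^ p) ^ n"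
        by (metis power_add power_mult)
      then show ?thesis using assms by (simp only: zeta_power_self) simp
    qed
    ultimately show "x \<in> corners p" by (metis mult.assoc mult_1)
  qed (use assms in \<open>auto intro: rotate_corner\<close>)
  then show ?thesis by (simp add: rot_of_def)
qed

lemma induces_vertices:
  assumes i: "induces S T \<alpha> \<phi>" and \<alpha>: "dart_map S T \<alpha>" and S: "gluing S" and T: "gluing T" and q: "q \<in> points S"
  shows "\<phi> q \<in> vertices T \<longleftrightarrow> q \<in> vertices S"
proof -
  obtain f x where f: "f \<in> faces S" "x \<in> poly_of S" "q = pt S f x" using q by (auto simp: points_eq)
  have "face_map \<alpha> f \<in> faces T" "rot_of (gon S) \<alpha> f * x \<in> poly_of T"
    using act_in_cells[OF \<alpha> S, of "(f, x)"] f by (auto simp: cells_def act_def)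
  then show ?thesis
    using pt_in_vertices_iff[OF T] pt_in_vertices_iff[OF S] f inducesD[OF i] dart_mapD(1)[OF \<alpha>]
      rot_of_corner_iff[OF gluing_gon[OF S]] by simp
qed

lemma induces_continuous:
  assumes i: "induces S T \<alpha> \<phi>" and \<alpha>: "dart_map S T \<alpha>" and S: "gluing S" and T: "gluing T"
  shows "continuous_map (surf_top S) (surf_top T) \<phi>"
  unfolding continuous_map_surf_top_iff[OF S]
proof
  fix f assume f: "f \<in> faces S"
  have "continuous_map (top_of_set (poly_of S)) (top_of_set (poly_of T)) (\<lambda>x. rot_of (gon S) \<alpha> f * x)"
    using gluing_gon[OF S] dart_mapD(1)[OF \<alpha>]
    by (auto simp: continuous_map_in_subtopology rot_of_in_polygon intro!: continuous_intros)
  then have "continuous_map (top_of_set (poly_of S)) (surf_top T) (pt T (face_map \<alpha> f) \<circ> (\<lambda>x. rot_of (gon S) \<alpha> f * x))"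
    using continuous_map_pt[OF T face_map_in[OF \<alpha> S f]] by (rule continuous_map_compose)
  then show "continuous_map (top_of_set (poly_of S)) (surf_top T) (\<lambda>x. \<phi> (pt S f x))"
    by (rule continuous_map_eq) (use inducesD[OF i f] in auto)
qed

lemma induces_lift:
  assumes i: "induces S T \<alpha> \<phi>" and \<alpha>: "dart_map S T \<alpha>" and S: "gluing S" and T: "gluing T"
    and q: "q \<in> points S" and g: "(g, y) \<in> \<phi> q"
  obtains f x where "(f, x) \<in> q" "f \<in> faces S" "x \<in> poly_of S" "face_map \<alpha> f = g" "rot_of (gon S) \<alpha> f * x = y"
proof -
  obtain f x where f: "f \<in> faces S" "x \<in> poly_of S" "q = pt S f x" using q by (auto simp: points_eq)
  have fT: "face_map \<alpha> f \<in> faces T" "rot_of (gon S) \<alpha> f * x \<in> poly_of T"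
    using act_in_cells[OF \<alpha> S, of "(f, x)"] f by (auto simp: cells_def act_def)
  have "(act (gon S) \<alpha> (f, x), (g, y)) \<in> (glue_rel T)\<^sup>*"
    using g f inducesD[OF i f(1,2)] pt_eq[OF T fT] by (simp add: act_def)
  moreover have "(f, x) \<in> cells S" using f by (simp add: cells_def)
  ultimately obtain r where r: "((f, x), r) \<in> (glue_rel S)\<^sup>*" "act (gon S) \<alpha> r = (g, y)"
    using act_lift_rtrancl[OF \<alpha> S T] by metis
  then have "r \<in> cells S" using rtrancl_glue_rel_cells[OF S] f by (auto simp: cells_def)
  with r f that[of "fst r" "snd r"] show thesis
    by (auto simp: pt_eq[OF S] act_def cells_def)
qed

text \<open>In the chart of \<open>g\<close>, the image of \<open>U\<close> is the union, over all
  faces \<open>f\<close> above \<open>g\<close>, of the rotated trace of \<open>U\<close> in the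
  chart of \<open>f\<close>. That nothing is missing is the lifting of gluing chains.\<close>

lemma induces_open:
  assumes i: "induces S T \<alpha> \<phi>" and \<alpha>: "dart_map S T \<alpha>" and S: "gluing S" and T: "gluing T"
  shows "open_map (surf_top S) (surf_top T) \<phi>"
  unfolding open_map_def
proof (intro allI impI)
  fix U assume "openin (surf_top S) U"
  then have U: "U \<subseteq> points S" "\<And>f. f \<in> faces S \<Longrightarrow> openin (top_of_set (poly_of S)) {x \<in> poly_of S. pt S f x \<in> U}"
    by (auto simp: openin_surf_top[OF S])
  note pT = dart_mapD(1)[OF \<alpha>] and p = gluing_gon[OF S]
  have "openin (top_of_set (poly_of T)) {y \<in> poly_of T. pt T g y \<in> \<phi> ` U}" if g: "g \<in> faces T" for g
  proof -
    have "{y \<in> poly_of T. pt T g y \<in> \<phi> ` U} =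
        (\<Union>f \<in> {f \<in> faces S. face_map \<alpha> f = g}. (\<lambda>x. rot_of (gon S) \<alpha> f * x) ` {x \<in> poly_of S. pt S f x \<in> U})"
      (is "?L = ?R")
    proof
      show "?L \<subseteq> ?R"
      proof
        fix y assume "y \<in> ?L"
        then obtain q where q: "q \<in> U" "pt T g y = \<phi> q" and y: "y \<in> poly_of T" by auto
        then have "(g, y) \<in> \<phi> q" using pt_eq[OF T g y] by auto
        then obtain f x where "(f, x) \<in> q" "f \<in> faces S" "x \<in> poly_of S" "face_map \<alpha> f = g" "rot_of (gon S) \<alpha> f * x = y"
          using induces_lift[OF i \<alpha> S T, of q g y] q U(1) by blast
        moreover from this have "pt S f x = q"
          using q U(1) in_pt_iff[OF S] by (auto simp: points_eq)
        ultimately show "y \<in> ?R" using q by auto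
      qed
      show "?R \<subseteq> ?L"
        using p pT inducesD[OF i] by (force simp: rot_of_in_polygon)
    qed
    moreover have "openin (top_of_set (poly_of T)) ((\<lambda>x. rot_of (gon S) \<alpha> f * x) ` {x \<in> poly_of S. pt S f x \<in> U})"
      if f: "f \<in> faces S" for f
    proof -
      have "homeomorphism (poly_of S) (poly_of S) (\<lambda>x. rot_of (gon S) \<alpha> f * x) (\<lambda>x. x / rot_of (gon S) \<alpha> f)"
      proof (rule homeomorphismI)
        have *: "x / rot_of (gon S) \<alpha> f \<in> poly_of S" if "x \<in> poly_of S" for x
          using that p rot_of_in_polygon[of "gon S" \<alpha> f "x / rot_of (gon S) \<alpha> f"] by simp
        then show "(\<lambda>x. x / rot_of (gon S) \<alpha> f) ` poly_of S \<subseteq> poly_of S" by auto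
      qed (use p in \<open>auto simp: rot_of_in_polygon intro!: continuous_intros\<close>)
      then show ?thesis
        using homeomorphism_imp_open_map[OF _ U(2)[OF f]] pT by fastforce
    qed
    ultimately show ?thesis by (auto intro!: openin_Union)
  qed
  moreover have "\<phi> ` U \<subseteq> points T" using U(1) induces_points[OF i \<alpha> S] by auto
  ultimately show "openin (surf_top T) (\<phi> ` U)" by (simp add: openin_surf_top[OF T])
qed

section \<open>Connectedness\<close>

definition dart_connected :: "'f polysurf \<Rightarrow> bool" where
  "dart_connected S \<longleftrightarrow> darts S \<noteq> {} \<and> (\<forall>C \<subseteq> darts S. C \<noteq> {} \<longrightarrow>
     (\<forall>s \<in> C. glue S s \<in> C \<and> (\<forall>n. turn (gon S) n s \<in> C)) \<longrightarrow> C = darts S)"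

lemma dart_connectedD:
  assumes "dart_connected S" "t \<in> darts S" "P t" "s \<in> darts S"
    and "\<And>s. s \<in> darts S \<Longrightarrow> P s \<Longrightarrow> P (glue S s)"
    and "\<And>s n. s \<in> darts S \<Longrightarrow> P s \<Longrightarrow> P (turn (gon S) n s)"
    and "gluing S"
  shows "P s"
proof -
  let ?C = "{s \<in> darts S. P s}"
  have "glue S s \<in> ?C \<and> (\<forall>n. turn (gon S) n s \<in> ?C)" if "s \<in> ?C" for s
    using that assms(5,6,7) gluing_gon[OF assms(7)] by (auto simp: gluing_def) (auto simp: darts_def turn_def)
  moreover have "?C \<subseteq> darts S" "?C \<noteq> {}" using assms(2,3) by blast+
  ultimately have "?C = darts S"
    using assms(1) unfolding dart_connected_def by (metis (lifting))
  with assms(4) show ?thesis by blast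
qed

text \<open>A set of darts closed under turning consists of whole faces, and closedness under gluing
  makes the union of these faces saturated. It and the union of the remaining faces are then
  disjoint open sets that cover the surface.\<close>

lemma connected_surface_darts:
  assumes "connected_surface S"
  shows "dart_connected S"
proof -
  have S: "gluing S" using assms by (rule connected_surface_gluing)
  note p = gluing_gon[OF S]
  have "darts S \<noteq> {}" using assms p by (auto simp: connected_surface_def darts_def lessThan_empty_iff)
  moreover have "C = darts S" if C: "C \<subseteq> darts S" "C \<noteq> {}"
    and cl: "\<forall>s \<in> C. glue S s \<in> C \<and> (\<forall>n. turn (gon S) n s \<in> C)" for C
  proof -
    define F where "F = fst ` C"
    have F: "F \<subseteq> faces S" using C by (auto simp: F_def darts_def)
    have CF: "(f, k) \<in> C" if fk: "f \<in> F" "k < gon S" for f k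
    proof -
      obtain j where j: "(f, j) \<in> C" using fk by (auto simp: F_def)
      then have "j < gon S" using C by (auto simp: darts_def)
      \<comment> \<open>Turning by this amount takes side \<open>j\<close> to side
        \<open>k\<close>.\<close>
      have "turn (gon S) (k + gon S - j) (f, j) \<in> C" using j cl by blast
      then show ?thesis using \<open>j < gon S\<close> that by (simp add: turn_def)
    qed
    have gF: "g \<in> F" if fx: "((f, x), (g, y)) \<in> glue_rel S" "f \<in> F" for f x g y
    proof -
      obtain f' k g' l s where 1: "k < gon S" "glue S (f', k) = (g', l)"
        "(f, x) = (f', side_pt (gon S) k s)" "(g, y) = (g', side_pt (gon S) l (1 - s))"
        using glue_relE[OF S fx(1)] by metis
      have "glue S (f', k) \<in> C" using cl CF[of f' k] 1 fx by auto
      then show ?thesis using 1 by (force simp: F_def)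
    qed
    have sat: "saturated S (G \<times> poly_of S)" if G: "G = F \<or> G = faces S - F" for G
      unfolding saturated_def
    proof (intro conjI allI impI)
      show "G \<times> poly_of S \<subseteq> cells S" using G F by (auto simp: cells_def)
      fix q r assume q: "q \<in> G \<times> poly_of S" and qr: "(q, r) \<in> glue_rel S"
      have "r \<in> cells S" using glue_rel_cells[OF S qr] by simp
      moreover have "fst r \<in> F \<longleftrightarrow> fst q \<in> F"
        using gF[of "fst q" "snd q" "fst r" "snd r"] gF[of "fst r" "snd r" "fst q" "snd q"] qr glue_rel_sym[OF S qr] by auto
      ultimately show "r \<in> G \<times> poly_of S" using q G by (auto simp: cells_def)
    qed
    have op: "openin (surf_top S) (pts_of S (G \<times> poly_of S))" if G: "G = F \<or> G = faces S - F" for G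
    proof (rule openin_pts_of[OF S sat[OF G]])
      fix f
      have "{x. (f, x) \<in> G \<times> poly_of S} = (if f \<in> G then poly_of S else {})" by auto
      then show "openin (top_of_set (poly_of S)) {x. (f, x) \<in> G \<times> poly_of S}" by simp
    qed
    let ?U = "pts_of S (F \<times> poly_of S)" and ?V = "pts_of S ((faces S - F) \<times> poly_of S)"
    have "?U \<inter> ?V = {}"
    proof (rule ccontr)
      assume "?U \<inter> ?V \<noteq> {}"
      then obtain q where "q \<in> ?U" "q \<in> ?V" by blast
      then obtain f x where f: "f \<in> F" "x \<in> poly_of S" and "pt S f x \<in> ?V"
        unfolding pts_of_def[of S "F \<times> poly_of S"] by auto
      then have "(f, x) \<in> (faces S - F) \<times> poly_of S" using pt_in_pts_of_iff[OF S sat] F by blast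
      with f show False by simp
    qed
    moreover have "topspace (surf_top S) \<subseteq> ?U \<union> ?V"
      unfolding topspace_surf_top[OF S] points_eq pts_of_def by force
    moreover have "?U \<noteq> {}" using C zero_in_polygon[OF p] by (auto simp: F_def pts_of_def)
    ultimately have "?V = {}"
      using assms op[of F] op[of "faces S - F"] unfolding connected_surface_def connected_space_def by blast
    then have "faces S - F = {}" using zero_in_polygon[OF p] by (auto simp: pts_of_def)
    then show ?thesis using CF C by (auto simp: darts_def)
  qed
  ultimately show ?thesis by (auto simp: dart_connected_def)
qed

lemma dart_map_eqI:
  assumes "dart_connected S" "gluing S" "dart_map S T \<alpha>" "dart_map S T \<beta>" "s \<in> darts S" "\<alpha> s = \<beta> s" "t \<in> darts S"
  shows "\<alpha> t = \<beta> t"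
  by (rule dart_connectedD[where P="\<lambda>t. \<alpha> t = \<beta> t", OF assms(1,5,6,7) _ _ assms(2)])
    (simp_all add: dart_mapD[OF assms(3)] dart_mapD[OF assms(4)])

lemma dart_map_surj:
  assumes "dart_map S T \<alpha>" "gluing S" "gluing T" "darts S \<noteq> {}" "dart_connected T"
  shows "\<alpha> ` darts S = darts T"
proof -
  obtain s where s: "s \<in> darts S" using assms(4) by blast
  have "t \<in> \<alpha> ` darts S" if "t \<in> darts T" for t
  proof (rule dart_connectedD[where P="\<lambda>t. t \<in> \<alpha> ` darts S", OF assms(5) _ _ that _ _ assms(3)])
    show "\<alpha> s \<in> darts T" "\<alpha> s \<in> \<alpha> ` darts S" using s dart_mapD[OF assms(1)] by auto
  next
    fix t assume "t \<in> \<alpha> ` darts S"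
    then obtain s where s: "s \<in> darts S" "t = \<alpha> s" by blast
    moreover have "glue S s \<in> darts S" using s assms(2) by (auto simp: gluing_def)
    ultimately show "glue T t \<in> \<alpha> ` darts S"
      using dart_mapD(3)[OF assms(1) s(1)] by (metis imageI)
    fix n
    have "turn (gon S) n s \<in> darts S" using s gluing_gon[OF assms(2)] by (auto simp: darts_def turn_def)
    then show "turn (gon T) n t \<in> \<alpha> ` darts S"
      using dart_mapD(1,4)[OF assms(1)] s by (metis imageI)
  qed
  then show ?thesis using dart_mapD(2)[OF assms(1)] by blast
qed

section \<open>Composition, inverses and recovery of dart maps\<close>

lemma dart_map_compose:
  assumes "dart_map S T \<alpha>" "dart_map T U \<beta>"
  shows "dart_map S U (\<beta> \<circ> \<alpha>)"
  using assms unfolding dart_map_def by auto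

lemma dart_map_inverse:
  assumes "dart_map S T \<alpha>" "bij_betw \<alpha> (darts S) (darts T)" "gluing S"
  shows "dart_map T S (inv_into (darts S) \<alpha>)"
proof -
  let ?\<beta> = "inv_into (darts S) \<alpha>"
  have inj: "inj_on \<alpha> (darts S)" using assms(2) by (rule bij_betw_imp_inj_on)
  have eq: "?\<beta> (\<alpha> s) = s" if "s \<in> darts S" for s using that inj by simp
  have "?\<beta> t \<in> darts S \<and> ?\<beta> (glue T t) = glue S (?\<beta> t) \<and> (\<forall>n. ?\<beta> (turn (gon T) n t) = turn (gon T) n (?\<beta> t))"
    if t: "t \<in> darts T" for t
  proof -
    obtain s where s: "s \<in> darts S" "t = \<alpha> s" using t bij_betw_imp_surj_on[OF assms(2)] by blast
    have "glue S s \<in> darts S" "turn (gon S) n s \<in> darts S" for n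
      using s assms(3) gluing_gon[OF assms(3)] by (auto simp: gluing_def) (auto simp: darts_def turn_def)
    then show ?thesis
      using s eq dart_mapD[OF assms(1)] by metis
  qed
  then show ?thesis using dart_mapD(1)[OF assms(1)] by (simp add: dart_map_def)
qed

lemma face_map_compose:
  assumes "dart_map S T \<alpha>" "dart_map T U \<beta>" "gluing S" "gluing T" "f \<in> faces S"
  shows "face_map (\<beta> \<circ> \<alpha>) f = face_map \<beta> (face_map \<alpha> f)"
    "rot_of (gon S) (\<beta> \<circ> \<alpha>) f = rot_of (gon S) \<beta> (face_map \<alpha> f) * rot_of (gon S) \<alpha> f"
proof -
  have "\<alpha> (f, 0) \<in> darts T"
    using dart_mapD(2)[OF assms(1)] assms gluing_gon[OF assms(3)] by (simp add: darts_def)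
  then have d: "fst (\<alpha> (f, 0)) \<in> faces T" "snd (\<alpha> (f, 0)) < gon T"
    by (auto simp: darts_def)
  show "face_map (\<beta> \<circ> \<alpha>) f = face_map \<beta> (face_map \<alpha> f)"
    using dart_map_rot(1)[OF assms(2,4) d] by (simp add: face_map_def)
  show "rot_of (gon S) (\<beta> \<circ> \<alpha>) f = rot_of (gon S) \<beta> (face_map \<alpha> f) * rot_of (gon S) \<alpha> f"
    using dart_map_rot(3)[OF assms(2,4) d] dart_mapD(1)[OF assms(1)]
    by (simp add: rot_of_def face_map_def)
qed

lemma induces_compose:
  assumes "induces S T \<alpha> \<phi>" "induces T U \<beta> \<psi>" "dart_map S T \<alpha>" "dart_map T U \<beta>" "gluing S" "gluing T"
  shows "induces S U (\<beta> \<circ> \<alpha>) (\<psi> \<circ> \<phi>)"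
  unfolding induces_def
proof (intro ballI)
  fix f x assume f: "f \<in> faces S" "x \<in> poly_of S"
  then have "face_map \<alpha> f \<in> faces T" "rot_of (gon S) \<alpha> f * x \<in> poly_of T"
    using act_in_cells[OF assms(3,5), of "(f, x)"] by (auto simp: cells_def act_def)
  then show "(\<psi> \<circ> \<phi>) (pt S f x) = pt U (face_map (\<beta> \<circ> \<alpha>) f) (rot_of (gon S) (\<beta> \<circ> \<alpha>) f * x)"
    using inducesD[OF assms(1) f] inducesD[OF assms(2)] face_map_compose[OF assms(3-6) f(1)] dart_mapD(1)[OF assms(3)]
    by (simp add: mult.assoc)
qed

lemma induces_cong:
  assumes "induces S T \<alpha> \<phi>" "gluing S" "\<And>s. s \<in> darts S \<Longrightarrow> \<alpha> s = \<beta> s" "\<And>y. y \<in> points S \<Longrightarrow> \<phi> y = \<psi> y"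
  shows "induces S T \<beta> \<psi>"
  unfolding induces_def
proof (intro ballI)
  fix f x assume f: "f \<in> faces S" "x \<in> poly_of S"
  then have "\<alpha> (f, 0) = \<beta> (f, 0)" using assms(3) gluing_gon[OF assms(2)] by (simp add: darts_def)
  then show "\<psi> (pt S f x) = pt T (face_map \<beta> f) (rot_of (gon S) \<beta> f * x)"
    using inducesD[OF assms(1) f] assms(4)[OF pt_in_points[OF f]] by (simp add: face_map_def rot_of_def)
qed

lemma induces_id:
  assumes "induces S S \<alpha> \<phi>" "gluing S" "\<And>s. s \<in> darts S \<Longrightarrow> \<alpha> s = s" "y \<in> points S"
  shows "\<phi> y = y"
proof -
  obtain f x where f: "f \<in> faces S" "x \<in> poly_of S" "y = pt S f x" using assms(4) by (auto simp: points_eq)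
  then have "\<alpha> (f, 0) = (f, 0)" using assms(3) gluing_gon[OF assms(2)] by (simp add: darts_def)
  then show ?thesis using inducesD[OF assms(1) f(1,2)] f by (simp add: face_map_def rot_of_def)
qed

lemma pt_eq_offside:
  assumes S: "gluing S" and f: "f \<in> faces S" "x \<in> poly_of S" "\<And>k. x \<notin> side (gon S) k"
    and g: "g \<in> faces S" "y \<in> poly_of S" "pt S f x = pt S g y"
  shows "f = g" "x = y"
proof -
  note p = gluing_gon[OF S]
  have "x \<noteq> side_pt (gon S) k s" if "0 \<le> s" "s \<le> 1" for k s
    using f(3)[of k] that by (auto simp: side_eq)
  then have ns: "x = side_pt (gon S) k s \<Longrightarrow> 0 \<le> s \<Longrightarrow> s \<le> 1 \<Longrightarrow> False" for k s by blast
  have c: "x \<notin> corners (gon S)"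
    using ns[of _ 0] by (auto simp: corners_def)
  have "((f, x), r) \<notin> glue_rel S" for r
  proof
    assume "((f, x), r) \<in> glue_rel S"
    then obtain f' k g' l s where "0 \<le> s" "s \<le> 1" "(f, x) = (f', side_pt (gon S) k s)"
      using glue_relE[OF S] by metis
    then show False using ns by auto
  qed
  then have "(g, y) = (f, x)"
    using g f pt_eq_iff[OF S f(1,2) g(1,2)] nonvertex_class[OF S c, of f "(g, y)"] by simp
  then show "f = g" "x = y" by auto
qed

lemma pt_rot_unique:
  assumes S: "gluing S" and f: "f \<in> faces S" and g: "g \<in> faces S"
    and eq: "\<And>x. x \<in> poly_of S \<Longrightarrow> pt S f (zeta (gon S) ^ n * x) = pt S g (zeta (gon S) ^ m * x)"
  shows "f = g" "zeta (gon S) ^ n = zeta (gon S) ^ m"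
proof -
  note p = gluing_gon[OF S]
  \<comment> \<open>Halfway along a spoke: off all sides in every rotated position, so the point has
    one representative, and nonzero, so that it distinguishes rotations.\<close>
  let ?x = "of_real (1/2) * vert (gon S) 0"
  have x: "?x \<in> poly_of S" using p by (intro scale_in_polygon polygon_vert) auto
  have "zeta (gon S) ^ n * ?x = of_real (1/2) * vert (gon S) n"
    using vert_eq[of "gon S" n] by (simp add: mult_ac)
  then have "zeta (gon S) ^ n * ?x \<notin> side (gon S) k" for k
    using spoke_notin_side[OF p, of "1/2"] by simp
  moreover have "zeta (gon S) ^ n * ?x \<in> poly_of S" "zeta (gon S) ^ m * ?x \<in> poly_of S"
    using x p by (simp_all only: rotate_in_polygon)
  ultimately have "f = g \<and> zeta (gon S) ^ n * ?x = zeta (gon S) ^ m * ?x"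
    using pt_eq_offside[OF S f _ _ g _ eq[OF x]] by presburger
  then show "f = g" "zeta (gon S) ^ n = zeta (gon S) ^ m" by simp_all
qed

text \<open>The converse passage from points to darts: knowing the point map on one face in charts,
  with its rotation, fixes the dart map on the sides of that face.\<close>

lemma induces_dart_unique:
  assumes S: "gluing S" and T: "gluing T" and \<alpha>: "dart_map S T \<alpha>" "induces S T \<alpha> \<phi>"
    and s: "s \<in> darts S" and \<phi>: "g \<in> faces T" "m < gon S"
      "\<And>x. x \<in> poly_of S \<Longrightarrow> \<phi> (pt S (fst s) x) = pt T g (zeta (gon S) ^ m * x)"
  shows "\<alpha> s = (g, (snd s + m) mod gon S)"
proof -
  note pT = dart_mapD(1)[OF \<alpha>(1)]
  have f: "fst s \<in> faces S" "snd s < gon S" using s by (auto simp: darts_def)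
  define n where "n = snd (\<alpha> (fst s, 0))"
  have n: "n < gon S" unfolding n_def
    using dart_map_rot(2)[OF \<alpha>(1) S f(1), of 0] gluing_gon[OF S] by simp
  have *: "pt T (face_map \<alpha> (fst s)) (zeta (gon T) ^ n * x) = pt T g (zeta (gon T) ^ m * x)" if "x \<in> poly_of T" for x
    using that \<phi>(3) inducesD[OF \<alpha>(2) f(1), of x] pT by (simp add: rot_of_def n_def)
  have "face_map \<alpha> (fst s) = g" "zeta (gon T) ^ n = zeta (gon T) ^ m"
    using pt_rot_unique[OF T face_map_in[OF \<alpha>(1) S f(1)] \<phi>(1) *] by blast+
  then have "n = m" using zeta_power_inj[of "gon T" n m] n \<phi>(2) pT by simp
  then show ?thesis
    using dart_map_apply[OF \<alpha>(1) S f] \<open>face_map \<alpha> (fst s) = g\<close> by (simp add: n_def)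
qed

section \<open>Rotations as maps of darts\<close>

text \<open>The point one third along a side is compared with its glued partner: the midpoint would not
  exclude a fold along the side.\<close>

lemma carries_dart_map:
  assumes S: "gluing S" and T: "gluing T" and ST: "gon S = gon T"
    and \<phi>: "\<And>f. f \<in> faces S \<Longrightarrow> \<exists>g A. carries S T \<phi> f g A \<and> orientation_preserving_on (poly_of S) A"
  obtains \<alpha> where "dart_map S T \<alpha>" "induces S T \<alpha> \<phi>"
proof -
  define p where "p = gon S"
  have p: "p \<ge> 3" "gon S = p" "gon T = p" using gluing_gon[OF S] ST by (simp_all add: p_def)
  have "\<exists>g n. g \<in> faces T \<and> n < p \<and> (\<forall>x \<in> poly_of S. \<phi> (pt S f x) = pt T g (zeta p ^ n * x))"
    if f: "f \<in> faces S" for f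
  proof -
    obtain g A where A: "carries S T \<phi> f g A" "orientation_preserving_on (poly_of S) A" using \<phi>[OF f] by blast
    then obtain n where "n < p" "\<And>x. x \<in> polygon p \<Longrightarrow> A x = zeta p ^ n * x"
      using orientation_preserving_rotation[OF p(1), of A] p by (auto simp: carries_def)
    with A show ?thesis using p by (auto simp: carries_def intro!: exI[of _ g] exI[of _ n])
  qed
  then obtain F n where F: "\<And>f. f \<in> faces S \<Longrightarrow> F f \<in> faces T" and n: "\<And>f. f \<in> faces S \<Longrightarrow> n f < p"
    and Fn: "\<And>f x. f \<in> faces S \<Longrightarrow> x \<in> poly_of S \<Longrightarrow> \<phi> (pt S f x) = pt T (F f) (zeta p ^ n f * x)"
    by metis
  define \<alpha> where "\<alpha> s = (F (fst s), (snd s + n (fst s)) mod p)" for s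
  have rot: "zeta p ^ n f * side_pt p k s = side_pt p (snd (\<alpha> (f, k))) s" for f k s
    using p by (simp add: \<alpha>_def side_pt_mod side_pt_add)
  have g: "\<alpha> (glue S s) = glue T (\<alpha> s)" if s: "s \<in> darts S" for s
  proof -
    obtain f k where fk: "s = (f, k)" "f \<in> faces S" "k < p" using s p by (auto simp: darts_def)
    obtain g l where gl: "glue S (f, k) = (g, l)" by fastforce
    have d: "g \<in> faces S" "l < p" using glue_dart[OF S fk(2) _ gl] fk p by auto
    have lt: "snd (\<alpha> (f', k')) < p" for f' k' using p by (simp add: \<alpha>_def)
    obtain h m where hm: "glue T (\<alpha> (f, k)) = (h, m)" by fastforce
    have hm': "glue T (F f, snd (\<alpha> (f, k))) = (h, m)" using hm by (simp add: \<alpha>_def)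
    have dT: "h \<in> faces T" "m < p" using glue_dart[OF T F[OF fk(2)] _ hm'] lt[of f k] p by auto
    let ?x = "side_pt p (snd (\<alpha> (f, k))) (1/3)" and ?y = "side_pt p (snd (\<alpha> (g, l))) (2/3)"
    have "pt S f (side_pt p k (1/3)) = pt S g (side_pt p l (1 - 1/3))"
      using pt_side_pt[OF S fk(2) _ gl, of "1/3"] fk p by simp
    then have "pt T (F f) (zeta p ^ n f * side_pt p k (1/3)) = pt T (F g) (zeta p ^ n g * side_pt p l (1 - 1/3))"
      using Fn[OF fk(2), of "side_pt p k (1/3)"] Fn[OF d(1), of "side_pt p l (1 - 1/3)"] p
      by (simp add: side_pt_in_polygon)
    then have "pt T (F f) ?x = pt T (F g) ?y" unfolding rot by simp
    then have "((F f, ?x), (F g, ?y)) \<in> (glue_rel T)\<^sup>*"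
      using pt_eq_iff[OF T F[OF fk(2)] _ F[OF d(1)], of ?x ?y] p by (simp add: side_pt_in_polygon)
    moreover have nc: "?x \<notin> corners (gon T)"
      using side_pt_corner_iff[OF p(1) lt, of "1/3"] p by simp
    ultimately have "(F g, ?y) = (F f, ?x) \<or> ((F f, ?x), (F g, ?y)) \<in> glue_rel T"
      by (simp add: nonvertex_class[OF T])
    moreover have "?y \<noteq> ?x"
    proof
      assume "?y = ?x"
      then have "(2/3::real) = 1/3"
        using side_pt_unique(2)[OF p(1) lt lt _ _ _ _ \<open>?y = ?x\<close>[symmetric]] by simp
      then show False by simp
    qed
    moreover have "((F f, ?x), (h, side_pt p m (1 - 1/3))) \<in> glue_rel T"
      using glue_relI[OF T F[OF fk(2)] _ hm', of "1/3"] lt p by simp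
    ultimately have "(F g, ?y) = (h, side_pt p m (1 - 1/3))"
      using glue_rel_functional[OF T] nc by (metis snd_conv prod.inject)
    then have "F g = h" "snd (\<alpha> (g, l)) = m"
      using side_pt_unique(1)[OF p(1) lt dT(2), of "2/3" "2/3"] by auto
    then show ?thesis using hm gl fk by (simp add: \<alpha>_def)
  qed
  have "dart_map S T \<alpha>"
    unfolding dart_map_def
  proof (intro conjI ballI allI)
    fix s k assume s: "s \<in> darts S"
    show "\<alpha> s \<in> darts T" using s F p by (auto simp: \<alpha>_def darts_def)
    show "\<alpha> (glue S s) = glue T (\<alpha> s)" using g[OF s] .
    show "\<alpha> (turn (gon S) k s) = turn (gon S) k (\<alpha> s)"
      by (simp add: \<alpha>_def turn_def p mod_simps add_ac)
  qed (rule ST)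
  moreover have "induces S T \<alpha> \<phi>"
    using Fn n by (simp add: induces_def face_map_def rot_of_def \<alpha>_def p)
  ultimately show thesis by (rule that)
qed

definition dart_auto :: "'f polysurf \<Rightarrow> ('f \<times> nat \<Rightarrow> 'f \<times> nat) \<Rightarrow> bool" where
  "dart_auto S \<alpha> \<longleftrightarrow> dart_map S S \<alpha> \<and> bij_betw \<alpha> (darts S) (darts S)"

lemma carries_rot_of:
  assumes "induces S T \<alpha> \<phi>" "dart_map S T \<alpha>" "gluing S" "f \<in> faces S"
  shows "carries S T \<phi> f (face_map \<alpha> f) (\<lambda>x. rot_of (gon S) \<alpha> f * x)"
    "orientation_preserving_on (poly_of S) (\<lambda>x. rot_of (gon S) \<alpha> f * x)"
proof -
  have "(\<lambda>x. rot_of (gon S) \<alpha> f * x) ` poly_of S = poly_of T"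
    using rotate_polygon gluing_gon[OF assms(3)] dart_mapD(1)[OF assms(2)] by (simp add: rot_of_def)
  moreover have "dist (rot_of (gon S) \<alpha> f * x) (rot_of (gon S) \<alpha> f * y) = dist x y" for x y
    by (simp add: dist_norm norm_mult flip: right_diff_distrib)
  ultimately show "carries S T \<phi> f (face_map \<alpha> f) (\<lambda>x. rot_of (gon S) \<alpha> f * x)"
    using inducesD[OF assms(1)] face_map_in[OF assms(2-4)] assms(4) by (simp add: carries_def)
  show "orientation_preserving_on (poly_of S) (\<lambda>x. rot_of (gon S) \<alpha> f * x)"
    unfolding orientation_preserving_on_def by (metis add.right_neutral norm_rot_of)
qed

lemma induces_auto_homeomorphic:
  assumes S: "gluing S" and \<alpha>: "dart_auto S \<alpha>" "induces S S \<alpha> \<phi>"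
  shows "homeomorphic_map (surf_top S) (surf_top S) \<phi>"
proof -
  let ?\<beta> = "inv_into (darts S) \<alpha>"
  have \<alpha>': "dart_map S S \<alpha>" and b: "bij_betw \<alpha> (darts S) (darts S)" using \<alpha> by (auto simp: dart_auto_def)
  have \<beta>: "dart_map S S ?\<beta>" using dart_map_inverse[OF \<alpha>' b S] .
  obtain \<psi> where \<psi>: "induces S S ?\<beta> \<psi>" using induces_exists[OF \<beta> S S] by blast
  have "(\<psi> \<circ> \<phi>) y = y" if "y \<in> points S" for y
    by (rule induces_id[OF induces_compose[OF \<alpha>(2) \<psi> \<alpha>' \<beta> S S] S _ that])
      (use b in \<open>simp add: bij_betw_inv_into_left\<close>)
  moreover have "(\<phi> \<circ> \<psi>) y = y" if "y \<in> points S" for y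
    by (rule induces_id[OF induces_compose[OF \<psi> \<alpha>(2) \<beta> \<alpha>' S S] S _ that])
      (use b in \<open>simp add: bij_betw_inv_into_right\<close>)
  ultimately have "homeomorphic_maps (surf_top S) (surf_top S) \<phi> \<psi>"
    using induces_continuous[OF \<alpha>(2) \<alpha>' S S] induces_continuous[OF \<psi> \<beta> S S]
    by (simp add: homeomorphic_maps_def topspace_surf_top[OF S])
  then show ?thesis by (rule homeomorphic_maps_imp_map)
qed

text \<open>For the dart map of a rotation, injectivity comes from the centres of faces: they have a
  single representative, so an injective \<open>\<phi>\<close> cannot merge two faces, and inside a
  face the dart map is a shift. Conversely the inverse dart map induces the inverse
  homeomorphism.\<close>

lemma Rot_set_iff:
  assumes con: "connected_surface S"
  shows "\<phi> \<in> Rot_set S \<longleftrightarrow> \<phi> \<in> extensional (points S) \<and> (\<exists>\<alpha>. dart_auto S \<alpha> \<and> induces S S \<alpha> \<phi>)"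
proof
  note S = connected_surface_gluing[OF con]
  assume \<phi>: "\<phi> \<in> Rot_set S"
  then have B: "\<phi> \<in> extensional (points S)" "inj_on \<phi> (points S)"
    by (auto simp: Rot_set_def Aut_set_def Bij_def bij_betw_def)
  have "\<exists>g A. carries S S \<phi> f g A \<and> orientation_preserving_on (poly_of S) A" if "f \<in> faces S" for f
    using \<phi> that by (auto simp: Rot_set_def)
  then obtain \<alpha> where \<alpha>: "dart_map S S \<alpha>" "induces S S \<alpha> \<phi>"
    using carries_dart_map[OF S S refl] by metis
  have "inj_on \<alpha> (darts S)"
  proof (rule inj_onI)
    fix s t assume st: "s \<in> darts S" "t \<in> darts S" "\<alpha> s = \<alpha> t"
    obtain f k g l where fk: "s = (f, k)" "f \<in> faces S" "k < gon S" and gl: "t = (g, l)" "g \<in> faces S" "l < gon S"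
      using st by (auto simp: darts_def)
    have z: "0 \<in> poly_of S" by (rule zero_in_polygon[OF gluing_gon[OF S]])
    have "face_map \<alpha> f = face_map \<alpha> g"
      using dart_map_rot(1)[OF \<alpha>(1) S] st(3) fk gl by metis
    then have "\<phi> (pt S f 0) = \<phi> (pt S g 0)" using inducesD[OF \<alpha>(2) _ z] fk gl by simp
    then have e: "pt S f 0 = pt S g 0"
      using inj_onD[OF B(2)] pt_in_points[OF fk(2) z] pt_in_points[OF gl(2) z] by blast
    have "0 \<notin> side (gon S) k" for k
      using spoke_notin_side[OF gluing_gon[OF S], of 0] by simp
    then have "f = g" using pt_eq_offside(1)[OF S fk(2) z _ gl(2) z e] by blast
    moreover have "rot_of (gon S) \<alpha> f * zeta (gon S) ^ k = rot_of (gon S) \<alpha> g * zeta (gon S) ^ l"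
      using dart_map_rot(3)[OF \<alpha>(1) S] st(3) fk gl by metis
    ultimately have "zeta (gon S) ^ k = zeta (gon S) ^ l" by simp
    then show "s = t" using zeta_power_inj fk gl \<open>f = g\<close> by simp
  qed
  moreover have "\<alpha> ` darts S = darts S"
    using dart_map_surj[OF \<alpha>(1) S S] connected_surface_darts[OF con] by (auto simp: dart_connected_def)
  ultimately have "dart_auto S \<alpha>" using \<alpha> by (auto simp: dart_auto_def bij_betw_def)
  with \<alpha> B show "\<phi> \<in> extensional (points S) \<and> (\<exists>\<alpha>. dart_auto S \<alpha> \<and> induces S S \<alpha> \<phi>)" by blast
next
  note S = connected_surface_gluing[OF con]
  assume "\<phi> \<in> extensional (points S) \<and> (\<exists>\<alpha>. dart_auto S \<alpha> \<and> induces S S \<alpha> \<phi>)"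
  then obtain \<alpha> where e: "\<phi> \<in> extensional (points S)" and \<alpha>: "dart_auto S \<alpha>" "induces S S \<alpha> \<phi>" by blast
  have h: "homeomorphic_map (surf_top S) (surf_top S) \<phi>" by (rule induces_auto_homeomorphic[OF S \<alpha>])
  then have "bij_betw \<phi> (points S) (points S)"
    using homeomorphic_imp_injective_map[OF h] homeomorphic_imp_surjective_map[OF h]
    by (simp add: bij_betw_def topspace_surf_top[OF S])
  with e h show "\<phi> \<in> Rot_set S"
    using carries_rot_of[OF \<alpha>(2) _ S] \<alpha>(1) by (auto simp: Rot_set_def Aut_set_def Bij_def dart_auto_def)
qed

section \<open>The group of rotations\<close>

lemma Rot_set_Bij: "Rot_set S \<subseteq> Bij (points S)"
  by (auto simp: Rot_set_def Aut_set_def)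

lemma dart_auto_compose: "dart_auto S \<alpha> \<Longrightarrow> dart_auto S \<beta> \<Longrightarrow> dart_auto S (\<beta> \<circ> \<alpha>)"
  by (auto simp: dart_auto_def intro: dart_map_compose bij_betw_trans)

lemma dart_auto_inverse: "dart_auto S \<alpha> \<Longrightarrow> gluing S \<Longrightarrow> dart_auto S (inv_into (darts S) \<alpha>)"
  by (auto simp: dart_auto_def intro: dart_map_inverse bij_betw_inv_into)

lemma Rot_set_subgroup:
  assumes con: "connected_surface S"
  shows "subgroup (Rot_set S) (BijGroup (points S))"
proof (rule group.subgroupI[OF group_BijGroup])
  note S = connected_surface_gluing[OF con]
  show "Rot_set S \<subseteq> carrier (BijGroup (points S))" using Rot_set_Bij by (simp add: BijGroup_def)
  have "dart_auto S id" by (auto simp: dart_auto_def dart_map_def)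
  moreover have "induces S S id (\<lambda>y\<in>points S. y)"
    by (auto simp: induces_def face_map_def rot_of_def pt_in_points)
  ultimately show "Rot_set S \<noteq> {}"
    using Rot_set_iff[OF con, of "\<lambda>y\<in>points S. y"] by auto
next
  note S = connected_surface_gluing[OF con]
  fix \<phi> assume \<phi>: "\<phi> \<in> Rot_set S"
  then obtain \<alpha> where \<alpha>: "dart_auto S \<alpha>" "induces S S \<alpha> \<phi>" using Rot_set_iff[OF con] by blast
  then have d: "dart_map S S \<alpha>" and b: "bij_betw \<alpha> (darts S) (darts S)" by (auto simp: dart_auto_def)
  note \<beta> = dart_auto_inverse[OF \<alpha>(1) S]
  then have d': "dart_map S S (inv_into (darts S) \<alpha>)" by (simp add: dart_auto_def)
  obtain \<psi> where \<psi>: "induces S S (inv_into (darts S) \<alpha>) \<psi>" "\<psi> \<in> extensional (points S)"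
    using induces_exists[OF d' S S] by blast
  then have \<psi>R: "\<psi> \<in> Rot_set S" using \<beta> Rot_set_iff[OF con] by blast
  have "(\<psi> \<circ> \<phi>) y = y" if "y \<in> points S" for y
    by (rule induces_id[OF induces_compose[OF \<alpha>(2) \<psi>(1) d d' S S] S _ that])
      (use b in \<open>simp add: bij_betw_inv_into_left\<close>)
  then have "\<psi> \<otimes>\<^bsub>BijGroup (points S)\<^esub> \<phi> = \<one>\<^bsub>BijGroup (points S)\<^esub>"
    using \<phi> \<psi>R Rot_set_Bij by (auto simp: BijGroup_def compose_def fun_eq_iff)
  then have "inv\<^bsub>BijGroup (points S)\<^esub> \<phi> = \<psi>"
  proof (rule group.inv_equality[OF group_BijGroup])
    show "\<phi> \<in> carrier (BijGroup (points S))" "\<psi> \<in> carrier (BijGroup (points S))"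
      using \<phi> \<psi>R Rot_set_Bij by (auto simp: BijGroup_def)
  qed
  then show "inv\<^bsub>BijGroup (points S)\<^esub> \<phi> \<in> Rot_set S" using \<psi>R by simp
next
  note S = connected_surface_gluing[OF con]
  fix \<phi> \<psi> assume R: "\<phi> \<in> Rot_set S" "\<psi> \<in> Rot_set S"
  then obtain \<alpha> \<beta> where \<alpha>: "dart_auto S \<alpha>" "induces S S \<alpha> \<phi>" and \<beta>: "dart_auto S \<beta>" "induces S S \<beta> \<psi>"
    using Rot_set_iff[OF con] by meson
  have "induces S S (\<alpha> \<circ> \<beta>) (\<phi> \<circ> \<psi>)"
    using induces_compose[OF \<beta>(2) \<alpha>(2) _ _ S S] \<alpha> \<beta> by (simp add: dart_auto_def)
  then have "induces S S (\<alpha> \<circ> \<beta>) (compose (points S) \<phi> \<psi>)"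
    by (rule induces_cong[OF _ S]) (simp_all add: compose_def)
  then show "\<phi> \<otimes>\<^bsub>BijGroup (points S)\<^esub> \<psi> \<in> Rot_set S"
    using R Rot_set_Bij[of S] Rot_set_iff[OF con, of "compose (points S) \<phi> \<psi>"] dart_auto_compose[OF \<beta>(1) \<alpha>(1)]
    by (auto simp: BijGroup_def subset_iff)
qed

lemma Rot_mult:
  assumes "\<phi> \<in> Rot_set S" "\<psi> \<in> Rot_set S"
  shows "\<phi> \<otimes>\<^bsub>Rot S\<^esub> \<psi> = compose (points S) \<phi> \<psi>"
  using assms Rot_set_Bij[of S] by (auto simp: Rot_def BijGroup_def subset_iff)

lemma carrier_Rot [simp]: "carrier (Rot S) = Rot_set S"
  by (simp add: Rot_def)

lemma group_Rot: "connected_surface S \<Longrightarrow> group (Rot S)"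
  unfolding Rot_def using Rot_set_subgroup group_BijGroup by (rule subgroup.subgroup_is_group)

lemma compose_in_Rot:
  assumes "connected_surface S" "\<phi> \<in> Rot_set S" "\<psi> \<in> Rot_set S"
  shows "compose (points S) \<phi> \<psi> \<in> Rot_set S"
  using monoid.m_closed[OF group.is_monoid[OF group_Rot[OF assms(1)]], of \<phi> \<psi>] assms Rot_mult[OF assms(2,3)] by simp

lemma Rot_from_auto:
  assumes "connected_surface S" "dart_auto S \<alpha>"
  obtains \<phi> where "\<phi> \<in> Rot_set S" "induces S S \<alpha> \<phi>"
proof -
  have "dart_map S S \<alpha>" using assms(2) by (simp add: dart_auto_def)
  then obtain \<phi> where "induces S S \<alpha> \<phi>" "\<phi> \<in> extensional (points S)"
    using induces_exists connected_surface_gluing[OF assms(1)] by metis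
  then show thesis using that Rot_set_iff[OF assms(1)] assms(2) by blast
qed

lemma Rot_set_ext: "\<phi> \<in> Rot_set S \<Longrightarrow> \<phi> \<in> extensional (points S)"
  and Rot_set_points: "\<phi> \<in> Rot_set S \<Longrightarrow> y \<in> points S \<Longrightarrow> \<phi> y \<in> points S"
  using Rot_set_Bij[of S] by (auto simp: Bij_def bij_betw_def)

section \<open>From flag transitivity to dart transitivity\<close>

lemma carries_cong:
  assumes "carries S T \<phi> f g A" "\<And>x. x \<in> poly_of S \<Longrightarrow> A x = B x"
  shows "carries S T \<phi> f g B"
  using assms unfolding carries_def by (auto simp: image_def)

text \<open>Orientation propagates across edges. On a common side the isometry of the next face is
  forced by the one already known to be a rotation, and an isometry of the polygon that agrees with
  a rotation at two points of a side is that rotation.\<close>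

lemma isometry_spread:
  assumes con: "connected_surface S" and \<phi>: "\<phi> \<in> Aut_set S"
    and f0: "carries S S \<phi> f0 g0 (\<lambda>x. zeta (gon S) ^ n0 * x)"
  shows "\<phi> \<in> Rot_set S"
proof -
  note S = connected_surface_gluing[OF con]
  define p where "p = gon S"
  have p: "p \<ge> 3" "gon S = p" using gluing_gon[OF S] by (simp_all add: p_def)
  have inj: "inj_on \<phi> (points S)" using \<phi> by (auto simp: Aut_set_def Bij_def bij_betw_def)
  let ?P = "\<lambda>s. \<exists>g n. carries S S \<phi> (fst s) g (\<lambda>x. zeta p ^ n * x)"
  have "?P s" if s: "s \<in> darts S" for s
  proof (rule dart_connectedD[where P="?P", OF connected_surface_darts[OF con] _ _ s _ _ S])
    show "(f0, 0) \<in> darts S" using f0 p by (simp add: carries_def darts_def)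
    show "?P (f0, 0)" using f0 p by auto
    show "?P (turn (gon S) n s)" if "?P s" for s n using that by (simp add: turn_def)
  next
    fix s assume s: "s \<in> darts S" "?P s"
    obtain f k where fk: "s = (f, k)" "f \<in> faces S" "k < p" using s p by (auto simp: darts_def)
    obtain f' n where f': "carries S S \<phi> f f' (\<lambda>x. zeta p ^ n * x)" using s fk by auto
    obtain g l where gl: "glue S (f, k) = (g, l)" by fastforce
    have d: "g \<in> faces S" "l < p" using glue_dart[OF S fk(2) _ gl] fk p by auto
    obtain g' A where A: "carries S S \<phi> g g' A" using \<phi> d by (auto simp: Aut_set_def)
    have f'S: "f' \<in> faces S" and g'S: "g' \<in> faces S" using f' A by (auto simp: carries_def)
    have \<phi>f: "\<phi> (pt S f x) = pt S f' (zeta p ^ n * x)" if "x \<in> polygon p" for x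
      using f' that p by (auto simp: carries_def)
    have \<phi>g: "\<phi> (pt S g x) = pt S g' (A x)" if "x \<in> polygon p" for x
      using A that p by (auto simp: carries_def)
    have AP: "A ` polygon p = polygon p" using A p by (simp add: carries_def)
    define k' where "k' = (k + n) mod p"
    have k': "k' < p" using p by (simp add: k'_def)
    have rot: "zeta p ^ n * side_pt p k s = side_pt p k' s" for s
      using p by (simp add: k'_def side_pt_mod side_pt_add)
    obtain h m where hm: "glue S (f', k') = (h, m)" by fastforce
    have m: "m < p" using glue_dart(2)[OF S f'S _ hm] k' p by simp
    show "?P (glue S s)"
    proof (cases "g = f")
      case True
      with f' gl fk show ?thesis by auto
    next
      case False
      \<comment> \<open>The image of an inner point of the common side has at most two
        representatives, one of them known and in \<open>f'\<close>. Once \<open>g'\<close> is a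
        different face, the representative in \<open>g'\<close> must be the other one, the glued
        partner.\<close>
      have "g' \<noteq> f'"
      proof
        assume "g' = f'"
        have z: "0 \<in> polygon p" by (rule zero_in_polygon[OF p(1)])
        then obtain y where y: "y \<in> polygon p" "A y = 0" using AP by (metis imageE)
        then have "\<phi> (pt S g y) = \<phi> (pt S f 0)" using \<phi>f[OF z] \<phi>g[OF y(1)] \<open>g' = f'\<close> by simp
        then have "pt S f 0 = pt S g y"
          using inj_onD[OF inj] pt_in_points[OF fk(2)] pt_in_points[OF d(1)] y z p by metis
        then have "f = g"
          using pt_eq_offside(1)[OF S fk(2) _ _ d(1)] y z p spoke_notin_side[OF p(1), of 0] by simp
        with False show False by simp
      qed
      have eq: "A (side_pt p l (1 - s)) = zeta p ^ (m + p - l) * side_pt p l (1 - s)" if s: "0 < s" "s < 1" for s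
      proof -
        have in1: "side_pt p k s \<in> polygon p" "side_pt p l (1 - s) \<in> polygon p"
          using s p by (auto intro!: side_pt_in_polygon)
        have "pt S f (side_pt p k s) = pt S g (side_pt p l (1 - s))"
          using pt_side_pt[OF S fk(2) _ gl, of s] s fk p by simp
        then have "pt S f' (side_pt p k' s) = pt S g' (A (side_pt p l (1 - s)))"
          using \<phi>f[OF in1(1)] \<phi>g[OF in1(2)] rot by simp
        moreover have "A (side_pt p l (1 - s)) \<in> polygon p" using AP in1 by blast
        ultimately have "((f', side_pt p k' s), (g', A (side_pt p l (1 - s)))) \<in> (glue_rel S)\<^sup>*"
          using pt_eq_iff[OF S f'S _ g'S] s p by (simp add: side_pt_in_polygon)
        moreover have nc: "side_pt p k' s \<notin> corners (gon S)"
          using side_pt_corner_iff[OF p(1) k', of s] s p by simp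
        ultimately have "((f', side_pt p k' s), (g', A (side_pt p l (1 - s)))) \<in> glue_rel S"
          using \<open>g' \<noteq> f'\<close> by (simp add: nonvertex_class[OF S])
        moreover have "((f', side_pt p k' s), (h, side_pt p m (1 - s))) \<in> glue_rel S"
          using glue_relI[OF S f'S _ hm, of s] s k' p by simp
        ultimately have "A (side_pt p l (1 - s)) = side_pt p m (1 - s)"
          using glue_rel_functional[OF S] nc by (metis snd_conv prod.inject)
        also have "\<dots> = side_pt p (l + (m + p - l)) (1 - s)"
          using side_pt_mod[of p "m + p"] side_pt_mod[of p m] p d by simp
        finally show ?thesis by (simp add: side_pt_add)
      qed
      \<comment> \<open>Any two inner points of the side would do. The ends are avoided because they
        are vertices, where the representative in \<open>g'\<close> is not determined by one
        gluing.\<close>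
      have "A x = zeta p ^ (m + p - l) * x" if x: "x \<in> polygon p" for x
      proof (rule isometry_eq_rotation[where s="1/3" and t="2/3", OF p(1) _ _ _ _ _ _ _ _ _ x d(2)])
        show "A ` polygon p \<subseteq> polygon p" using AP by simp
        show "dist (A x) (A y) = dist x y" if "x \<in> polygon p" "y \<in> polygon p" for x y
          using A that p by (auto simp: carries_def)
        show "A (side_pt p l (1/3)) = zeta p ^ (m + p - l) * side_pt p l (1/3)" using eq[of "2/3"] by simp
        show "A (side_pt p l (2/3)) = zeta p ^ (m + p - l) * side_pt p l (2/3)" using eq[of "1/3"] by simp
      qed auto
      then have "carries S S \<phi> g g' (\<lambda>x. zeta p ^ (m + p - l) * x)"
        using carries_cong[OF A] p by simp
      then show ?thesis using gl fk by auto
    qed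
  qed
  then have "\<exists>g n. carries S S \<phi> f g (\<lambda>x. zeta p ^ n * x)" if "f \<in> faces S" for f
    using that p by (force simp: darts_def)
  moreover have "orientation_preserving_on (poly_of S) (\<lambda>x. zeta p ^ n * x)" for n
    unfolding orientation_preserving_on_def by (intro exI[of _ "zeta p ^ n"] exI[of _ 0]) (simp add: norm_power)
  ultimately show ?thesis using \<phi> unfolding Rot_set_def by blast
qed

text \<open>An automorphism that matches the sides and their initial endpoints also preserves the
  sense of the side. As the polygon stays to the left of it, the automorphism is a rotation on this
  face, and then on every face.\<close>

lemma platonic_dart_transitive:
  assumes D: "platonic_surface D" and s: "s \<in> darts D" and t: "t \<in> darts D"
  obtains \<alpha> where "dart_auto D \<alpha>" "\<alpha> s = t"
proof -
  have con: "connected_surface D" using D by (simp add: platonic_surface_def)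
  note S = connected_surface_gluing[OF con]
  define p where "p = gon D"
  have p: "p \<ge> 3" "gon D = p" using gluing_gon[OF S] by (simp_all add: p_def)
  obtain f k g l where fk: "s = (f, k)" "f \<in> faces D" "k < p" and gl: "t = (g, l)" "g \<in> faces D" "l < p"
    using s t p by (auto simp: darts_def)
  \<comment> \<open>The initial endpoint is taken in both flags; this encodes the sense of the
    dart.\<close>
  have "(f, k, vert p k) \<in> flags D" "(g, l, vert p l) \<in> flags D" using fk gl p by (auto simp: flags_def)
  then obtain \<phi> where \<phi>: "\<phi> \<in> Aut_set D" "maps_flag D \<phi> (f, k, vert p k) (g, l, vert p l)"
    using D unfolding platonic_surface_def by blast
  then obtain A where A: "carries D D \<phi> f g A" "A ` side p k = side p l" "A (vert p k) = vert p l"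
    using p by (auto simp: maps_flag_def)
  have iso: "dist (A x) (A y) = dist x y" if "x \<in> polygon p" "y \<in> polygon p" for x y
    using A that p by (auto simp: carries_def)
  have "side_pt p l 1 \<in> side p l" unfolding side_eq by (rule imageI) simp
  then have "side_pt p l 1 \<in> A ` side p k" unfolding A(2) .
  then obtain u where u: "0 \<le> u" "u \<le> 1" "A (side_pt p k u) = side_pt p l 1"
    unfolding side_eq by auto
  have len: "cmod (side_vec p i) = cmod (side_vec p 0)" for i
    unfolding side_vec_eq[of p i] by (simp add: norm_mult norm_power)
  \<comment> \<open>All sides have the same length, so the preimage of the final endpoint is at full
    distance from the initial one, that is, \<open>u = 1\<close>.\<close>
  have "dist (side_pt p l 1) (vert p l) = dist (side_pt p k u) (vert p k)"
    using iso[of "side_pt p k u" "vert p k"] u A(3) p by (simp add: side_pt_in_polygon polygon_vert)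
  then have "cmod (side_vec p l) = u * cmod (side_vec p k)"
    using u by (simp add: dist_norm side_pt_def norm_mult)
  then have "u = 1" using side_vec_nonzero[OF p(1), of 0] len[of k] len[of l] by simp
  define n where "n = l + p - k"
  have rot: "zeta p ^ n * side_pt p k r = side_pt p l r" for r
  proof -
    have "zeta p ^ n * side_pt p k r = side_pt p (l + p) r"
      using fk by (simp add: n_def flip: side_pt_add)
    then show ?thesis using side_pt_mod[of p "l + p"] side_pt_mod[of p l] p by simp
  qed
  have "A x = zeta p ^ n * x" if x: "x \<in> polygon p" for x
  proof (rule isometry_eq_rotation[where s=0 and t=1, OF p(1) _ _ _ _ _ _ _ _ _ x fk(3)])
    show "A ` polygon p \<subseteq> polygon p" using A p by (simp add: carries_def)
    show "A (side_pt p k 0) = zeta p ^ n * side_pt p k 0" unfolding rot using A(3) by simp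
    show "A (side_pt p k 1) = zeta p ^ n * side_pt p k 1" unfolding rot using u \<open>u = 1\<close> by simp
  qed (use iso in auto)
  then have c: "carries D D \<phi> f g (\<lambda>x. zeta p ^ n * x)" using carries_cong[OF A(1)] p by simp
  then have "\<phi> \<in> Rot_set D" using isometry_spread[OF con \<phi>(1)] p by blast
  then obtain \<alpha> where \<alpha>: "dart_auto D \<alpha>" "induces D D \<alpha> \<phi>" using Rot_set_iff[OF con] by blast
  have "\<alpha> s = (g, (snd s + n mod p) mod p)"
    using induces_dart_unique[OF S S _ \<alpha>(2) s gl(2), of "n mod p"] \<alpha>(1) c p fk
    by (simp add: dart_auto_def carries_def zeta_power_mod)
  also have "\<dots> = t" using fk gl by (simp add: n_def mod_simps)
  finally show thesis using \<alpha>(1) that by blast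
qed

section \<open>Covering maps\<close>

lemma covering_map_evenly_covered:
  assumes "covering_map X Y h" "y \<in> topspace Y"
  obtains V \<U> where "y \<in> V" "openin Y V" "\<Union>\<U> = {x \<in> topspace X. h x \<in> V}" "\<forall>U \<in> \<U>. openin X U"
    "pairwise disjnt \<U>" "\<forall>U \<in> \<U>. homeomorphic_map (subtopology X U) (subtopology Y V) h"
proof -
  from assms(1) have "\<forall>y \<in> topspace Y. \<exists>V. y \<in> V \<and> openin Y V \<and>
      (\<exists>\<U>. \<Union>\<U> = {x \<in> topspace X. h x \<in> V} \<and> (\<forall>U \<in> \<U>. openin X U) \<and> pairwise disjnt \<U> \<and>
           (\<forall>U \<in> \<U>. homeomorphic_map (subtopology X U) (subtopology Y V) h))"
    unfolding covering_map_def by (elim conjE)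
  from bspec[OF this assms(2)] show thesis
    by (elim exE conjE) (rule that)
qed

text \<open>Agreement of two lifts is locally constant: near a point the lifts stay in fixed sheets,
  and they agree throughout if the sheets coincide and nowhere if the sheets are disjoint. So the
  set of agreement is open and closed.\<close>

lemma covering_map_lift_unique:
  assumes h: "covering_map X Y h" and Z: "connected_space Z"
    and f: "continuous_map Z X f" and g: "continuous_map Z X g"
    and eq: "\<And>z. z \<in> topspace Z \<Longrightarrow> h (f z) = h (g z)"
    and z0: "z0 \<in> topspace Z" "f z0 = g z0" and z: "z \<in> topspace Z"
  shows "f z = g z"
proof -
  have loc: "\<exists>W. openin Z W \<and> z \<in> W \<and> (\<forall>w \<in> W. f w = g w \<longleftrightarrow> f z = g z)" if z: "z \<in> topspace Z" for z
  proof -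
    have fz: "f z \<in> topspace X" "g z \<in> topspace X" "h (f z) \<in> topspace Y"
      using z f g h by (auto simp: continuous_map_def covering_map_def)
    obtain V \<U> where V: "h (f z) \<in> V" "openin Y V" and \<U>: "\<Union>\<U> = {x \<in> topspace X. h x \<in> V}"
        "\<forall>U \<in> \<U>. openin X U" "pairwise disjnt \<U>"
      and hom': "\<forall>U \<in> \<U>. homeomorphic_map (subtopology X U) (subtopology Y V) h"
      by (rule covering_map_evenly_covered[OF h fz(3)])
    note hom = hom'[rule_format] and op = \<U>(2)[rule_format]
    have "f z \<in> \<Union>\<U>" "g z \<in> \<Union>\<U>" unfolding \<U>(1) using fz V eq[OF z] by auto
    then obtain A B where A: "A \<in> \<U>" "f z \<in> A" and B: "B \<in> \<U>" "g z \<in> B" by auto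
    have inj: "inj_on h U" if "U \<in> \<U>" for U
      using homeomorphic_imp_injective_map[OF hom[OF that]] openin_subset[OF op[OF that]]
      by (simp add: Int_absorb1)
    define W where "W = {w \<in> topspace Z. f w \<in> A} \<inter> {w \<in> topspace Z. g w \<in> B}"
    have "openin Z W" unfolding W_def
      using A B op f g by (intro openin_Int) (auto simp: continuous_map_def)
    moreover have "z \<in> W" using A B z by (simp add: W_def)
    moreover have "f w = g w \<longleftrightarrow> f z = g z" if w: "w \<in> W" for w
    proof (cases "A = B")
      case True
      have "f w = g w" "f z = g z"
        using w z A B eq True inj_onD[OF inj[OF A(1)]] by (auto simp: W_def)
      then show ?thesis by simp
    next
      case False
      then have "A \<inter> B = {}" using \<U>(3) A B by (auto simp: pairwise_def disjnt_def)
      then have "f w \<noteq> g w" "f z \<noteq> g z" using w A B by (auto simp: W_def)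
      then show ?thesis by simp
    qed
    ultimately show ?thesis by blast
  qed
  let ?E = "{z \<in> topspace Z. f z = g z}"
  have op: "openin Z {z \<in> topspace Z. (f z = g z) = b}" for b
  proof (subst openin_subopen, intro ballI)
    fix z assume z: "z \<in> {z \<in> topspace Z. (f z = g z) = b}"
    then have zZ: "z \<in> topspace Z" and b: "(f z = g z) = b" by simp_all
    from loc[OF zZ] obtain W where W: "openin Z W" "z \<in> W" "\<forall>w \<in> W. f w = g w \<longleftrightarrow> f z = g z" by blast
    moreover have "W \<subseteq> {z \<in> topspace Z. (f z = g z) = b}"
    proof
      fix w assume "w \<in> W"
      with W(3) b openin_subset[OF W(1)] show "w \<in> {z \<in> topspace Z. (f z = g z) = b}" by blast
    qed
    ultimately show "\<exists>T. openin Z T \<and> z \<in> T \<and> T \<subseteq> {z \<in> topspace Z. (f z = g z) = b}" by blast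
  qed
  have "openin Z ?E" using op[of True] by simp
  moreover have "topspace Z - ?E = {z \<in> topspace Z. (f z = g z) = False}" by auto
  then have "openin Z (topspace Z - ?E)" using op[of False] by simp
  then have "closedin Z ?E" by (auto simp: closedin_def)
  ultimately have "?E = {} \<or> ?E = topspace Z"
    using Z unfolding connected_space_clopen_in by blast
  then show ?thesis using z0 z by blast
qed

lemma covering_map_path_lift:
  assumes h: "covering_map X Y h" and \<gamma>: "pathin Y \<gamma>" and x: "x \<in> topspace X" "h x = \<gamma> 0"
  obtains c where "pathin X c" "\<And>t. t \<in> {0..1} \<Longrightarrow> h (c t) = \<gamma> t" "c 0 = x"
proof -
  \<comment> \<open>Liftability is stated for every starting point over \<open>\<gamma> a\<close>,
    so that a second piece can continue from wherever the first one ends. The guard confines the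
    claim to subintervals of the unit interval, since the bisection principle quantifies over all
    reals.\<close>
  define Q where "Q a b \<longleftrightarrow> (0 \<le> a \<and> b \<le> 1 \<longrightarrow> (\<forall>x \<in> topspace X. h x = \<gamma> a \<longrightarrow>
     (\<exists>c. continuous_map (top_of_set {a..b}) X c \<and> c a = x \<and> (\<forall>t \<in> {a..b}. h (c t) = \<gamma> t))))" for a b
  have "(0::real) \<le> 1" by simp
  then have "Q 0 1"
  proof (induction rule: Bolzano)
    case (trans a b c)
    show ?case
      unfolding Q_def
    proof (intro impI ballI)
      fix x assume ac: "0 \<le> a \<and> c \<le> 1" and x: "x \<in> topspace X" "h x = \<gamma> a"
      then obtain c1 where c1: "continuous_map (top_of_set {a..b}) X c1" "c1 a = x" "\<forall>t \<in> {a..b}. h (c1 t) = \<gamma> t"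
        using trans unfolding Q_def by (metis order_trans)
      have "c1 b \<in> topspace X" "h (c1 b) = \<gamma> b" using c1 trans by (auto simp: continuous_map_def)
      then obtain c2 where c2: "continuous_map (top_of_set {b..c}) X c2" "c2 b = c1 b" "\<forall>t \<in> {b..c}. h (c2 t) = \<gamma> t"
        using trans ac unfolding Q_def by (metis order_trans)
      have "continuous_map (top_of_set {a..c}) X (\<lambda>t. if t \<le> b then c1 t else c2 t)"
      proof (rule continuous_map_cases_le)
        have "{t \<in> {a..c}. t \<le> b} = {a..b}" "{t \<in> {a..c}. b \<le> t} = {b..c}" using trans by auto
        then show "continuous_map (subtopology (top_of_set {a..c}) {t \<in> topspace (top_of_set {a..c}). t \<le> b}) X c1"
          "continuous_map (subtopology (top_of_set {a..c}) {t \<in> topspace (top_of_set {a..c}). b \<le> t}) X c2"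
          using c1 c2 trans by (simp_all add: subtopology_subtopology Int_absorb1)
      qed (use c2 in auto)
      then show "\<exists>c'. continuous_map (top_of_set {a..c}) X c' \<and> c' a = x \<and> (\<forall>t \<in> {a..c}. h (c' t) = \<gamma> t)"
        using c1 c2 trans by (intro exI[of _ "\<lambda>t. if t \<le> b then c1 t else c2 t"]) auto
    qed
  next
    case (local u)
    have u: "u \<in> {0..1}" using local by auto
    have "\<gamma> u \<in> topspace Y" using \<gamma> u by (auto simp: pathin_def continuous_map_def)
    then obtain V \<U> where V: "\<gamma> u \<in> V" "openin Y V" and \<U>: "\<Union>\<U> = {x \<in> topspace X. h x \<in> V}"
        "\<forall>U \<in> \<U>. openin X U" "pairwise disjnt \<U>"
      and hom': "\<forall>U \<in> \<U>. homeomorphic_map (subtopology X U) (subtopology Y V) h"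
      by (rule covering_map_evenly_covered[OF h])
    note hom = hom'[rule_format] and op = \<U>(2)[rule_format]
    have "openin (top_of_set {0..1}) {t \<in> {0..1}. \<gamma> t \<in> V}"
      using \<gamma> V by (auto simp: pathin_def continuous_map_def)
    then obtain d where d: "d > 0" "\<And>t. t \<in> {0..1} \<Longrightarrow> dist t u < d \<Longrightarrow> \<gamma> t \<in> V"
      using u V unfolding openin_euclidean_subtopology_iff by (metis (mono_tags, lifting) mem_Collect_eq)
    have "Q a b" if ab: "a \<le> u" "u \<le> b" "b - a < d" for a b
      unfolding Q_def
    proof (intro impI ballI)
      fix x assume r: "0 \<le> a \<and> b \<le> 1" and x: "x \<in> topspace X" "h x = \<gamma> a"
      have \<gamma>V: "\<gamma> t \<in> V" if "t \<in> {a..b}" for t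
        using d(2)[of t] that ab r by (auto simp: dist_real_def)
      then have "x \<in> \<Union>\<U>" unfolding \<U>(1) using x ab by auto
      then obtain U where U: "U \<in> \<U>" "x \<in> U" by blast
      obtain k where k: "homeomorphic_maps (subtopology X U) (subtopology Y V) h k"
        using hom[OF U(1)] by (auto simp: homeomorphic_map_maps)
      have VY: "V \<subseteq> topspace Y" and UX: "U \<subseteq> topspace X" using openin_subset[OF V(2)] openin_subset[OF op[OF U(1)]] .
      have "continuous_map (top_of_set {a..b}) (subtopology Y V) \<gamma>"
        unfolding continuous_map_in_subtopology
      proof
        show "continuous_map (top_of_set {a..b}) Y \<gamma>"
          using \<gamma> r continuous_map_from_subtopology_mono[of euclideanreal "{0..1}" Y \<gamma> "{a..b}"]
          by (auto simp: pathin_def)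
      qed (use \<gamma>V in auto)
      moreover have "continuous_map (subtopology Y V) X k"
        using k by (auto simp: homeomorphic_maps_def continuous_map_in_subtopology)
      ultimately have "continuous_map (top_of_set {a..b}) X (k \<circ> \<gamma>)" by (rule continuous_map_compose)
      moreover have "k (h x) = x"
        using k U UX by (auto simp: homeomorphic_maps_def)
      then have "(k \<circ> \<gamma>) a = x" using x(2) by simp
      moreover have "h ((k \<circ> \<gamma>) t) = \<gamma> t" if "t \<in> {a..b}" for t
        using k \<gamma>V[OF that] VY by (auto simp: homeomorphic_maps_def)
      ultimately show "\<exists>c. continuous_map (top_of_set {a..b}) X c \<and> c a = x \<and> (\<forall>t \<in> {a..b}. h (c t) = \<gamma> t)"
        by blast
    qed
    with d(1) show ?case by blast
  qed
  with x that show thesis unfolding Q_def pathin_def by fastforce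
qed

lemma connected_space_01: "connected_space (top_of_set {0..1::real})"
  by (simp add: connected_space_subtopology convex_connected)

lemma lift_end_eq:
  assumes h: "covering_map (punctured E) Y h" and c: "pathin (punctured E) c" "\<And>t. t \<in> {0..1} \<Longrightarrow> h (c t) = \<gamma> t"
  shows "lift_end E h \<gamma> (c 0) = c 1"
  unfolding lift_end_def
proof (rule the_equality)
  show "\<exists>c'. pathin (punctured E) c' \<and> (\<forall>t\<in>{0..1}. h (c' t) = \<gamma> t) \<and> c' 0 = c 0 \<and> c' 1 = c 1"
    using c by blast
  fix z assume "\<exists>c'. pathin (punctured E) c' \<and> (\<forall>t\<in>{0..1}. h (c' t) = \<gamma> t) \<and> c' 0 = c 0 \<and> c' 1 = z"
  then obtain c' where c': "pathin (punctured E) c'" "\<forall>t\<in>{0..1}. h (c' t) = \<gamma> t" "c' 0 = c 0" "c' 1 = z" by blast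
  have "c' 1 = c 1"
    by (rule covering_map_lift_unique[OF h connected_space_01, of c' c 0 1])
      (use c c' in \<open>auto simp: pathin_def\<close>)
  with c' show "z = c 1" by simp
qed

section \<open>Evenly covered sets\<close>

definition sides :: "nat \<Rightarrow> complex set" where
  "sides p = (\<Union>k<p. side p k)"

definition open_face :: "'f polysurf \<Rightarrow> 'f \<Rightarrow> ('f \<times> complex) set" where
  "open_face S f = {f} \<times> (poly_of S - sides (gon S))"

text \<open>The triangle over a side with apex at the centre, without its two other edges but with
  the inner points of the side. Together with the triangle across the side it forms an open
  neighbourhood of the open edge, even if both lie in the same face.\<close>

definition half_kite :: "'f polysurf \<Rightarrow> 'f \<times> nat \<Rightarrow> ('f \<times> complex) set" where
  "half_kite S s = {fst s} \<times> (poly_of S \<inter> sector (gon S) (snd s))"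

definition kite :: "'f polysurf \<Rightarrow> 'f \<times> nat \<Rightarrow> ('f \<times> complex) set" where
  "kite S s = half_kite S s \<union> half_kite S (glue S s)"

definition open_cells :: "'f polysurf \<Rightarrow> ('f \<times> complex) set \<Rightarrow> bool" where
  "open_cells S W \<longleftrightarrow> saturated S W \<and> (\<forall>f \<in> faces S. openin (top_of_set (poly_of S)) {x. (f, x) \<in> W}) \<and>
     (\<forall>q \<in> W. snd q \<notin> corners (gon S))"

lemma closed_sides: "closed (sides p)"
  unfolding sides_def side_def by auto

lemma corners_subset_sides: "p > 0 \<Longrightarrow> corners p \<subseteq> sides p"
  unfolding corners_def sides_def side_def by auto

lemma in_sides_iff: "x \<in> sides p \<longleftrightarrow> (\<exists>k s. k < p \<and> 0 \<le> s \<and> s \<le> 1 \<and> x = side_pt p k s)"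
  unfolding sides_def side_eq UN_iff image_iff lessThan_iff Bex_def atLeastAtMost_iff by blast

lemma rot_of_sides:
  assumes "dart_map S T \<alpha>" "gluing S" "f \<in> faces S"
  shows "rot_of (gon S) \<alpha> f * x \<in> sides (gon S) \<longleftrightarrow> x \<in> sides (gon S)"
proof
  assume "x \<in> sides (gon S)"
  then show "rot_of (gon S) \<alpha> f * x \<in> sides (gon S)"
    using dart_map_rot(2,4)[OF assms] unfolding in_sides_iff by metis
next
  assume "rot_of (gon S) \<alpha> f * x \<in> sides (gon S)"
  then obtain m s where m: "m < gon S" "0 \<le> s" "s \<le> 1" "rot_of (gon S) \<alpha> f * x = side_pt (gon S) m s"
    by (auto simp: in_sides_iff)
  obtain k where k: "k < gon S" "\<alpha> (f, k) = (face_map \<alpha> f, m)" using dart_map_index[OF assms m(1)] .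
  then have "rot_of (gon S) \<alpha> f * x = rot_of (gon S) \<alpha> f * side_pt (gon S) k s"
    using dart_map_rot(4)[OF assms k(1), of s] m by simp
  then have "x = side_pt (gon S) k s" by simp
  then show "x \<in> sides (gon S)" using k m by (auto simp: in_sides_iff)
qed

lemma open_cells_open_face:
  assumes S: "gluing S" and f: "f \<in> faces S"
  shows "open_cells S (open_face S f)"
  unfolding open_cells_def
proof (intro conjI ballI)
  show "saturated S (open_face S f)"
    unfolding saturated_def
  proof (intro conjI allI impI)
    show "open_face S f \<subseteq> cells S" using f by (auto simp: open_face_def cells_def)
    fix q r assume q: "q \<in> open_face S f" "(q, r) \<in> glue_rel S"
    then obtain f' k s where "k < gon S" "0 \<le> s" "s \<le> 1" "q = (f', side_pt (gon S) k s)"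
      using glue_relE[OF S] by metis
    then have "snd q \<in> sides (gon S)" by (auto simp: in_sides_iff)
    with q(1) have False by (auto simp: open_face_def)
    then show "r \<in> open_face S f" ..
  qed
  show "snd q \<notin> corners (gon S)" if "q \<in> open_face S f" for q
    using that corners_subset_sides[of "gon S"] gluing_gon[OF S] by (auto simp: open_face_def)
  fix g assume "g \<in> faces S"
  have "{x. (g, x) \<in> open_face S f} = (if g = f then poly_of S \<inter> - sides (gon S) else {})"
    by (auto simp: open_face_def)
  then show "openin (top_of_set (poly_of S)) {x. (g, x) \<in> open_face S f}"
    using closed_sides[of "gon S"] by (auto intro!: openin_open_Int)
qed

lemma half_kite_glue:
  assumes S: "gluing S" and s: "s \<in> darts S" and q: "q \<in> half_kite S s" "(q, r) \<in> glue_rel S"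
  shows "r \<in> half_kite S (glue S s)"
proof -
  obtain f k where fk: "s = (f, k)" "k < gon S" using s by (auto simp: darts_def)
  obtain f' k' g l u where 1: "f' \<in> faces S" "k' < gon S" "glue S (f', k') = (g, l)" and u: "0 \<le> u" "u \<le> 1"
    and e: "q = (f', side_pt (gon S) k' u)" "r = (g, side_pt (gon S) l (1 - u))"
    using glue_relE[OF S q(2)] .
  have sec: "side_pt (gon S) k' u \<in> sector (gon S) k" "f' = f" using q(1) e fk by (auto simp: half_kite_def)
  then have "k' = k" using side_pt_notin_sector 1 fk u by blast
  have "u \<noteq> 0" "u \<noteq> 1" using sec vert_notin_sector[OF fk(2)] by auto
  then have "side_pt (gon S) l (1 - u) \<in> sector (gon S) l" "side_pt (gon S) l (1 - u) \<in> poly_of S"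
    using u gluing_gon[OF S] by (auto intro!: side_pt_in_sector side_pt_in_polygon)
  then show ?thesis using e 1 fk \<open>k' = k\<close> \<open>f' = f\<close> by (simp add: half_kite_def)
qed

lemma half_kite_unique:
  assumes "gluing S" "s \<in> darts S" "t \<in> darts S" "q \<in> half_kite S s" "q \<in> half_kite S t"
  shows "s = t"
proof -
  have "fst s = fst t" "snd q \<in> sector (gon S) (snd s) \<inter> sector (gon S) (snd t)"
    using assms(4,5) by (auto simp: half_kite_def)
  moreover from this have "snd s = snd t"
    using disjoint_sectors[OF gluing_gon[OF assms(1)], of "snd s" "snd t"] assms(2,3)
    unfolding darts_def mem_Times_iff lessThan_iff by blast
  ultimately show ?thesis by (simp add: prod_eq_iff)
qed

lemma open_cells_kite:
  assumes S: "gluing S" and s: "s \<in> darts S"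
  shows "open_cells S (kite S s)"
  unfolding open_cells_def
proof (intro conjI ballI)
  have gs: "glue S s \<in> darts S" "glue S (glue S s) = s" using S s by (auto simp: gluing_def)
  show "saturated S (kite S s)"
    unfolding saturated_def
  proof (intro conjI allI impI)
    show "kite S s \<subseteq> cells S" using s gs by (auto simp: kite_def half_kite_def cells_def darts_def)
    fix q r assume q: "q \<in> kite S s" "(q, r) \<in> glue_rel S"
    then show "r \<in> kite S s"
      using half_kite_glue[OF S s _ q(2)] half_kite_glue[OF S gs(1) _ q(2)] gs(2) by (auto simp: kite_def)
  qed
  show "snd q \<notin> corners (gon S)" if "q \<in> kite S s" for q
    using that s gs vert_notin_sector[of "snd s" "gon S"] vert_notin_sector[of "snd (glue S s)" "gon S"]
    by (auto simp: kite_def half_kite_def corners_def darts_def)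
  fix g assume "g \<in> faces S"
  have "openin (top_of_set (poly_of S)) {x. (g, x) \<in> half_kite S t}" for t
  proof -
    have "{x. (g, x) \<in> half_kite S t} = (if g = fst t then poly_of S \<inter> sector (gon S) (snd t) else {})"
      by (auto simp: half_kite_def)
    then show ?thesis using open_sector by (auto intro!: openin_open_Int)
  qed
  moreover have "{x. (g, x) \<in> kite S s} = {x. (g, x) \<in> half_kite S s} \<union> {x. (g, x) \<in> half_kite S (glue S s)}"
    by (auto simp: kite_def)
  ultimately show "openin (top_of_set (poly_of S)) {x. (g, x) \<in> kite S s}"
    by (simp only: openin_Un)
qed

lemma topspace_punctured: "gluing S \<Longrightarrow> topspace (punctured S) = points S - vertices S"
  by (auto simp: punctured_def topspace_surf_top)

lemma pts_of_open_cells: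
  assumes S: "gluing S" and W: "open_cells S W"
  shows "openin (surf_top S) (pts_of S W)" "openin (punctured S) (pts_of S W)"
    "pts_of S W \<subseteq> points S - vertices S"
    "subtopology (punctured S) (pts_of S W) = subtopology (surf_top S) (pts_of S W)"
proof -
  show op: "openin (surf_top S) (pts_of S W)"
    using W openin_pts_of[OF S] by (auto simp: open_cells_def)
  show sub: "pts_of S W \<subseteq> points S - vertices S"
  proof
    fix y assume "y \<in> pts_of S W"
    then obtain f x where fx: "(f, x) \<in> W" "y = pt S f x" by (auto simp: pts_of_def)
    then have "f \<in> faces S" "x \<in> poly_of S" "x \<notin> corners (gon S)"
      using W by (auto simp: open_cells_def saturated_def cells_def)
    then show "y \<in> points S - vertices S"
      using pt_in_vertices_iff[OF S, of f x] pt_in_points[of f S x] fx by simp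
  qed
  show "openin (punctured S) (pts_of S W)"
    unfolding punctured_def openin_subtopology using op sub by blast
  show "subtopology (punctured S) (pts_of S W) = subtopology (surf_top S) (pts_of S W)"
    unfolding punctured_def subtopology_subtopology using sub by (simp add: Int_absorb1)
qed

text \<open>Injectivity on representatives gives injectivity on points: if two points of the sheet
  have the same image, the gluing chain between the image representatives lifts, stays in
  \<open>W\<close> by saturation, and ends at the second representative because the action is
  injective on \<open>W\<close>.\<close>

lemma induces_sheet:
  assumes i: "induces S T \<alpha> \<phi>" and \<alpha>: "dart_map S T \<alpha>" and S: "gluing S" and T: "gluing T"
    and W: "open_cells S W" and inj: "inj_on (act (gon S) \<alpha>) W" and W': "open_cells T (act (gon S) \<alpha> ` W)"
  shows "homeomorphic_map (subtopology (punctured S) (pts_of S W))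
      (subtopology (punctured T) (pts_of T (act (gon S) \<alpha> ` W))) \<phi>"
  unfolding pts_of_open_cells(4)[OF S W] pts_of_open_cells(4)[OF T W']
proof (rule bijective_open_imp_homeomorphic_map)
  let ?a = "act (gon S) \<alpha>" and ?U = "pts_of S W" and ?V = "pts_of T (act (gon S) \<alpha> ` W)"
  note oU = pts_of_open_cells(1)[OF S W] and oV = pts_of_open_cells(1)[OF T W']
  have Wc: "W \<subseteq> cells S" and sat: "saturated S W" using W by (auto simp: open_cells_def saturated_def)
  have img: "\<phi> ` ?U = ?V"
    unfolding pts_of_def image_image
    by (rule image_cong) (use Wc inducesD[OF i] in \<open>auto simp: act_def cells_def\<close>)
  have tU: "topspace (subtopology (surf_top S) ?U) = ?U" and tV: "topspace (subtopology (surf_top T) ?V) = ?V"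
    using openin_subset[OF oU] openin_subset[OF oV] by (auto simp: Int_absorb1)
  show "\<phi> ` topspace (subtopology (surf_top S) ?U) = topspace (subtopology (surf_top T) ?V)"
    unfolding tU tV by (rule img)
  show "continuous_map (subtopology (surf_top S) ?U) (subtopology (surf_top T) ?V) \<phi>"
    using img tU induces_continuous[OF i \<alpha> S T]
    by (auto simp: continuous_map_in_subtopology continuous_map_from_subtopology)
  show "open_map (subtopology (surf_top S) ?U) (subtopology (surf_top T) ?V) \<phi>"
    using induces_open[OF i \<alpha> S T] img
    unfolding open_map_def openin_open_subtopology[OF oU] openin_open_subtopology[OF oV] by blast
  show "inj_on \<phi> (topspace (subtopology (surf_top S) ?U))"
    unfolding tU
  proof (rule inj_onI)
    fix y z assume yz: "y \<in> ?U" "z \<in> ?U" "\<phi> y = \<phi> z"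
    then obtain f x g w where f: "(f, x) \<in> W" "y = pt S f x" and g: "(g, w) \<in> W" "z = pt S g w"
      by (auto simp: pts_of_def)
    have fS: "f \<in> faces S" "x \<in> poly_of S" and gS: "g \<in> faces S" "w \<in> poly_of S"
      using f g Wc by (auto simp: cells_def)
    have "?a (f, x) \<in> cells T" "?a (g, w) \<in> cells T" using act_in_cells[OF \<alpha> S] f g Wc by blast+
    then have "(?a (f, x), ?a (g, w)) \<in> (glue_rel T)\<^sup>*"
      using yz(3) inducesD[OF i fS] inducesD[OF i gS] pt_eq_iff[OF T] f g by (auto simp: act_def cells_def)
    then obtain r where r: "((f, x), r) \<in> (glue_rel S)\<^sup>*" "?a r = ?a (g, w)"
      using act_lift_rtrancl[OF \<alpha> S T] f(1) Wc by blast
    have "r \<in> W"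
      using r(1) f(1) sat by (induction rule: rtrancl_induct) (auto simp: saturated_def)
    then have "r = (g, w)" using inj_onD[OF inj r(2)] g(1) by simp
    then show "y = z" using r(1) f g fS gS pt_eq_iff[OF S] by simp
  qed
qed

text \<open>Reduces even covering to statements about representatives only. It is applied to open
  faces, for points inside a face, and to kites, for points on an edge.\<close>

lemma induces_evenly_covered:
  assumes i: "induces S T \<alpha> \<phi>" and \<alpha>: "dart_map S T \<alpha>" and S: "gluing S" and T: "gluing T"
    and W: "\<And>j. j \<in> I \<Longrightarrow> open_cells S (W j)" and inj: "\<And>j. j \<in> I \<Longrightarrow> inj_on (act (gon S) \<alpha>) (W j)"
    and W': "open_cells T W'" "\<And>j. j \<in> I \<Longrightarrow> act (gon S) \<alpha> ` W j = W'"
    and cover: "\<And>q. q \<in> cells S \<Longrightarrow> act (gon S) \<alpha> q \<in> W' \<Longrightarrow> \<exists>j \<in> I. q \<in> W j"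
    and disj: "\<And>j j'. j \<in> I \<Longrightarrow> j' \<in> I \<Longrightarrow> j \<noteq> j' \<Longrightarrow> W j \<inter> W j' = {}"
  shows "\<exists>\<U>. \<Union>\<U> = {y \<in> topspace (punctured S). \<phi> y \<in> pts_of T W'} \<and> (\<forall>U \<in> \<U>. openin (punctured S) U) \<and>
     pairwise disjnt \<U> \<and>
     (\<forall>U \<in> \<U>. homeomorphic_map (subtopology (punctured S) U) (subtopology (punctured T) (pts_of T W')) \<phi>)"
proof (intro exI[of _ "(\<lambda>j. pts_of S (W j)) ` I"] conjI)
  have sat: "saturated S (W j)" if "j \<in> I" for j using W[OF that] by (simp add: open_cells_def)
  have satT: "saturated T W'" using W' by (simp add: open_cells_def)
  show "\<Union>((\<lambda>j. pts_of S (W j)) ` I) = {y \<in> topspace (punctured S). \<phi> y \<in> pts_of T W'}"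
  proof (intro subset_antisym subsetI)
    fix y assume "y \<in> \<Union>((\<lambda>j. pts_of S (W j)) ` I)"
    then obtain j f x where j: "j \<in> I" "(f, x) \<in> W j" "y = pt S f x" by (auto simp: pts_of_def)
    then have y: "y \<in> pts_of S (W j)" by (force simp: pts_of_def)
    have f: "f \<in> faces S" "x \<in> poly_of S" using sat[OF j(1)] j(2) by (auto simp: saturated_def cells_def)
    have "act (gon S) \<alpha> (f, x) \<in> W'" using W'(2)[OF j(1)] j(2) by blast
    then have "\<phi> y \<in> pts_of T W'" using inducesD[OF i f] j(3) by (force simp: act_def pts_of_def)
    then show "y \<in> {y \<in> topspace (punctured S). \<phi> y \<in> pts_of T W'}"
      using pts_of_open_cells(3)[OF S W[OF j(1)]] y topspace_punctured[OF S] by auto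
  next
    fix y assume y: "y \<in> {y \<in> topspace (punctured S). \<phi> y \<in> pts_of T W'}"
    then obtain f x where f: "f \<in> faces S" "x \<in> poly_of S" "y = pt S f x"
      by (auto simp: topspace_punctured[OF S] points_eq)
    then have c: "(f, x) \<in> cells S" by (simp add: cells_def)
    have "act (gon S) \<alpha> (f, x) \<in> W'"
      using y f inducesD[OF i f(1,2)] pt_in_pts_of_iff[OF T satT] act_in_cells[OF \<alpha> S c]
      by (auto simp: act_def cells_def)
    then obtain j where "j \<in> I" "(f, x) \<in> W j" using cover[OF c] by blast
    then show "y \<in> \<Union>((\<lambda>j. pts_of S (W j)) ` I)" using f by (force simp: pts_of_def)
  qed
  show "\<forall>U \<in> (\<lambda>j. pts_of S (W j)) ` I. openin (punctured S) U"
    using pts_of_open_cells(2)[OF S W] by blast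
  show "pairwise disjnt ((\<lambda>j. pts_of S (W j)) ` I)"
    unfolding pairwise_def
  proof (intro ballI impI)
    fix U V assume "U \<in> (\<lambda>j. pts_of S (W j)) ` I" "V \<in> (\<lambda>j. pts_of S (W j)) ` I" "U \<noteq> V"
    then obtain j j' where j: "j \<in> I" "j' \<in> I" "j \<noteq> j'" "U = pts_of S (W j)" "V = pts_of S (W j')" by blast
    show "disjnt U V"
    proof (rule ccontr)
      assume "\<not> disjnt U V"
      then obtain y where y: "y \<in> U" "y \<in> V" by (auto simp: disjnt_def)
      then obtain f x where f: "(f, x) \<in> W j" "y = pt S f x" using j by (auto simp: pts_of_def)
      then have "f \<in> faces S" "x \<in> poly_of S" using sat[OF j(1)] by (auto simp: saturated_def cells_def)
      then have "(f, x) \<in> W j'" using y f j pt_in_pts_of_iff[OF S sat[OF j(2)]] by simp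
      with f disj[OF j(1-3)] show False by blast
    qed
  qed
  show "\<forall>U \<in> (\<lambda>j. pts_of S (W j)) ` I.
      homeomorphic_map (subtopology (punctured S) U) (subtopology (punctured T) (pts_of T W')) \<phi>"
    using induces_sheet[OF i \<alpha> S T W inj] W' by force
qed

lemma act_half_kite:
  assumes \<alpha>: "dart_map S T \<alpha>" and S: "gluing S" and s: "s \<in> darts S"
  shows "act (gon S) \<alpha> ` half_kite S s = half_kite T (\<alpha> s)"
proof -
  obtain f k where fk: "s = (f, k)" "f \<in> faces S" "k < gon S" using s by (auto simp: darts_def)
  note p = gluing_gon[OF S] and pT = dart_mapD(1)[OF \<alpha>]
  have F: "fst (\<alpha> (f, k)) = face_map \<alpha> f" using dart_map_rot(1)[OF \<alpha> S fk(2,3)] .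
  note sec = dart_map_sector[OF \<alpha> S fk(2,3)]
  show ?thesis
  proof
    show "act (gon S) \<alpha> ` half_kite S s \<subseteq> half_kite T (\<alpha> s)"
      using p pT F sec by (auto simp: half_kite_def act_def fk(1) rot_of_in_polygon)
    show "half_kite T (\<alpha> s) \<subseteq> act (gon S) \<alpha> ` half_kite S s"
    proof
      fix r assume r: "r \<in> half_kite T (\<alpha> s)"
      define x where "x = snd r / rot_of (gon S) \<alpha> f"
      have rx: "r = act (gon S) \<alpha> (f, x)"
        using r F by (auto simp: half_kite_def act_def fk(1) x_def)
      then have "rot_of (gon S) \<alpha> f * x \<in> poly_of S" "rot_of (gon S) \<alpha> f * x \<in> sector (gon S) (snd (\<alpha> (f, k)))"
        using r pT by (auto simp: half_kite_def act_def fk(1))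
      then have "(f, x) \<in> half_kite S s"
        using sec p by (simp add: half_kite_def fk(1) rot_of_in_polygon)
      then show "r \<in> act (gon S) \<alpha> ` half_kite S s" using rx by blast
    qed
  qed
qed

lemma act_half_kite_lift:
  assumes \<alpha>: "dart_map S T \<alpha>" and S: "gluing S" and q: "q \<in> cells S"
    and t: "t \<in> darts T" "act (gon S) \<alpha> q \<in> half_kite T t"
  obtains s where "s \<in> darts S" "\<alpha> s = t" "q \<in> half_kite S s"
proof -
  obtain f x where fx: "q = (f, x)" "f \<in> faces S" "x \<in> poly_of S" using q by (auto simp: cells_def)
  have t': "fst t = face_map \<alpha> f" "snd t < gon S" "rot_of (gon S) \<alpha> f * x \<in> sector (gon S) (snd t)"
    using t fx dart_mapD(1)[OF \<alpha>] by (auto simp: half_kite_def act_def darts_def)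
  obtain k where k: "k < gon S" "\<alpha> (f, k) = (face_map \<alpha> f, snd t)"
    using dart_map_index[OF \<alpha> S fx(2) t'(2)] .
  have "x \<in> sector (gon S) k" using dart_map_sector[OF \<alpha> S fx(2) k(1), of x] k(2) t'(3) by simp
  then show thesis
    using that[of "(f, k)"] k fx t'(1) by (simp add: darts_def half_kite_def prod_eq_iff)
qed

text \<open>The two halves have different images because their darts do: the image of the partner is
  the partner of the image, and no dart is its own partner. On one half the action is a rotation of
  a chart.\<close>

lemma act_inj_on_kite:
  assumes \<alpha>: "dart_map S T \<alpha>" and S: "gluing S" and T: "gluing T" and s: "s \<in> darts S"
  shows "inj_on (act (gon S) \<alpha>) (kite S s)"
proof (rule inj_onI)
  fix q r assume q: "q \<in> kite S s" and r: "r \<in> kite S s" and e: "act (gon S) \<alpha> q = act (gon S) \<alpha> r"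
  have gs: "glue S s \<in> darts S" using S s by (auto simp: gluing_def)
  have ne: "\<alpha> (glue S s) \<noteq> \<alpha> s" "\<alpha> s \<in> darts T" "\<alpha> (glue S s) \<in> darts T"
    using dart_mapD[OF \<alpha>] s gs T by (auto simp: gluing_def)
  obtain u v where u: "u \<in> {s, glue S s}" "q \<in> half_kite S u" and v: "v \<in> {s, glue S s}" "r \<in> half_kite S v"
    using q r unfolding kite_def by blast
  have d: "u \<in> darts S" "v \<in> darts S" using u(1) v(1) s gs by auto
  have "act (gon S) \<alpha> q \<in> half_kite T (\<alpha> u)" "act (gon S) \<alpha> r \<in> half_kite T (\<alpha> v)"
    using act_half_kite[OF \<alpha> S d(1)] act_half_kite[OF \<alpha> S d(2)] u(2) v(2) by blast+
  then have "\<alpha> u = \<alpha> v"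
    using half_kite_unique[OF T dart_mapD(2)[OF \<alpha> d(1)] dart_mapD(2)[OF \<alpha> d(2)]] e by simp
  then have "u = v" using u(1) v(1) ne(1) by auto
  then have "fst q = fst r" using u v by (auto simp: half_kite_def)
  with e show "q = r" by (simp add: act_def prod_eq_iff)
qed

lemma act_open_face:
  assumes \<alpha>: "dart_map S T \<alpha>" and S: "gluing S" and f: "f \<in> faces S"
  shows "act (gon S) \<alpha> ` open_face S f = open_face T (face_map \<alpha> f)"
proof
  note p = gluing_gon[OF S] and pT = dart_mapD(1)[OF \<alpha>] and rs = rot_of_sides[OF \<alpha> S f]
  show "act (gon S) \<alpha> ` open_face S f \<subseteq> open_face T (face_map \<alpha> f)"
  proof
    fix r assume "r \<in> act (gon S) \<alpha> ` open_face S f"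
    then obtain x where x: "r = act (gon S) \<alpha> (f, x)" "x \<in> poly_of S" "x \<notin> sides (gon S)"
      unfolding open_face_def by blast
    have "rot_of (gon S) \<alpha> f * x \<in> poly_of S" using x(2) p by (simp add: rot_of_in_polygon)
    then show "r \<in> open_face T (face_map \<alpha> f)"
      using x rs[of x] pT by (simp add: open_face_def act_def)
  qed
  show "open_face T (face_map \<alpha> f) \<subseteq> act (gon S) \<alpha> ` open_face S f"
  proof
    fix r assume r: "r \<in> open_face T (face_map \<alpha> f)"
    define x where "x = snd r / rot_of (gon S) \<alpha> f"
    have rx: "r = act (gon S) \<alpha> (f, x)" using r by (auto simp: open_face_def act_def x_def)
    then have "rot_of (gon S) \<alpha> f * x \<in> poly_of S" "rot_of (gon S) \<alpha> f * x \<notin> sides (gon S)"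
      using r pT by (auto simp: open_face_def act_def)
    then have "(f, x) \<in> open_face S f" using rs p by (simp add: open_face_def rot_of_in_polygon)
    then show "r \<in> act (gon S) \<alpha> ` open_face S f" using rx by blast
  qed
qed

lemma edge_in_kite:
  assumes S: "gluing S" and f: "f \<in> faces S" "x \<in> poly_of S" "x \<in> sides (gon S)" "x \<notin> corners (gon S)"
  obtains k s where "k < gon S" "0 < s" "s < 1" "x = side_pt (gon S) k s" "(f, x) \<in> half_kite S (f, k)"
proof -
  obtain k s where k: "k < gon S" "0 \<le> s" "s \<le> 1" "x = side_pt (gon S) k s" using f by (auto simp: in_sides_iff)
  then have "s \<noteq> 0" "s \<noteq> 1" using side_pt_corner_iff[OF gluing_gon[OF S] k(1-3)] f(4) by auto
  then have s: "0 < s" "s < 1" using k by auto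
  then have "(f, x) \<in> half_kite S (f, k)"
    using side_pt_in_sector[OF gluing_gon[OF S] s, of k] f(2) k by (simp add: half_kite_def)
  then show thesis using that k s by blast
qed

lemma induces_surj:
  assumes i: "induces S T \<alpha> \<phi>" and \<alpha>: "dart_map S T \<alpha>" and S: "gluing S" and T: "gluing T"
    and ne: "darts S \<noteq> {}" "dart_connected T" and y: "y \<in> points T"
  obtains z where "z \<in> points S" "\<phi> z = y"
proof -
  obtain g w where g: "g \<in> faces T" "w \<in> poly_of T" "y = pt T g w" using y by (auto simp: points_eq)
  have "(g, 0) \<in> darts T" using g gluing_gon[OF T] by (simp add: darts_def)
  then obtain f k where f: "(f, k) \<in> darts S" "\<alpha> (f, k) = (g, 0)"
    using dart_map_surj[OF \<alpha> S T ne] by (metis imageE prod.collapse)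
  then have fS: "f \<in> faces S" "face_map \<alpha> f = g"
    using dart_map_rot(1)[OF \<alpha> S, of f k] by (auto simp: darts_def)
  let ?x = "w / rot_of (gon S) \<alpha> f"
  have x: "?x \<in> poly_of S"
    using g dart_mapD(1)[OF \<alpha>] gluing_gon[OF S] rot_of_in_polygon[of "gon S" \<alpha> f ?x] by simp
  then have "\<phi> (pt S f ?x) = y" using inducesD[OF i fS(1) x] g(3) fS(2) by simp
  then show thesis using that[OF pt_in_points[OF fS(1) x]] by simp
qed

lemma induces_covering:
  assumes i: "induces S T \<alpha> \<phi>" and \<alpha>: "dart_map S T \<alpha>" and S: "gluing S" and T: "gluing T"
    and ne: "darts S \<noteq> {}" "dart_connected T"
  shows "covering_map (punctured S) (punctured T) \<phi>"
  unfolding covering_map_def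
proof (intro conjI ballI)
  have maps: "\<phi> z \<in> points T - vertices T \<longleftrightarrow> z \<in> points S - vertices S" if "z \<in> points S" for z
    using induces_points[OF i \<alpha> S that] induces_vertices[OF i \<alpha> S T that] that by auto
  show "continuous_map (punctured S) (punctured T) \<phi>"
    unfolding punctured_def[of T] continuous_map_in_subtopology
  proof
    show "continuous_map (punctured S) (surf_top T) \<phi>"
      unfolding punctured_def using induces_continuous[OF i \<alpha> S T] by (rule continuous_map_from_subtopology)
    show "\<phi> \<in> topspace (punctured S) \<rightarrow> points T - vertices T"
      using maps by (auto simp: topspace_punctured[OF S])
  qed
  show "\<phi> ` topspace (punctured S) = topspace (punctured T)"
    unfolding topspace_punctured[OF S] topspace_punctured[OF T]
  proof
    show "\<phi> ` (points S - vertices S) \<subseteq> points T - vertices T" using maps by blast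
    show "points T - vertices T \<subseteq> \<phi> ` (points S - vertices S)"
    proof
      fix y assume y: "y \<in> points T - vertices T"
      then obtain z where "z \<in> points S" "\<phi> z = y" using induces_surj[OF i \<alpha> S T ne] by blast
      with y maps show "y \<in> \<phi> ` (points S - vertices S)" by blast
    qed
  qed
next
  fix y assume "y \<in> topspace (punctured T)"
  then have y: "y \<in> points T" "y \<notin> vertices T" by (auto simp: topspace_punctured[OF T])
  then obtain g x where g: "g \<in> faces T" "x \<in> poly_of T" "y = pt T g x" by (auto simp: points_eq)
  have x: "x \<notin> corners (gon T)" using y g pt_in_vertices_iff[OF T] by simp
  show "\<exists>V. y \<in> V \<and> openin (punctured T) V \<and> (\<exists>\<U>. \<Union>\<U> = {x \<in> topspace (punctured S). \<phi> x \<in> V} \<and>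
      (\<forall>U \<in> \<U>. openin (punctured S) U) \<and> pairwise disjnt \<U> \<and>
      (\<forall>U \<in> \<U>. homeomorphic_map (subtopology (punctured S) U) (subtopology (punctured T) V) \<phi>))"
  proof (cases "x \<in> sides (gon T)")
    case False
    let ?I = "{f \<in> faces S. face_map \<alpha> f = g}"
    have oc: "open_cells T (open_face T g)" using open_cells_open_face[OF T g(1)] .
    have "\<exists>\<U>. \<Union>\<U> = {x \<in> topspace (punctured S). \<phi> x \<in> pts_of T (open_face T g)} \<and>
      (\<forall>U \<in> \<U>. openin (punctured S) U) \<and> pairwise disjnt \<U> \<and>
      (\<forall>U \<in> \<U>. homeomorphic_map (subtopology (punctured S) U) (subtopology (punctured T) (pts_of T (open_face T g))) \<phi>)"
    proof (rule induces_evenly_covered[OF i \<alpha> S T, of ?I "open_face S"])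
      show "open_cells S (open_face S f)" if "f \<in> ?I" for f using open_cells_open_face[OF S] that by blast
      show "inj_on (act (gon S) \<alpha>) (open_face S f)" for f
        by (rule inj_onI) (auto simp: open_face_def act_def)
      show "act (gon S) \<alpha> ` open_face S f = open_face T g" if "f \<in> ?I" for f
        using act_open_face[OF \<alpha> S] that by blast
      show "\<exists>f \<in> ?I. q \<in> open_face S f" if q: "q \<in> cells S" "act (gon S) \<alpha> q \<in> open_face T g" for q
        using q rot_of_sides[OF \<alpha> S, of "fst q" "snd q"] dart_mapD(1)[OF \<alpha>]
        by (intro bexI[of _ "fst q"]) (auto simp: open_face_def act_def cells_def)
      show "open_face S f \<inter> open_face S f' = {}" if "f \<noteq> f'" for f f' using that by (auto simp: open_face_def)
    qed (rule oc)
    moreover have "(g, x) \<in> open_face T g" using g False by (simp add: open_face_def)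
    then have "y \<in> pts_of T (open_face T g)" using g unfolding pts_of_def by force
    ultimately show ?thesis
      using pts_of_open_cells(2)[OF T oc] by (intro exI[of _ "pts_of T (open_face T g)"] conjI)
  next
    case True
    obtain l where l: "l < gon T" "(g, x) \<in> half_kite T (g, l)" using edge_in_kite[OF T g(1,2) True x] by metis
    define t where "t = (g, l)"
    have t: "t \<in> darts T" "glue T t \<in> darts T" "glue T (glue T t) = t" "glue T t \<noteq> t"
      using g l T by (auto simp: darts_def t_def gluing_def)
    have gS: "glue S s \<in> darts S" "glue S (glue S s) = s" if "s \<in> darts S" for s
      using that S by (auto simp: gluing_def)
    \<comment> \<open>Every kite is named by two darts. Admitting only the darts over
      \<open>t\<close>, and not those over its partner, counts each sheet once.\<close>
    let ?I = "{s \<in> darts S. \<alpha> s = t}"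
    have oc: "open_cells T (kite T t)" using open_cells_kite[OF T t(1)] .
    have "\<exists>\<U>. \<Union>\<U> = {x \<in> topspace (punctured S). \<phi> x \<in> pts_of T (kite T t)} \<and>
      (\<forall>U \<in> \<U>. openin (punctured S) U) \<and> pairwise disjnt \<U> \<and>
      (\<forall>U \<in> \<U>. homeomorphic_map (subtopology (punctured S) U) (subtopology (punctured T) (pts_of T (kite T t))) \<phi>)"
    proof (rule induces_evenly_covered[OF i \<alpha> S T, of ?I "kite S"])
      show "open_cells S (kite S s)" if "s \<in> ?I" for s using open_cells_kite[OF S] that by blast
      show "inj_on (act (gon S) \<alpha>) (kite S s)" if "s \<in> ?I" for s using act_inj_on_kite[OF \<alpha> S T] that by blast
      show "act (gon S) \<alpha> ` kite S s = kite T t" if "s \<in> ?I" for s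
        using that act_half_kite[OF \<alpha> S, of s] act_half_kite[OF \<alpha> S, of "glue S s"] gS[of s] dart_mapD(3)[OF \<alpha>, of s]
        by (simp add: kite_def image_Un)
      show "\<exists>s \<in> ?I. q \<in> kite S s" if q: "q \<in> cells S" "act (gon S) \<alpha> q \<in> kite T t" for q
      proof -
        obtain t' where t': "t' = t \<or> t' = glue T t" "act (gon S) \<alpha> q \<in> half_kite T t'" "t' \<in> darts T"
          using q(2) t(1,2) unfolding kite_def by blast
        obtain s where s: "s \<in> darts S" "\<alpha> s = t'" "q \<in> half_kite S s"
          using act_half_kite_lift[OF \<alpha> S q(1) t'(3,2)] .
        show ?thesis
        proof (cases "t' = t")
          case True
          with s show ?thesis by (intro bexI[of _ s]) (auto simp: kite_def)
        next
          case False
          then show ?thesis using s t' gS[OF s(1)] dart_mapD(3)[OF \<alpha> s(1)] t(3)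
            by (intro bexI[of _ "glue S s"]) (auto simp: kite_def)
        qed
      qed
      \<comment> \<open>If the kites meet, the two darts belong to the same edge; being different,
        they are partners, and then their common image \<open>t\<close> would be its own
        partner.\<close>
      show "kite S s \<inter> kite S s' = {}" if ss: "s \<in> ?I" "s' \<in> ?I" "s \<noteq> s'" for s s'
      proof (rule ccontr)
        assume "kite S s \<inter> kite S s' \<noteq> {}"
        then obtain q u v where "u \<in> {s, glue S s}" "v \<in> {s', glue S s'}" "q \<in> half_kite S u" "q \<in> half_kite S v"
          unfolding kite_def by blast
        moreover from this have "u \<in> darts S" "v \<in> darts S" using ss(1,2) gS(1)[of s] gS(1)[of s'] by auto
        ultimately have "u \<in> {s, glue S s}" "v \<in> {s', glue S s'}" "u = v" using half_kite_unique[OF S, of u v q] by blast+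
        moreover have "glue S s = glue S s' \<Longrightarrow> s = s'" using gS(2)[of s] gS(2)[of s'] ss by simp
        ultimately have "s' = glue S s \<or> s = glue S s'" using ss by blast
        then have "s' = glue S s" using gS(2)[of s'] ss by auto
        then show False using ss dart_mapD(3)[OF \<alpha>, of s] t(4) by simp
      qed
    qed (rule oc)
    moreover have "(g, x) \<in> kite T t" using l by (simp add: kite_def t_def)
    then have "y \<in> pts_of T (kite T t)" using g unfolding pts_of_def by force
    ultimately show ?thesis
      using pts_of_open_cells(2)[OF T oc] by (intro exI[of _ "pts_of T (kite T t)"] conjI)
  qed
qed

section \<open>Path connectedness off the vertices\<close>

lemma path_component_center:
  assumes S: "gluing S" and f: "f \<in> faces S" "x \<in> poly_of S" "x \<notin> corners (gon S)"
  shows "path_component_of (punctured S) (pt S f x) (pt S f 0)"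
proof -
  note p = gluing_gon[OF S]
  let ?r = "\<lambda>t. of_real (1 - t) * x"
  have r: "?r t \<in> poly_of S" if "t \<in> {0..1}" for t
    using that f p by (intro scale_in_polygon) auto
  have "continuous_map (top_of_set {0..1}) (top_of_set (poly_of S)) ?r"
    using r by (auto simp: continuous_map_in_subtopology intro!: continuous_intros)
  then have "pathin (surf_top S) (pt S f \<circ> ?r)"
    unfolding pathin_def using continuous_map_pt[OF S f(1)] by (rule continuous_map_compose)
  moreover have "pt S f (?r t) \<in> points S - vertices S" if t: "t \<in> {0..1}" for t
  proof -
    have "?r t \<notin> corners (gon S)"
    proof (cases "t = 0")
      case False
      have "cmod x \<le> 1" using f(2) polygon_subset_cball[of "gon S"] by auto
      then have "\<bar>1 - t\<bar> * cmod x \<le> \<bar>1 - t\<bar>" by (simp add: mult_left_le)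
      then have "cmod (?r t) < 1" using t False by (simp only: norm_mult norm_of_real) auto
      then show ?thesis by (auto simp: corners_def)
    qed (use f in simp)
    then show ?thesis using pt_in_vertices_iff[OF S f(1) r[OF t]] pt_in_points[OF f(1) r[OF t]] by simp
  qed
  ultimately have "pathin (punctured S) (pt S f \<circ> ?r)"
    unfolding punctured_def pathin_subtopology by auto
  then show ?thesis unfolding path_component_of_def by (intro exI[of _ "pt S f \<circ> ?r"]) auto
qed

text \<open>Every point off the vertices is joined to the centre of a face by a straight segment,
  which avoids the corners because its later points have norm below 1. Centres of neighbouring faces
  are joined through the midpoint of the common side, and dart connectedness reaches all
  faces.\<close>

lemma punctured_path_connected:
  assumes con: "connected_surface S"
  shows "path_connected_space (punctured S)"
proof -
  note S = connected_surface_gluing[OF con]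
  note p = gluing_gon[OF S]
  let ?pc = "path_component_of (punctured S)"
  have cent: "?pc (pt S f 0) (pt S g 0)" if f: "f \<in> faces S" and g: "g \<in> faces S" for f g
  proof -
    have "?pc (pt S f 0) (pt S (fst (g, 0::nat)) 0)"
    proof (rule dart_connectedD[where P="\<lambda>s. ?pc (pt S f 0) (pt S (fst s) 0)",
          OF connected_surface_darts[OF con] _ _ _ _ _ S])
      show "(f, 0) \<in> darts S" "(g, 0) \<in> darts S" using f g p by (auto simp: darts_def)
      have "pt S f 0 \<in> topspace (punctured S)"
        using f zero_in_polygon[OF p] pt_in_vertices_iff[OF S f zero_in_polygon[OF p]]
        by (auto simp: topspace_punctured[OF S] pt_in_points corners_def)
      then show "?pc (pt S f 0) (pt S (fst (f, 0)) 0)" by (simp add: path_component_of_refl)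
      show "?pc (pt S f 0) (pt S (fst (turn (gon S) n s)) 0)" if "?pc (pt S f 0) (pt S (fst s) 0)" for s n
        using that by (simp add: turn_def)
      fix s assume s: "s \<in> darts S" and pc: "?pc (pt S f 0) (pt S (fst s) 0)"
      obtain h k where hk: "s = (h, k)" "h \<in> faces S" "k < gon S" using s by (auto simp: darts_def)
      obtain h' l where hl: "glue S (h, k) = (h', l)" by fastforce
      note d = glue_dart[OF S hk(2,3) hl]
      have mid: "side_pt (gon S) j (1/2) \<in> poly_of S" "side_pt (gon S) j (1/2) \<notin> corners (gon S)" if "j < gon S" for j
        using p side_pt_corner_iff[OF p that, of "1/2"] by (auto intro: side_pt_in_polygon)
      have "pt S h (side_pt (gon S) k (1/2)) = pt S h' (side_pt (gon S) l (1/2))"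
        using pt_side_pt[OF S hk(2,3) hl, of "1/2"] by simp
      moreover have "?pc (pt S h (side_pt (gon S) k (1/2))) (pt S h 0)"
        using path_component_center[OF S hk(2) mid[OF hk(3)]] .
      moreover have "?pc (pt S h' (side_pt (gon S) l (1/2))) (pt S h' 0)"
        using path_component_center[OF S d(1) mid[OF d(2)]] .
      ultimately have "?pc (pt S h 0) (pt S h' 0)"
        using path_component_of_sym path_component_of_trans by metis
      then show "?pc (pt S f 0) (pt S (fst (glue S s)) 0)"
        using pc hk hl path_component_of_trans by fastforce
    qed
    then show ?thesis by simp
  qed
  show ?thesis
    unfolding path_connected_space_iff_path_component
  proof (intro ballI)
    fix y z assume "y \<in> topspace (punctured S)" "z \<in> topspace (punctured S)"
    then have yz: "y \<in> points S" "y \<notin> vertices S" "z \<in> points S" "z \<notin> vertices S"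
      by (auto simp: topspace_punctured[OF S])
    obtain f x g w where f: "f \<in> faces S" "x \<in> poly_of S" "y = pt S f x" and g: "g \<in> faces S" "w \<in> poly_of S" "z = pt S g w"
      using yz by (auto simp: points_eq)
    have "x \<notin> corners (gon S)" "w \<notin> corners (gon S)"
      using yz f g pt_in_vertices_iff[OF S] by auto
    then have "?pc y (pt S f 0)" "?pc z (pt S g 0)"
      using path_component_center[OF S f(1,2)] path_component_center[OF S g(1,2)] f g by auto
    then show "?pc y z" using cent[OF f(1) g(1)] path_component_of_sym path_component_of_trans by metis
  qed
qed

section \<open>Holonomy of projected paths\<close>

text \<open>The parallel field along the projection of a path in \<open>E\<close> is the image of the globally constant
  direction of \<open>E\<close>, which reads \<open>1 / d f\<close> in the chart of the face \<open>f\<close>.\<close>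

definition pushed_field ::
  "'g polysurf \<Rightarrow> ('g \<times> nat \<Rightarrow> 'f \<times> nat) \<Rightarrow> ('g \<Rightarrow> complex) \<Rightarrow> (real \<Rightarrow> ('g \<times> complex) set) \<Rightarrow> real \<Rightarrow> 'f \<times> complex \<Rightarrow> complex"
  where "pushed_field E \<alpha> d c t r =
    (THE v. \<exists>q \<in> c t. act (gon E) \<alpha> q = r \<and> v = rot_of (gon E) \<alpha> (fst q) / d (fst q))"

text \<open>The description in \<open>pushed_field\<close> denotes because different representatives
  of a point off the vertices have different images. Compatibility across an edge is the condition
  on \<open>d\<close>. Local constancy holds because nearby representatives with nearby images lie
  in the same face of \<open>E\<close>; this is delicate at an edge whose two sides are carried into
  one face of \<open>D\<close>.\<close>

lemma pushed_field_parallel: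
  fixes E :: "'g polysurf" and D :: "'f polysurf"
  assumes i: "induces E D \<alpha> \<phi>" and \<alpha>: "dart_map E D \<alpha>" and E: "gluing E" and D: "gluing D"
    and d0: "\<And>f. f \<in> faces E \<Longrightarrow> d f \<noteq> 0"
    and d: "\<And>f k g l. f \<in> faces E \<Longrightarrow> k < gon E \<Longrightarrow> glue E (f, k) = (g, l) \<Longrightarrow>
        d g * side_vec (gon E) l = - (d f * side_vec (gon E) k)"
    and c: "pathin (punctured E) c"
  shows "t \<in> {0..1} \<Longrightarrow> q \<in> c t \<Longrightarrow>
      pushed_field E \<alpha> d c t (act (gon E) \<alpha> q) = rot_of (gon E) \<alpha> (fst q) / d (fst q)"
    and "parallel_along D (\<phi> \<circ> c) (pushed_field E \<alpha> d c)"
proof -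
  let ?p = "gon E" and ?a = "act (gon E) \<alpha>" and ?V = "pushed_field E \<alpha> d c"
  define val where "val q = rot_of ?p \<alpha> (fst q) / d (fst q)" for q :: "'g \<times> complex"
  note p = gluing_gon[OF E] and pD = dart_mapD(1)[OF \<alpha>]
  have ct: "c t \<in> points E" "c t \<notin> vertices E" if "t \<in> {0..1}" for t
  proof -
    have "c t \<in> topspace (punctured E)" using c that by (auto simp: pathin_def continuous_map_def)
    then show "c t \<in> points E" "c t \<notin> vertices E" by (auto simp: topspace_punctured[OF E])
  qed
  have rep: "fst q \<in> faces E" "snd q \<in> poly_of E" "snd q \<notin> corners ?p" "pt E (fst q) (snd q) = c t" "q \<in> cells E"
    if t: "t \<in> {0..1}" and q: "q \<in> c t" for t q
  proof -
    obtain f x where f: "f \<in> faces E" "x \<in> poly_of E" "c t = pt E f x" using ct(1)[OF t] by (auto simp: points_eq)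
    have "(fst q, snd q) \<in> pt E f x" using q f(3) by simp
    then have A: "fst q \<in> faces E \<and> snd q \<in> poly_of E \<and> pt E (fst q) (snd q) = c t"
      unfolding f(3) using in_pt_iff[OF E f(1,2), of "fst q" "snd q"] by blast
    then show "fst q \<in> faces E" "snd q \<in> poly_of E" "pt E (fst q) (snd q) = c t" by blast+
    show "snd q \<notin> corners ?p"
      using A ct(2)[OF t] pt_in_vertices_iff[OF E, of "fst q" "snd q"] by metis
    show "q \<in> cells E" using A by (simp add: cells_def mem_Times_iff)
  qed
  have rel: "(q, r) \<in> (glue_rel E)\<^sup>*" if t: "t \<in> {0..1}" and qr: "q \<in> c t" "r \<in> c t" for t q r
    using rep(1,2,4)[OF t qr(1)] rep(1,2,4)[OF t qr(2)] pt_eq_iff[OF E, of "fst q" "snd q" "fst r" "snd r"] by simp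
  have V: "?V t (?a q) = val q" if t: "t \<in> {0..1}" and q: "q \<in> c t" for t q
    unfolding pushed_field_def
  proof (rule the_equality)
    show "\<exists>r \<in> c t. ?a r = ?a q \<and> val q = rot_of ?p \<alpha> (fst r) / d (fst r)" using q val_def by blast
    fix v assume "\<exists>r \<in> c t. ?a r = ?a q \<and> v = rot_of ?p \<alpha> (fst r) / d (fst r)"
    then obtain r where r: "r \<in> c t" "?a r = ?a q" "v = val r" unfolding val_def by blast
    then have "q = r"
      using act_inj_on_class[OF \<alpha> E D rep(5,3)[OF t q] rel[OF t q r(1)]] by simp
    with r show "v = val q" by simp
  qed
  then show "t \<in> {0..1} \<Longrightarrow> q \<in> c t \<Longrightarrow> ?V t (?a q) = rot_of ?p \<alpha> (fst q) / d (fst q)" by (simp add: val_def)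
  have lift: "\<exists>q \<in> c t. ?a q = r" if t: "t \<in> {0..1}" and r: "r \<in> \<phi> (c t)" for t r
  proof -
    have r': "(fst r, snd r) \<in> \<phi> (c t)" using r by simp
    obtain f x where "(f, x) \<in> c t" "f \<in> faces E" "x \<in> poly_of E" "face_map \<alpha> f = fst r" "rot_of ?p \<alpha> f * x = snd r"
      using induces_lift[OF i \<alpha> E D ct(1)[OF t] r'] .
    then show ?thesis by (intro bexI[of _ "(f, x)"]) (simp_all add: act_def)
  qed
  show "parallel_along D (\<phi> \<circ> c) ?V"
    unfolding parallel_along_def
  proof (intro conjI ballI allI impI)
    fix t g x k g' l
    assume t: "t \<in> {0..1}" and "(g, x) \<in> (\<phi> \<circ> c) t \<and> k < gon D \<and> x \<in> side (gon D) k \<and> glue D (g, k) = (g', l)"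
    then have gx: "(g, x) \<in> \<phi> (c t)" and k: "k < ?p" "x \<in> side ?p k" and gl: "glue D (g, k) = (g', l)"
      using pD by auto
    obtain s where s: "0 \<le> s" "s \<le> 1" "x = side_pt ?p k s" using k by (auto simp: side_eq)
    obtain q where q: "q \<in> c t" "?a q = (g, x)" using lift[OF t gx] by blast
    have gD: "g \<in> faces D" using act_in_cells[OF \<alpha> E rep(5)[OF t q(1)]] q(2) by (simp add: cells_def)
    define y where "y = glue_map ?p k l x"
    have y: "y = side_pt ?p l (1 - s)" using glue_map_side_pt[OF p] s by (simp add: y_def)
    have "((g, x), (g', y)) \<in> glue_rel D" using glue_relI[OF D gD _ gl s(1,2)] k s y pD by simp
    then obtain r where r: "(q, r) \<in> glue_rel E" "?a r = (g', y)"
      using act_lift_glue_rel[OF \<alpha> E D rep(5)[OF t q(1)]] q(2) by metis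
    have "r \<in> c t" using r(1) rep(1,2,4)[OF t q(1)] pt_eq[OF E] by (metis mem_Collect_eq prod.collapse r_into_rtrancl)
    then have Vr: "?V t (g', y) = val r" using V[OF t] r(2) by metis
    have Vq: "?V t (g, x) = val q" using V[OF t] q by metis
    obtain f k0 f' l0 s0 where 1: "f \<in> faces E" "k0 < ?p" "glue E (f, k0) = (f', l0)" and s0: "0 \<le> s0" "s0 \<le> 1"
      and qr: "q = (f, side_pt ?p k0 s0)" "r = (f', side_pt ?p l0 (1 - s0))"
      using glue_relE[OF E r(1)] .
    note 2 = glue_dart[OF E 1]
    have "s0 \<noteq> 0" "s0 \<noteq> 1" using rep(3)[OF t q(1)] side_pt_corner_iff[OF p 1(2) s0] qr by auto
    then have s0': "0 < s0" "s0 < 1" using s0 by auto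
    have "side_pt ?p (snd (\<alpha> (f, k0))) s0 = side_pt ?p k s"
      using dart_map_rot(4)[OF \<alpha> E 1(1,2)] q(2) qr s by (simp add: act_def)
    then have "k = snd (\<alpha> (f, k0))"
      using side_pt_unique(1)[OF p k(1) dart_map_rot(2)[OF \<alpha> E 1(1,2)] s0' s(1,2)] by simp
    then have \<alpha>k: "\<alpha> (f, k0) = (g, k)"
      using dart_map_rot(1)[OF \<alpha> E 1(1,2)] q(2) qr by (simp add: act_def prod_eq_iff)
    have "\<alpha> (f', l0) = (g', l)"
      using dart_mapD(3)[OF \<alpha>, of "(f, k0)"] 1 \<alpha>k gl by (simp add: darts_def)
    then have sv: "side_vec ?p k = rot_of ?p \<alpha> f * side_vec ?p k0" "side_vec ?p l = rot_of ?p \<alpha> f' * side_vec ?p l0"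
      using dart_map_rot(5)[OF \<alpha> E 1(1,2)] dart_map_rot(5)[OF \<alpha> E 2(1,2)] \<alpha>k by simp_all
    have nz: "side_vec ?p k0 \<noteq> 0" "d f \<noteq> 0" "d f' \<noteq> 0" using side_vec_nonzero[OF p] d0 1 2 by auto
    \<comment> \<open>The rotation on the face of \<open>q\<close> occurs in \<open>val q\<close>
      and in the vector of side \<open>k\<close>, and cancels; what remains is governed by the
      condition on \<open>d\<close>.\<close>
    have "glue_rot ?p k l * val q = - (rot_of ?p \<alpha> f' * side_vec ?p l0) / (d f * side_vec ?p k0)"
      using nz by (simp add: glue_rot_def sv val_def qr)
    also have "d f * side_vec ?p k0 = - (d f' * side_vec ?p l0)" using d[OF 1] by simp
    also have "- (rot_of ?p \<alpha> f' * side_vec ?p l0) / - (d f' * side_vec ?p l0) = val r"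
      using side_vec_nonzero[OF p, of l0] by (simp add: val_def qr)
    finally show "?V t (g', glue_map (gon D) k l x) = glue_rot (gon D) k l * ?V t (g, x)"
      using Vr Vq pD by (simp add: y_def)
  next
    fix t :: real assume t: "t \<in> {0..1}"
    obtain q where q: "q \<in> c t"
    proof -
      obtain f x where f: "f \<in> faces E" "x \<in> poly_of E" "c t = pt E f x" using ct(1)[OF t] by (auto simp: points_eq)
      then have "(f, x) \<in> c t" using pt_eq[OF E] by simp
      with that show thesis .
    qed
    obtain f x where fx: "q = (f, x)" by fastforce
    have fE: "f \<in> faces E" "x \<in> poly_of E" "x \<notin> corners ?p" "pt E f x = c t"
      using rep(1-4)[OF t q] fx by auto
    have near: "\<exists>\<epsilon>>0. \<forall>s \<in> {0..1}. \<bar>s - t\<bar> < \<epsilon> \<longrightarrow> c s \<subseteq> W" if W: "open_cells E W" "q \<in> W" for W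
    proof -
      have sat: "saturated E W" using W by (simp add: open_cells_def)
      have "c t \<in> pts_of E W" using W(2) fE fx by (force simp: pts_of_def)
      moreover have "openin (top_of_set {0..1}) {s \<in> {0..1}. c s \<in> pts_of E W}"
        using c pts_of_open_cells(2)[OF E W(1)] by (auto simp: pathin_def continuous_map_def)
      ultimately obtain \<epsilon> where e: "\<epsilon> > 0" "\<And>s. s \<in> {0..1} \<Longrightarrow> dist s t < \<epsilon> \<Longrightarrow> c s \<in> pts_of E W"
        using t unfolding openin_euclidean_subtopology_iff by (metis (mono_tags, lifting) mem_Collect_eq)
      have "c s \<subseteq> W" if s: "s \<in> {0..1}" "\<bar>s - t\<bar> < \<epsilon>" for s
      proof
        fix r assume r: "r \<in> c s"
        have "pt E (fst r) (snd r) \<in> pts_of E W" using rep(4)[OF s(1) r] e(2) s by (simp add: dist_real_def)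
        then show "r \<in> W" using pt_in_pts_of_iff[OF E sat rep(1,2)[OF s(1) r]] by simp
      qed
      with e(1) show ?thesis by blast
    qed
    show "\<exists>\<epsilon>>0. \<forall>s\<in>{0..1}. \<bar>s - t\<bar> < \<epsilon> \<longrightarrow> (\<forall>g y y'. (g, y) \<in> (\<phi> \<circ> c) s \<and> (g, y') \<in> (\<phi> \<circ> c) t \<and>
        dist y y' < \<epsilon> \<longrightarrow> ?V s (g, y) = ?V t (g, y'))"
    proof (cases "x \<in> sides ?p")
      case False
      then have "q \<in> open_face E f" using fE fx by (simp add: open_face_def)
      then obtain \<epsilon> where e: "\<epsilon> > 0" "\<And>s. s \<in> {0..1} \<Longrightarrow> \<bar>s - t\<bar> < \<epsilon> \<Longrightarrow> c s \<subseteq> open_face E f"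
        using near[OF open_cells_open_face[OF E fE(1)]] by blast
      have val: "?V s r = rot_of ?p \<alpha> f / d f" if s: "s \<in> {0..1}" "\<bar>s - t\<bar> < \<epsilon>" and r: "r \<in> \<phi> (c s)" for s r
      proof -
        obtain q' where q': "q' \<in> c s" "?a q' = r" using lift[OF s(1) r] by blast
        then have "fst q' = f" using e(2)[OF s] by (auto simp: open_face_def)
        then show ?thesis using V[OF s(1) q'(1)] q' by (simp add: val_def)
      qed
      show ?thesis
      proof (intro exI[of _ \<epsilon>] conjI e(1) ballI impI allI)
        fix s g y y' assume s: "s \<in> {0..1}" "\<bar>s - t\<bar> < \<epsilon>"
          and r: "(g, y) \<in> (\<phi> \<circ> c) s \<and> (g, y') \<in> (\<phi> \<circ> c) t \<and> dist y y' < \<epsilon>"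
        then show "?V s (g, y) = ?V t (g, y')" using val[OF s] val[OF t] e(1) by simp
      qed
    next
      case True
      obtain k u where k: "k < ?p" "0 < u" "u < 1" "x = side_pt ?p k u" "(f, x) \<in> half_kite E (f, k)"
        using edge_in_kite[OF E fE(1,2) True fE(3)] .
      obtain f' l where gl: "glue E (f, k) = (f', l)" by fastforce
      note 2 = glue_dart[OF E fE(1) k(1) gl]
      have dk: "(f, k) \<in> darts E" "(f', l) \<in> darts E" using fE k 2 by (auto simp: darts_def)
      define q' where "q' = (f', side_pt ?p l (1 - u))"
      have q'k: "q' \<in> half_kite E (f', l)"
        using half_kite_glue[OF E dk(1) k(5)] glue_relI[OF E fE(1) k(1) gl] k gl by (simp add: q'_def)
      have reps: "r = q \<or> r = q'" if r: "r \<in> c t" for r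
      proof -
        have "(q, q') \<in> glue_rel E" using glue_relI[OF E fE(1) k(1) gl] k fx by (simp add: q'_def)
        moreover have "r = q \<or> (q, r) \<in> glue_rel E"
          using rel[OF t q r] nonvertex_class[OF E fE(3)] fx by simp
        ultimately show ?thesis using glue_rel_functional[OF E] fE(3) fx by (metis snd_conv)
      qed
      let ?t1 = "\<alpha> (f, k)" and ?t2 = "\<alpha> (f', l)"
      have tD: "?t1 \<in> darts D" "?t2 \<in> darts D" using dart_mapD(2)[OF \<alpha>] dk by auto
      have i1: "?a r \<in> half_kite D ?t1" if "r \<in> half_kite E (f, k)" for r
        using act_half_kite[OF \<alpha> E dk(1)] that by blast
      have i2: "?a r \<in> half_kite D ?t2" if "r \<in> half_kite E (f', l)" for r
        using act_half_kite[OF \<alpha> E dk(2)] that by blast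
      have sec: "snd (?a q) \<in> sector ?p (snd ?t1)" "snd (?a q') \<in> sector ?p (snd ?t2)"
        using i1[of q] i2[OF q'k] k(5) fx pD by (auto simp: half_kite_def)
      obtain e1 where e1: "e1 > 0" "ball (snd (?a q)) e1 \<subseteq> sector ?p (snd ?t1)"
        using open_sector sec(1) by (meson openE)
      obtain e2 where e2: "e2 > 0" "ball (snd (?a q')) e2 \<subseteq> sector ?p (snd ?t2)"
        using open_sector sec(2) by (meson openE)
      have "q \<in> kite E (f, k)" using k(5) fx by (simp add: kite_def)
      then obtain e3 where e3: "e3 > 0" "\<And>s. s \<in> {0..1} \<Longrightarrow> \<bar>s - t\<bar> < e3 \<Longrightarrow> c s \<subseteq> kite E (f, k)"
        using near[OF open_cells_kite[OF E dk(1)]] by blast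
      \<comment> \<open>\<open>e3\<close> keeps the path in the kite around the edge;
        \<open>e1\<close> and \<open>e2\<close> keep a point close to the image of either
        representative inside the sector of that image.\<close>
      define \<epsilon> where "\<epsilon> = min e1 (min e2 e3)"
      show ?thesis
      proof (intro exI[of _ \<epsilon>] conjI ballI impI allI)
        show "\<epsilon> > 0" using e1 e2 e3 by (simp add: \<epsilon>_def)
        fix s g y y' assume s: "s \<in> {0..1}" "\<bar>s - t\<bar> < \<epsilon>"
          and r: "(g, y) \<in> (\<phi> \<circ> c) s \<and> (g, y') \<in> (\<phi> \<circ> c) t \<and> dist y y' < \<epsilon>"
        obtain r1 where r1: "r1 \<in> c s" "?a r1 = (g, y)" using lift[OF s(1), of "(g, y)"] r by auto
        obtain r2 where r2: "r2 \<in> c t" "?a r2 = (g, y')" using lift[OF t, of "(g, y')"] r by auto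
        have r1k: "r1 \<in> half_kite E (f, k) \<or> r1 \<in> half_kite E (f', l)"
          using e3(2)[OF s(1)] s(2) r1(1) gl by (auto simp: kite_def \<epsilon>_def)
        have r2q: "r2 = q \<or> r2 = q'" using reps r2 by blast
        have uniq: "tt = tt'" if "tt \<in> darts D" "tt' \<in> darts D" "(g, y) \<in> half_kite D tt" "(g, y') \<in> half_kite D tt'"
          "y \<in> sector ?p (snd tt')" for tt tt'
        proof -
          have "(g, y) \<in> half_kite D tt'" using that pD by (auto simp: half_kite_def)
          then show ?thesis using half_kite_unique[OF D that(1,2,3)] by blast
        qed
        \<comment> \<open>Sectors of different darts are disjoint, so lying in the sector of the
          image of \<open>r2\<close> forces \<open>r1\<close> into the half of the kite that
          contains \<open>r2\<close>. Without the bound on the distance, the image of the other half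
          could be compared.\<close>
        have "fst r1 = fst r2"
        proof (cases "r2 = q")
          case True
          then have "(g, y') \<in> half_kite D ?t1" using i1[of q] k(5) fx r2 by simp
          moreover have "y \<in> sector ?p (snd ?t1)"
            using e1(2) r r2 True by (auto simp: \<epsilon>_def dist_commute subset_iff)
          ultimately have "r1 \<in> half_kite E (f', l) \<Longrightarrow> ?t2 = ?t1"
            using uniq[OF tD(2,1)] i2[of r1] r1 by simp
          moreover have "?t2 \<noteq> ?t1" using dart_mapD(3)[OF \<alpha> dk(1)] gl D tD(1) by (auto simp: gluing_def)
          ultimately have "r1 \<in> half_kite E (f, k)" using r1k by metis
          then show ?thesis using True fx by (auto simp: half_kite_def)
        next
          case False
          then have r2q': "r2 = q'" using r2q by simp
          then have "(g, y') \<in> half_kite D ?t2" using i2[OF q'k] r2 by simp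
          moreover have "y \<in> sector ?p (snd ?t2)"
            using e2(2) r r2 r2q' by (auto simp: \<epsilon>_def dist_commute subset_iff)
          ultimately have "r1 \<in> half_kite E (f, k) \<Longrightarrow> ?t1 = ?t2"
            using uniq[OF tD] i1[of r1] r1 by simp
          moreover have "?t2 \<noteq> ?t1" using dart_mapD(3)[OF \<alpha> dk(1)] gl D tD(1) by (auto simp: gluing_def)
          ultimately have "r1 \<in> half_kite E (f', l)" using r1k by metis
          then show ?thesis using r2q' by (auto simp: half_kite_def q'_def)
        qed
        then show "?V s (g, y) = ?V t (g, y')"
          using V[OF s(1) r1(1)] V[OF t r2(1)] r1(2) r2(2) by (simp add: val_def)
      qed
    qed
  qed
qed

lemma pt_center:
  assumes E: "gluing E" and f: "f \<in> faces E"
  shows "pt E f 0 = {(f, 0)}" "pt E f 0 \<in> topspace (punctured E)"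
proof -
  note p = gluing_gon[OF E]
  have z: "0 \<in> poly_of E" using zero_in_polygon[OF p] .
  have ns: "0 \<notin> side (gon E) k" for k using spoke_notin_side[OF p, of 0] by simp
  have "(g, y) \<in> pt E f 0 \<longleftrightarrow> (g, y) = (f, 0)" for g y
    using in_pt_iff[OF E f z, of g y] pt_eq_offside[OF E f z ns, of g y] f z by auto
  then show "pt E f 0 = {(f, 0)}" by auto
  have "0 \<notin> corners (gon E)" by (auto simp: corners_def)
  then show "pt E f 0 \<in> topspace (punctured E)"
    using pt_in_vertices_iff[OF E f z] pt_in_points[OF f z] by (simp add: topspace_punctured[OF E])
qed

text \<open>A path between the two centres projects to a loop. The pushed field along it starts with
  the left-hand and ends with the right-hand side of the last hypothesis, so the holonomy is 0 and
  the path is closed. Centres are used as ends because the field is then read in a single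
  chart.\<close>

lemma unfolding_face_unique:
  assumes u: "is_unfolding D E \<phi>" and D: "gluing D"
    and i: "induces E D \<alpha> \<phi>" and \<alpha>: "dart_map E D \<alpha>"
    and d0: "\<And>f. f \<in> faces E \<Longrightarrow> d f \<noteq> 0"
    and d: "\<And>f k g l. f \<in> faces E \<Longrightarrow> k < gon E \<Longrightarrow> glue E (f, k) = (g, l) \<Longrightarrow>
        d g * side_vec (gon E) l = - (d f * side_vec (gon E) k)"
    and f: "f \<in> faces E" "f' \<in> faces E" "face_map \<alpha> f = face_map \<alpha> f'"
      "rot_of (gon E) \<alpha> f / d f = rot_of (gon E) \<alpha> f' / d f'"
  shows "f = f'"
proof -
  have con: "connected_surface E" using u by (simp add: is_unfolding_def)
  note E = connected_surface_gluing[OF con]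
  have z: "0 \<in> poly_of E" using zero_in_polygon[OF gluing_gon[OF E]] .
  obtain c where c: "pathin (punctured E) c" "c 0 = pt E f 0" "c 1 = pt E f' 0"
    using punctured_path_connected[OF con, unfolded path_connected_space_def, rule_format,
        OF pt_center(2)[OF E f(1)] pt_center(2)[OF E f(2)]] by blast
  note V = pushed_field_parallel[OF i \<alpha> E D d0 d c(1)]
  have e: "\<phi> (c 0) = pt D (face_map \<alpha> f) 0" "\<phi> (c 1) = pt D (face_map \<alpha> f) 0"
    using inducesD[OF i f(1) z] inducesD[OF i f(2) z] c f(3) by simp_all
  have "has_holonomy D (\<phi> \<circ> c) 0"
    unfolding has_holonomy_def
  proof (intro exI[of _ "pushed_field E \<alpha> d c"] conjI ballI)
    show "parallel_along D (\<phi> \<circ> c) (pushed_field E \<alpha> d c)" by (rule V(2))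
    fix q assume "q \<in> (\<phi> \<circ> c) 0"
    then have q: "q = (face_map \<alpha> f, 0)"
      using e pt_center(1)[OF D face_map_in[OF \<alpha> E f(1)]] by simp
    have "(f, 0) \<in> c 0" "(f', 0) \<in> c 1" using c pt_center(1)[OF E] f by auto
    then have "pushed_field E \<alpha> d c 0 q = rot_of (gon E) \<alpha> f / d f" "pushed_field E \<alpha> d c 1 q = rot_of (gon E) \<alpha> f' / d f'"
      using V(1)[where t=0 and q="(f, 0)"] V(1)[where t=1 and q="(f', 0)"] f(3) q by (auto simp: act_def)
    then show "pushed_field E \<alpha> d c 0 q \<noteq> 0" "pushed_field E \<alpha> d c 1 q = cis 0 * pushed_field E \<alpha> d c 0 q"
      using f d0 by simp_all
  qed
  moreover have "c 0 = c 1 \<longleftrightarrow> \<phi> (c 0) = \<phi> (c 1) \<and> has_holonomy D (\<phi> \<circ> c) 0"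
    using u c(1) unfolding is_unfolding_def by blast
  ultimately have "c 0 = c 1" using e by simp
  then show ?thesis using c pt_center(1)[OF E] f by simp
qed

section \<open>Two group-theoretic lemmas\<close>

text \<open>A multiplicative map into a field takes equal values on conjugates, so its kernel is
  normal, and surjectivity of \<open>\<Psi>\<close> carries normality to \<open>G\<close>. Modulo
  the kernel every element is a power of \<open>h0\<close>, which passes to the quotient of
  \<open>G\<close>.\<close>

lemma kernel_image_cyclic_quotient:
  fixes G (structure) and H :: "('b, 'n) monoid_scheme" and \<xi> :: "'b \<Rightarrow> 'c::field"
  assumes G: "group G" and H: "group H" and \<Psi>: "\<Psi> \<in> hom H G" "\<Psi> ` carrier H = carrier G"
    and \<xi>: "\<And>x y. x \<in> carrier H \<Longrightarrow> y \<in> carrier H \<Longrightarrow> \<xi> (x \<otimes>\<^bsub>H\<^esub> y) = \<xi> x * \<xi> y"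
    and \<xi>0: "\<And>x. x \<in> carrier H \<Longrightarrow> \<xi> x \<noteq> 0"
    and inj: "inj_on \<Psi> {x \<in> carrier H. \<xi> x = 1}"
    and h0: "h0 \<in> carrier H" "\<And>x. x \<in> carrier H \<Longrightarrow> \<exists>n::nat. \<xi> x = \<xi> h0 ^ n"
  shows "\<Psi> ` {x \<in> carrier H. \<xi> x = 1} \<lhd> G"
    "group (H\<lparr>carrier := {x \<in> carrier H. \<xi> x = 1}\<rparr>)"
    "H\<lparr>carrier := {x \<in> carrier H. \<xi> x = 1}\<rparr> \<cong> G\<lparr>carrier := \<Psi> ` {x \<in> carrier H. \<xi> x = 1}\<rparr>"
    "cyclic_group (G Mod \<Psi> ` {x \<in> carrier H. \<xi> x = 1})"
proof -
  interpret G: group G by (rule G)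
  interpret H: group H by (rule H)
  interpret \<Psi>: group_hom H G \<Psi> by unfold_locales (rule \<Psi>(1))
  let ?K = "{x \<in> carrier H. \<xi> x = 1}"
  let ?N = "\<Psi> ` ?K"
  have one: "\<xi> \<one>\<^bsub>H\<^esub> = 1"
    using \<xi>[of "\<one>\<^bsub>H\<^esub>" "\<one>\<^bsub>H\<^esub>"] \<xi>0[of "\<one>\<^bsub>H\<^esub>"] by simp
  have inv: "\<xi> (inv\<^bsub>H\<^esub> x) * \<xi> x = 1" if "x \<in> carrier H" for x
    using \<xi>[of "inv\<^bsub>H\<^esub> x" x] that one by simp
  have pow: "\<xi> (x [^]\<^bsub>H\<^esub> (n::nat)) = \<xi> x ^ n" if "x \<in> carrier H" for x n
    by (induction n) (use that in \<open>simp_all add: one \<xi>\<close>)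
  have K: "subgroup ?K H"
  proof (rule H.subgroupI)
    show "inv\<^bsub>H\<^esub> x \<in> ?K" if "x \<in> ?K" for x using that inv[of x] by simp
  qed (use one \<xi> in auto)
  show "group (H\<lparr>carrier := ?K\<rparr>)" using K by (rule subgroup.subgroup_is_group) (rule H)
  have N: "subgroup ?N G" by (rule \<Psi>.subgroup_img_is_subgroup[OF K])
  show normal: "?N \<lhd> G"
    unfolding G.normal_inv_iff
  proof (intro conjI ballI N)
    fix g n assume "g \<in> carrier G" "n \<in> ?N"
    then obtain h k where h: "h \<in> carrier H" "g = \<Psi> h" and k: "k \<in> carrier H" "\<xi> k = 1" "n = \<Psi> k"
      using \<Psi>(2) by blast
    have "\<xi> (h \<otimes>\<^bsub>H\<^esub> k \<otimes>\<^bsub>H\<^esub> inv\<^bsub>H\<^esub> h) = 1"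
      using h k inv[of h] by (simp add: \<xi> mult.commute)
    then have "\<Psi> (h \<otimes>\<^bsub>H\<^esub> k \<otimes>\<^bsub>H\<^esub> inv\<^bsub>H\<^esub> h) \<in> ?N" using h k by blast
    then show "g \<otimes> n \<otimes> inv g \<in> ?N" using h k by simp
  qed
  have "\<Psi> \<in> iso (H\<lparr>carrier := ?K\<rparr>) (G\<lparr>carrier := ?N\<rparr>)"
    using inj by (auto simp: iso_def hom_def bij_betw_def)
  then show "H\<lparr>carrier := ?K\<rparr> \<cong> G\<lparr>carrier := ?N\<rparr>" by (rule is_isoI)
  interpret N: normal ?N G by (rule normal)
  interpret Q: group "G Mod ?N" by (rule N.factorgroup_is_group)
  let ?x = "?N #> \<Psi> h0"
  have q: "group_hom G (G Mod ?N) (\<lambda>a. ?N #> a)"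
    by unfold_locales (rule N.r_coset_hom_Mod)
  have x: "?x \<in> carrier (G Mod ?N)" using group_hom.hom_closed[OF q \<Psi>.hom_closed[OF h0(1)]] .
  have "carrier (G Mod ?N) = range (\<lambda>n::int. ?x [^]\<^bsub>G Mod ?N\<^esub> n)"
  proof
    show "range (\<lambda>n::int. ?x [^]\<^bsub>G Mod ?N\<^esub> n) \<subseteq> carrier (G Mod ?N)" using Q.int_pow_closed[OF x] by blast
    show "carrier (G Mod ?N) \<subseteq> range (\<lambda>n::int. ?x [^]\<^bsub>G Mod ?N\<^esub> n)"
    proof
      fix C assume "C \<in> carrier (G Mod ?N)"
      then have "C \<in> rcosets ?N" by (simp add: FactGroup_def)
      then obtain g where g: "g \<in> carrier G" "C = ?N #> g" unfolding RCOSETS_def UN_iff singleton_iff by (elim bexE)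
      have "g \<in> \<Psi> ` carrier H" using g(1) \<Psi>(2) by simp
      with g(2) obtain h where h: "h \<in> carrier H" "C = ?N #> \<Psi> h" by (elim imageE) simp
      obtain n :: nat where n: "\<xi> h = \<xi> h0 ^ n" using h0(2)[OF h(1)] by blast
      let ?y = "h0 [^]\<^bsub>H\<^esub> n"
      \<comment> \<open>Dividing by the power of \<open>h0\<close> with the same value leaves an
        element of the kernel, so \<open>\<Psi> h\<close> and that power of \<open>\<Psi> h0\<close>
        have the same coset.\<close>
      define k where "k = h \<otimes>\<^bsub>H\<^esub> inv\<^bsub>H\<^esub> ?y"
      have y: "?y \<in> carrier H" using h0 by simp
      have "\<xi> k = 1"
        using h y n inv[of ?y] by (simp add: k_def \<xi> pow[OF h0(1)] mult.commute)
      moreover have kH: "k \<in> carrier H" using h y by (simp add: k_def)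
      ultimately have k: "\<Psi> k \<in> ?N" by (intro imageI) simp
      have "k \<otimes>\<^bsub>H\<^esub> ?y = h" using h y by (simp add: k_def H.m_assoc)
      then have "\<Psi> h = \<Psi> k \<otimes> \<Psi> ?y" using \<Psi>.hom_mult[OF kH y] by simp
      then have "\<Psi> h \<in> ?N #> \<Psi> ?y" using G.rcosI[OF k] N.subset y by simp
      then have "C = ?N #> \<Psi> ?y" using G.repr_independence[OF _ _ N] h y by simp
      also have "\<Psi> ?y = \<Psi> h0 [^] n" using \<Psi>.hom_nat_pow[OF h0(1)] .
      also have "?N #> (\<Psi> h0 [^] n) = ?x [^]\<^bsub>G Mod ?N\<^esub> n"
        using group_hom.hom_nat_pow[OF q, of "\<Psi> h0" n] h0 by simp
      also have "\<dots> = ?x [^]\<^bsub>G Mod ?N\<^esub> int n" by (simp add: int_pow_int)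
      finally show "C \<in> range (\<lambda>n::int. ?x [^]\<^bsub>G Mod ?N\<^esub> n)" by blast
    qed
  qed
  then show "cyclic_group (G Mod ?N)" unfolding Q.cyclic_group by (rule bexI[OF _ x])
qed

text \<open>An equivariant map of a simply transitive action is determined by the image of one point, so that
  \<open>M\<close> below contains all equivariant maps, and they form a copy of the opposite group of \<open>K\<close>.\<close>

lemma equivariant_maps_iso:
  fixes K (structure) and F :: "'b set"
  assumes K: "group K"
    and a: "\<And>k y. k \<in> carrier K \<Longrightarrow> y \<in> F \<Longrightarrow> a k y \<in> F"
      "\<And>k l y. k \<in> carrier K \<Longrightarrow> l \<in> carrier K \<Longrightarrow> y \<in> F \<Longrightarrow> a (k \<otimes> l) y = a k (a l y)"
    and trans: "\<And>y z. y \<in> F \<Longrightarrow> z \<in> F \<Longrightarrow> \<exists>k \<in> carrier K. a k y = z"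
    and free: "\<And>k l y. k \<in> carrier K \<Longrightarrow> l \<in> carrier K \<Longrightarrow> y \<in> F \<Longrightarrow> a k y = a l y \<Longrightarrow> k = l"
    and F: "F \<noteq> {}"
    and M: "\<And>m. m \<in> M \<Longrightarrow> m \<in> extensional F" "\<And>m y. m \<in> M \<Longrightarrow> y \<in> F \<Longrightarrow> m y \<in> F"
      "\<And>m k y. m \<in> M \<Longrightarrow> k \<in> carrier K \<Longrightarrow> y \<in> F \<Longrightarrow> m (a k y) = a k (m y)"
    and Mtrans: "\<And>y z. y \<in> F \<Longrightarrow> z \<in> F \<Longrightarrow> \<exists>m \<in> M. m y = z"
  shows "group ((BijGroup F)\<lparr>carrier := M\<rparr>)" "(BijGroup F)\<lparr>carrier := M\<rparr> \<cong> K"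
proof -
  interpret K: group K by (rule K)
  obtain y0 where y0: "y0 \<in> F" using F by blast
  have determined: "m = m'"
    if m: "m \<in> extensional F" "\<And>k. k \<in> carrier K \<Longrightarrow> m (a k y0) = a k (m y0)"
      and m': "m' \<in> extensional F" "\<And>k. k \<in> carrier K \<Longrightarrow> m' (a k y0) = a k (m' y0)"
      and "m y0 = m' y0" for m m'
  proof (rule extensionalityI[OF m(1) m'(1)])
    fix y assume "y \<in> F"
    then obtain k where "k \<in> carrier K" "a k y0 = y" using trans[OF y0] by blast
    then show "m y = m' y" using that by metis
  qed
  have all: "m \<in> M" if m: "m \<in> extensional F" "m y0 \<in> F" "\<And>k. k \<in> carrier K \<Longrightarrow> m (a k y0) = a k (m y0)" for m
  proof -
    obtain m' where m': "m' \<in> M" "m' y0 = m y0" using Mtrans[OF y0 m(2)] by blast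
    have "m = m'"
      by (rule determined[OF m(1) m(3) M(1)[OF m'(1)] M(3)[OF m'(1) _ y0] m'(2)[symmetric]])
    with m' show ?thesis by simp
  qed
  have bij: "M \<subseteq> Bij F"
  proof
    fix m assume m: "m \<in> M"
    have "inj_on m F"
    proof (rule inj_onI)
      fix y z assume yz: "y \<in> F" "z \<in> F" "m y = m z"
      obtain k where k: "k \<in> carrier K" "a k y = z" using trans[OF yz(1,2)] by blast
      \<comment> \<open>Transitivity provides \<open>l\<close> as a stand-in for the unit, whose
        action is not specified.\<close>
      obtain l where l: "l \<in> carrier K" "a l y = y" using trans[OF yz(1,1)] by blast
      have "a k (m y) = a l (m y)" using M(3)[OF m k(1) yz(1)] M(3)[OF m l(1) yz(1)] k l yz by simp
      then have "k = l" using free[OF k(1) l(1) M(2)[OF m yz(1)]] by simp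
      with k l show "y = z" by simp
    qed
    moreover have "z \<in> m ` F" if z: "z \<in> F" for z
    proof -
      obtain k where k: "k \<in> carrier K" "a k (m y0) = z" using trans[OF M(2)[OF m y0] z] by blast
      then have "m (a k y0) = z" using M(3)[OF m k(1) y0] by simp
      then show ?thesis using a(1)[OF k(1) y0] by blast
    qed
    ultimately show "m \<in> Bij F" using M(1,2)[OF m] by (auto simp: Bij_def bij_betw_def)
  qed
  let ?B = "BijGroup F"
  interpret B: group ?B by (rule group_BijGroup)
  have mult: "m \<otimes>\<^bsub>?B\<^esub> m' = compose F m m'" if "m \<in> M" "m' \<in> M" for m m'
    using that bij by (auto simp: BijGroup_def)
  have one: "(\<lambda>y\<in>F. y) \<in> M" by (rule all) (use y0 a in auto)
  have comp: "compose F m m' \<in> M" if "m \<in> M" "m' \<in> M" for m m'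
    by (rule all) (use that M y0 a in \<open>auto simp: compose_def\<close>)
  have sub: "subgroup M ?B"
  proof (rule B.subgroupI)
    show "M \<subseteq> carrier ?B" using bij by (simp add: BijGroup_def)
    show "M \<noteq> {}" using one by blast
    show "m \<otimes>\<^bsub>?B\<^esub> m' \<in> M" if "m \<in> M" "m' \<in> M" for m m' using that comp mult by simp
    fix m assume m: "m \<in> M"
    obtain m' where m': "m' \<in> M" "m' (m y0) = y0" using Mtrans[OF M(2)[OF m y0] y0] by blast
    have "compose F m' m = (\<lambda>y\<in>F. y)"
      by (rule determined)
        (use m m' y0 a M(3)[OF m _ y0] M(3)[OF m'(1) _ M(2)[OF m y0]] in \<open>simp_all add: compose_def\<close>)
    then have "m' \<otimes>\<^bsub>?B\<^esub> m = \<one>\<^bsub>?B\<^esub>" using mult[OF m'(1) m] by (simp add: BijGroup_def)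
    moreover have "m \<in> carrier ?B" "m' \<in> carrier ?B" using bij m m' by (auto simp: BijGroup_def)
    ultimately have "inv\<^bsub>?B\<^esub> m = m'" by (rule B.inv_equality)
    with m' show "inv\<^bsub>?B\<^esub> m \<in> M" by simp
  qed
  then show grp: "group (?B\<lparr>carrier := M\<rparr>)" by (rule subgroup.subgroup_is_group) (rule group_BijGroup)
  define \<kappa> where "\<kappa> m = (SOME k. k \<in> carrier K \<and> a k y0 = m y0)" for m
  have \<kappa>: "\<kappa> m \<in> carrier K" "a (\<kappa> m) y0 = m y0" if m: "m \<in> M" for m
  proof -
    have "\<exists>k. k \<in> carrier K \<and> a k y0 = m y0" using trans[OF y0 M(2)[OF m y0]] by blast
    then have "\<kappa> m \<in> carrier K \<and> a (\<kappa> m) y0 = m y0" unfolding \<kappa>_def by (rule someI_ex)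
    then show "\<kappa> m \<in> carrier K" "a (\<kappa> m) y0 = m y0" by auto
  qed
  have \<kappa>_mult: "\<kappa> (compose F m m') = \<kappa> m' \<otimes> \<kappa> m" if m: "m \<in> M" "m' \<in> M" for m m'
  proof (rule free[OF _ _ y0])
    have "a (\<kappa> m' \<otimes> \<kappa> m) y0 = m (a (\<kappa> m') y0)"
      using \<kappa> m a(2) M(3) y0 by simp
    then show "a (\<kappa> (compose F m m')) y0 = a (\<kappa> m' \<otimes> \<kappa> m) y0"
      using \<kappa>[OF comp[OF m]] \<kappa>[OF m(2)] y0 by (simp add: compose_def)
  qed (use \<kappa> comp m in auto)
  \<comment> \<open>\<open>\<kappa>\<close> reverses products, since an equivariant map commutes
    past the action before being evaluated at \<open>y0\<close>; inversion restores the
    order.\<close>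
  have "(\<lambda>m. inv (\<kappa> m)) \<in> iso (?B\<lparr>carrier := M\<rparr>) K"
    unfolding iso_def bij_betw_def
  proof (intro CollectI conjI)
    show "(\<lambda>m. inv (\<kappa> m)) \<in> hom (?B\<lparr>carrier := M\<rparr>) K"
      using \<kappa> mult \<kappa>_mult by (auto simp: hom_def K.inv_mult_group)
    show "inj_on (\<lambda>m. inv (\<kappa> m)) (carrier (?B\<lparr>carrier := M\<rparr>))"
    proof (rule inj_onI)
      fix m m' assume "m \<in> carrier (?B\<lparr>carrier := M\<rparr>)" "m' \<in> carrier (?B\<lparr>carrier := M\<rparr>)" "inv (\<kappa> m) = inv (\<kappa> m')"
      then have m: "m \<in> M" "m' \<in> M" and e: "inv (\<kappa> m) = inv (\<kappa> m')" by simp_all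
      have "\<kappa> m = inv (inv (\<kappa> m))" using K.inv_inv[OF \<kappa>(1)[OF m(1)]] by (rule sym)
      also have "\<dots> = \<kappa> m'" unfolding e by (rule K.inv_inv[OF \<kappa>(1)[OF m(2)]])
      finally have "\<kappa> m = \<kappa> m'" .
      with \<kappa>(2)[OF m(1)] \<kappa>(2)[OF m(2)] have e0: "m y0 = m' y0" by metis
      show "m = m'"
        by (rule determined[OF M(1)[OF m(1)] M(3)[OF m(1) _ y0] M(1)[OF m(2)] M(3)[OF m(2) _ y0] e0])
    qed
    have "k \<in> (\<lambda>m. inv (\<kappa> m)) ` M" if k: "k \<in> carrier K" for k
    proof -
      obtain m where m: "m \<in> M" "m y0 = a (inv k) y0" using Mtrans[OF y0 a(1)[OF K.inv_closed[OF k] y0]] by blast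
      have "\<kappa> m = inv k"
        by (rule free[OF \<kappa>(1)[OF m(1)] K.inv_closed[OF k] y0]) (use \<kappa>(2)[OF m(1)] m(2) in metis)
      then have "k = inv (\<kappa> m)" using k by simp
      then show ?thesis using m(1) by (rule image_eqI)
    qed
    then show "(\<lambda>m. inv (\<kappa> m)) ` carrier (?B\<lparr>carrier := M\<rparr>) = carrier K" using \<kappa>(1) by auto
  qed
  then show "?B\<lparr>carrier := M\<rparr> \<cong> K" by (rule is_isoI)
qed

section \<open>The (double) polygon surface\<close>

lemma gon_Pi_surface [simp]: "gon (Pi_surface p) = p"
  by (simp add: Pi_surface_def)

lemma faces_Pi_surface: "faces (Pi_surface p) = (if even p then {1} else {1, -1})"
  by (simp add: Pi_surface_def)

lemma gluing_Pi_surface: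
  assumes p: "p \<ge> 3"
  shows "gluing (Pi_surface p)"
proof (cases "even p")
  case True
  have k: "(k + p div 2) mod p \<noteq> k \<and> ((k + p div 2) mod p + p div 2) mod p = k" if "k < p" for k
  proof -
    obtain m where m: "p = 2 * m" using True by blast
    then show ?thesis using that p by (cases "k < m") (auto simp: mod_if)
  qed
  then show ?thesis using True p by (auto simp: gluing_def Pi_surface_def darts_def)
next
  case False
  then show ?thesis using p by (auto simp: gluing_def Pi_surface_def darts_def)
qed

lemma dart_connected_Pi_surface:
  assumes p: "p \<ge> 3"
  shows "dart_connected (Pi_surface p)"
  unfolding dart_connected_def
proof (intro conjI allI impI)
  show "darts (Pi_surface p) \<noteq> {}" using p by (auto simp: darts_def faces_Pi_surface lessThan_empty_iff)
  fix C assume C: "C \<subseteq> darts (Pi_surface p)" "C \<noteq> {}"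
    and cl: "\<forall>s \<in> C. glue (Pi_surface p) s \<in> C \<and> (\<forall>n. turn (gon (Pi_surface p)) n s \<in> C)"
  obtain u k where uk: "(u, k) \<in> C" using C(2) by auto
  have all: "(v, j) \<in> C" if vk: "(v, k) \<in> C" and j: "j < p" for v k j
  proof -
    have "k < p" using C vk by (auto simp: darts_def)
    have "turn p (j + p - k) (v, k) \<in> C" using cl vk by simp
    then show ?thesis using \<open>k < p\<close> j by (simp add: turn_def)
  qed
  have u: "u \<in> faces (Pi_surface p)" using C uk by (auto simp: darts_def)
  have "(v, 0) \<in> C" if v: "v \<in> faces (Pi_surface p)" for v
  proof (cases "v = u")
    case True
    then show ?thesis using all[OF uk] p by simp
  next
    case False
    then have o: "odd p" and v': "v = - u" using u v by (auto simp: faces_Pi_surface split: if_splits)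
    have "(u, 0) \<in> C" using all[OF uk] p by simp
    then have "glue (Pi_surface p) (u, 0) \<in> C" using cl by blast
    then show ?thesis using o v' by (simp add: Pi_surface_def)
  qed
  then have "(v, j) \<in> C" if "v \<in> faces (Pi_surface p)" "j < p" for v j
    using all that by blast
  then show "C = darts (Pi_surface p)" using C(1) by (auto simp: darts_def)
qed

text \<open>The \<open>p\<close>-th power of the left side is 1, that of the right side is
  -1.\<close>

lemma odd_zeta_neg:
  assumes "odd p"
  shows "zeta p ^ m \<noteq> - (zeta p ^ n)"
proof
  have p: "p > 0" using assms by (cases p) auto
  assume "zeta p ^ m = - (zeta p ^ n)"
  then have "(zeta p ^ m) ^ p = (- (zeta p ^ n)) ^ p" by simp
  moreover have "(zeta p ^ j) ^ p = 1" for j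
    using zeta_power_self[OF p] by (metis mult.commute power_mult power_one)
  ultimately show False using assms by (simp add: power_minus_odd)
qed

text \<open>\<open>fst s * zeta p ^ snd s\<close> is the direction of the dart in the plane, up to
  the constant \<open>side_vec p 0\<close>. For odd \<open>p\<close> the sides of \<open>P\<close>
  and \<open>-P\<close>, traversed counterclockwise, have no direction in common, so the direction
  also determines the face.\<close>

lemma Pi_surface_dart_eqI:
  assumes s: "s \<in> darts (Pi_surface p)" and t: "t \<in> darts (Pi_surface p)"
    and e: "fst s * zeta p ^ snd s = fst t * zeta p ^ snd t"
  shows "s = t"
proof -
  have "fst s = fst t"
  proof (cases "even p")
    case True
    then show ?thesis using s t by (auto simp: darts_def faces_Pi_surface)
  next
    case False
    show ?thesis
    proof (rule ccontr)
      assume ne: "fst s \<noteq> fst t"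
      then have "zeta p ^ snd s = - (zeta p ^ snd t)"
        using s t e False by (auto simp: darts_def faces_Pi_surface) (metis minus_minus)
      then show False using odd_zeta_neg[OF False] by blast
    qed
  qed
  moreover have "fst t \<noteq> 0" using t by (auto simp: darts_def faces_Pi_surface split: if_splits)
  ultimately have "zeta p ^ snd s = zeta p ^ snd t" using e by simp
  then have "snd s = snd t" using zeta_power_inj s t by (auto simp: darts_def)
  with \<open>fst s = fst t\<close> show ?thesis by (simp add: prod_eq_iff)
qed

text \<open>In charts the translation is multiplication by \<open>d f / u\<close>. It maps the
  polygon onto itself, so it is a power of \<open>zeta p\<close> and the general construction of
  dart maps applies; the last conclusion is the resulting factorisation of
  \<open>d f\<close>.\<close>

lemma translation_cover_dart_map:
  assumes E: "gluing E" and h: "is_translation_cover E d h" and d: "\<And>f. f \<in> faces E \<Longrightarrow> cmod (d f) = 1"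
  obtains Q where "dart_map E (Pi_surface (gon E)) Q" "induces E (Pi_surface (gon E)) Q h"
    "\<And>f. f \<in> faces E \<Longrightarrow> d f = face_map Q f * rot_of (gon E) Q f"
proof -
  define p where "p = gon E"
  let ?T = "Pi_surface p"
  have p: "p \<ge> 3" "gon E = p" using gluing_gon[OF E] by (simp_all add: p_def)
  note T = gluing_Pi_surface[OF p(1)]
  have ex: "\<exists>u \<in> faces ?T. carries E ?T h f u (\<lambda>x. d f / u * x) \<and>
      orientation_preserving_on (poly_of E) (\<lambda>x. d f / u * x)" if f: "f \<in> faces E" for f
  proof -
    obtain u where u: "u \<in> faces ?T" "(\<lambda>x. d f * x) ` polygon p = (\<lambda>x. u * x) ` polygon p"
      "\<And>x. x \<in> polygon p \<Longrightarrow> h (pt E f x) = pt ?T u (d f * x / u)"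
      using h f p unfolding is_translation_cover_def by metis
    have nu: "cmod u = 1" using u(1) by (auto simp: faces_Pi_surface split: if_splits)
    then have u0: "u \<noteq> 0" by auto
    have n: "cmod (d f / u) = 1" using d[OF f] nu by (simp add: norm_divide)
    have "(\<lambda>x. d f / u * x) ` polygon p = (\<lambda>x. x / u) ` (\<lambda>x. d f * x) ` polygon p"
      by (simp add: image_image)
    also have "\<dots> = polygon p" unfolding u(2) using u0 by (simp add: image_image)
    finally have "(\<lambda>x. d f / u * x) ` polygon p = polygon p" .
    moreover have "dist (d f / u * x) (d f / u * y) = dist x y" for x y
      unfolding dist_norm right_diff_distrib[symmetric] norm_mult n by simp
    ultimately have "carries E ?T h f u (\<lambda>x. d f / u * x)"
      using f u p unfolding carries_def by simp
    moreover have "orientation_preserving_on (poly_of E) (\<lambda>x. d f / u * x)"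
      unfolding orientation_preserving_on_def using n by (intro exI[of _ "d f / u"] exI[of _ 0]) simp
    ultimately show ?thesis using u(1) by blast
  qed
  then obtain Q where Q: "dart_map E ?T Q" "induces E ?T Q h"
    using carries_dart_map[OF E T, of h] p by (metis gon_Pi_surface)
  have "d f = face_map Q f * rot_of p Q f" if f: "f \<in> faces E" for f
  proof -
    obtain u where u: "u \<in> faces ?T" "carries E ?T h f u (\<lambda>x. d f / u * x)"
      "orientation_preserving_on (poly_of E) (\<lambda>x. d f / u * x)" using ex[OF f] by blast
    have "(\<lambda>x. d f / u * x) ` polygon p = polygon p" using u(2) p by (simp add: carries_def)
    then obtain m where m: "m < p" "\<And>x. x \<in> polygon p \<Longrightarrow> d f / u * x = zeta p ^ m * x"
      using orientation_preserving_rotation[OF p(1), of "\<lambda>x. d f / u * x"] u(3) p by auto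
    have "p > 0" using p by simp
    from m(2)[OF polygon_vert[OF this, of 0]] have eq: "d f / u = zeta p ^ m"
      by (simp only: mult_right_cancel[OF vert_nonzero])
    have "(f, 0) \<in> darts E" using f p by (simp add: darts_def)
    then have "Q (f, 0) = (u, (0 + m) mod p)"
      using induces_dart_unique[OF E T Q, of "(f, 0)" u m] u(1,2) m p by (simp add: carries_def)
    then have "face_map Q f = u" "rot_of p Q f = d f / u" using m(1) eq by (simp_all add: face_map_def rot_of_def)
    moreover have "u \<noteq> 0" using u(1) by (auto simp: faces_Pi_surface split: if_splits)
    ultimately show ?thesis by simp
  qed
  with Q p that show thesis by simp
qed

lemma induces_agree:
  assumes "induces S T \<alpha> \<phi>" "induces S T \<beta> \<psi>" "gluing S" "\<And>s. s \<in> darts S \<Longrightarrow> \<alpha> s = \<beta> s" "y \<in> points S"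
  shows "\<phi> y = \<psi> y"
proof -
  obtain f x where f: "f \<in> faces S" "x \<in> poly_of S" "y = pt S f x" using assms(5) by (auto simp: points_eq)
  have "\<alpha> (f, 0) = \<beta> (f, 0)" using assms(4) f gluing_gon[OF assms(3)] by (simp add: darts_def)
  then show ?thesis
    using inducesD[OF assms(1) f(1,2)] inducesD[OF assms(2) f(1,2)] f by (simp add: face_map_def rot_of_def)
qed

lemma induces_dart_eq:
  assumes S: "gluing S" and T: "gluing T" and \<alpha>: "dart_map S T \<alpha>" "induces S T \<alpha> \<phi>"
    and \<beta>: "dart_map S T \<beta>" "induces S T \<beta> \<psi>" and e: "\<And>y. y \<in> points S \<Longrightarrow> \<phi> y = \<psi> y" and s: "s \<in> darts S"
  shows "\<alpha> s = \<beta> s"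
proof -
  obtain f k where fk: "s = (f, k)" "f \<in> faces S" "k < gon S" using s by (auto simp: darts_def)
  have m: "snd (\<beta> (f, 0)) < gon S" using dart_map_rot(2)[OF \<beta>(1) S fk(2), of 0] gluing_gon[OF S] by simp
  have "\<alpha> s = (face_map \<beta> f, (snd s + snd (\<beta> (f, 0))) mod gon S)"
  proof (rule induces_dart_unique[OF S T \<alpha> s face_map_in[OF \<beta>(1) S fk(2)] m])
    fix x assume x: "x \<in> poly_of S"
    show "\<phi> (pt S (fst s) x) = pt T (face_map \<beta> f) (zeta (gon S) ^ snd (\<beta> (f, 0)) * x)"
      using e[OF pt_in_points[OF fk(2) x]] inducesD[OF \<beta>(2) fk(2) x] fk by (simp add: rot_of_def)
  qed
  also have "\<dots> = \<beta> s" using dart_map_apply[OF \<beta>(1) S fk(2,3)] fk(1) by simp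
  finally show ?thesis .
qed

section \<open>Rotations of the unfolding\<close>

text \<open>\<open>P\<close> and \<open>Q\<close> are the dart maps of the unfolding and of the
  translation covering. They are fixed here together with the maps of points, and \<open>d_Q\<close>
  ties \<open>Q\<close> to the global directions.\<close>

locale platonic_unfolding =
  fixes D :: "'f polysurf" and E :: "'g polysurf" and \<pi>D :: "('g \<times> complex) set \<Rightarrow> ('f \<times> complex) set"
    and d :: "'g \<Rightarrow> complex" and h :: "('g \<times> complex) set \<Rightarrow> (complex \<times> complex) set"
    and P :: "'g \<times> nat \<Rightarrow> 'f \<times> nat" and Q :: "'g \<times> nat \<Rightarrow> complex \<times> nat"
  assumes platonic: "platonic_surface D" and cover: "is_unfolding D E \<pi>D"
    and d_glue: "\<And>f k g l. f \<in> faces E \<Longrightarrow> k < gon E \<Longrightarrow> glue E (f, k) = (g, l) \<Longrightarrow>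
        d g * side_vec (gon E) l = - (d f * side_vec (gon E) k)"
    and P: "dart_map E D P" "induces E D P \<pi>D"
    and Q: "dart_map E (Pi_surface (gon E)) Q" "induces E (Pi_surface (gon E)) Q h"
    and d_Q: "\<And>f. f \<in> faces E \<Longrightarrow> d f = face_map Q f * rot_of (gon E) Q f"
begin

section \<open>Directions of the darts of the unfolding\<close>

abbreviation p where "p \<equiv> gon E"
abbreviation target where "target \<equiv> Pi_surface (gon E)"

text \<open>Side \<open>k\<close> of the face \<open>f\<close> points along
  \<open>d f * side_vec p k\<close>; the factor \<open>side_vec p 0\<close>, common to all darts, is
  dropped.\<close>

definition dir :: "'g \<times> nat \<Rightarrow> complex" where
  "dir s = d (fst s) * zeta p ^ snd s"

lemma conE: "connected_surface E" and conD: "connected_surface D"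
  using cover platonic by (simp_all add: is_unfolding_def platonic_surface_def)

lemma E: "gluing E" and D: "gluing D"
  using conE conD by (simp_all add: connected_surface_gluing)

lemma p3: "p \<ge> 3"
  using E by (rule gluing_gon)

lemma target: "gluing target"
  using p3 by (rule gluing_Pi_surface)

lemma gonD: "gon D = p"
  using dart_mapD(1)[OF P(1)] .

lemma dartsE_ne: "darts E \<noteq> {}"
  using connected_surface_darts[OF conE] by (simp add: dart_connected_def)

lemma glue_in_darts: "s \<in> darts E \<Longrightarrow> glue E s \<in> darts E"
  using E by (auto simp: gluing_def)

lemma turn_in_darts: "s \<in> darts E \<Longrightarrow> turn p n s \<in> darts E"
  using p3 by (auto simp: darts_def turn_def)

lemma face_Q: "f \<in> faces E \<Longrightarrow> cmod (face_map Q f) = 1"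
  using face_map_in[OF Q(1) E, of f] by (auto simp: faces_Pi_surface split: if_splits)

lemma d_nonzero: "f \<in> faces E \<Longrightarrow> d f \<noteq> 0"
  using d_Q[of f] face_Q[of f] by auto

lemma dir_nonzero: "s \<in> darts E \<Longrightarrow> dir s \<noteq> 0"
  using d_nonzero by (auto simp: dir_def darts_def)

lemma dir_turn: "dir (turn p n s) = zeta p ^ n * dir s"
  using p3 by (simp add: dir_def turn_def zeta_power_mod power_add)

lemma dir_glue:
  assumes "s \<in> darts E"
  shows "dir (glue E s) = - dir s"
proof -
  obtain f k g l where fk: "s = (f, k)" "f \<in> faces E" "k < p" and gl: "glue E (f, k) = (g, l)"
    using assms by (metis SigmaE darts_def lessThan_iff prod.collapse)
  have "d g * side_vec p l = - (d f * side_vec p k)" using d_glue[OF fk(2,3) gl] .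
  then have "(d g * zeta p ^ l) * side_vec p 0 = - (d f * zeta p ^ k) * side_vec p 0"
    unfolding side_vec_eq[of p l] side_vec_eq[of p k] by (simp add: mult.assoc)
  then have "d g * zeta p ^ l = - (d f * zeta p ^ k)"
    using side_vec_nonzero[OF p3, of 0] by (metis mult_right_cancel)
  then show ?thesis using fk gl by (simp add: dir_def)
qed

lemma dir_Q:
  assumes "s \<in> darts E"
  shows "dir s = fst (Q s) * zeta p ^ snd (Q s)"
proof -
  have f: "fst s \<in> faces E" "snd s < p" using assms by (auto simp: darts_def)
  show ?thesis
    using dart_map_rot(1,3)[OF Q(1) E f] d_Q[OF f(1)] by (simp add: dir_def)
qed

lemma Q_eq_iff: "s \<in> darts E \<Longrightarrow> t \<in> darts E \<Longrightarrow> Q s = Q t \<longleftrightarrow> dir s = dir t"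
  using Pi_surface_dart_eqI[of "Q s" p "Q t"] dart_mapD(2)[OF Q(1)] dir_Q by metis

text \<open>This is where holonomy enters. The quotient of the two equations no longer contains the
  indices and says that the global direction has the same expression in the chart of the common
  image face; by the kernel property of the unfolding the faces coincide.\<close>

lemma dart_unique:
  assumes s: "s \<in> darts E" and t: "t \<in> darts E" and e: "P s = P t" "dir s = dir t"
  shows "s = t"
proof -
  obtain f k f' k' where f: "s = (f, k)" "f \<in> faces E" "k < p" and f': "t = (f', k')" "f' \<in> faces E" "k' < p"
    using s t by (auto simp: darts_def)
  have F: "face_map P f = face_map P f'"
    using dart_map_rot(1)[OF P(1) E f(2,3)] dart_map_rot(1)[OF P(1) E f'(2,3)] e f f' by simp
  have a: "rot_of p P f * zeta p ^ k = rot_of p P f' * zeta p ^ k'"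
    using dart_map_rot(3)[OF P(1) E f(2,3)] dart_map_rot(3)[OF P(1) E f'(2,3)] e f f' by simp
  have b: "d f * zeta p ^ k = d f' * zeta p ^ k'" using e f f' by (simp add: dir_def)
  have nz: "d f \<noteq> 0" "d f' \<noteq> 0" using d_nonzero f f' by auto
  have "(rot_of p P f * zeta p ^ k) / (d f * zeta p ^ k) = (rot_of p P f' * zeta p ^ k') / (d f' * zeta p ^ k')"
    unfolding a b ..
  then have r: "rot_of p P f / d f = rot_of p P f' / d f'" by simp
  have "f = f'"
    by (rule unfolding_face_unique[OF cover D P(2,1) d_nonzero d_glue f(2) f'(2) F r])
  then have "zeta p ^ k = zeta p ^ k'" using b nz by simp
  then show ?thesis using zeta_power_inj f f' \<open>f = f'\<close> by simp
qed

section \<open>Lifting and projecting automorphisms\<close>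

lemma P_surj: "P ` darts E = darts D"
  using dart_map_surj[OF P(1) E D dartsE_ne connected_surface_darts[OF conD]] .

text \<open>\<open>\<beta>\<close> is a rotation of \<open>D\<close> matching the images of
  \<open>s\<close> and \<open>t\<close>. The lift is built as the relation \<open>R\<close>: the
  factor \<open>dir t / dir s\<close> is what makes \<open>t\<close> related to \<open>s\<close>,
  and it commutes with the changes of direction under gluing and turning. Injectivity is again the
  uniqueness of darts.\<close>

lemma auto_exists:
  assumes s: "s \<in> darts E" and t: "t \<in> darts E"
  obtains \<alpha> \<beta> where "dart_auto E \<alpha>" "\<alpha> s = t" "dart_auto D \<beta>" "\<And>r. r \<in> darts E \<Longrightarrow> P (\<alpha> r) = \<beta> (P r)"
    "\<And>r. r \<in> darts E \<Longrightarrow> dir (\<alpha> r) = dir t / dir s * dir r"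
proof -
  obtain \<beta> where \<beta>: "dart_auto D \<beta>" "\<beta> (P s) = P t"
    using platonic_dart_transitive[OF platonic] dart_mapD(2)[OF P(1)] s t by metis
  then have \<beta>': "dart_map D D \<beta>" "inj_on \<beta> (darts D)" by (auto simp: dart_auto_def bij_betw_def)
  define R where "R r r' \<longleftrightarrow> r' \<in> darts E \<and> P r' = \<beta> (P r) \<and> dir r' = dir t / dir s * dir r" for r r'
  have Rg: "R (glue E r) (glue E r')" if "r \<in> darts E" "R r r'" for r r'
    using that glue_in_darts dir_glue dart_mapD(2,3)[OF P(1)] dart_mapD(3)[OF \<beta>'(1)] by (simp add: R_def)
  have Rt: "R (turn p n r) (turn p n r')" if "r \<in> darts E" "R r r'" for r r' n
    using that turn_in_darts dir_turn dart_mapD(2,4)[OF P(1)] dart_mapD(4)[OF \<beta>'(1)] gonD by (simp add: R_def)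
  have ex: "\<exists>r'. R r r'" if r: "r \<in> darts E" for r
  proof (rule dart_connectedD[where P="\<lambda>r. \<exists>r'. R r r'", OF connected_surface_darts[OF conE] s _ r _ _ E])
    show "\<exists>r'. R s r'" using t \<beta>(2) dir_nonzero[OF s] by (intro exI[of _ t]) (simp add: R_def)
  qed (use Rg Rt in blast)+
  have uniq: "r' = r''" if "R r r'" "R r r''" for r r' r'' using that dart_unique by (simp add: R_def)
  define \<alpha> where "\<alpha> r = (SOME r'. R r r')" for r
  have \<alpha>R: "R r (\<alpha> r)" if "r \<in> darts E" for r unfolding \<alpha>_def using ex[OF that] by (rule someI_ex)
  have \<alpha>: "dart_map E E \<alpha>"
    unfolding dart_map_def
  proof (intro conjI ballI allI refl)
    fix r n assume r: "r \<in> darts E"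
    show "\<alpha> r \<in> darts E" using \<alpha>R[OF r] by (simp add: R_def)
    show "\<alpha> (glue E r) = glue E (\<alpha> r)" using uniq[OF \<alpha>R[OF glue_in_darts[OF r]] Rg[OF r \<alpha>R[OF r]]] .
    show "\<alpha> (turn p n r) = turn p n (\<alpha> r)" using uniq[OF \<alpha>R[OF turn_in_darts[OF r]] Rt[OF r \<alpha>R[OF r]]] .
  qed
  have "inj_on \<alpha> (darts E)"
  proof (rule inj_onI)
    fix r r' assume r: "r \<in> darts E" "r' \<in> darts E" and e: "\<alpha> r = \<alpha> r'"
    have "\<beta> (P r) = \<beta> (P r')" "dir t / dir s * dir r = dir t / dir s * dir r'"
      using \<alpha>R[OF r(1)] \<alpha>R[OF r(2)] e by (simp_all add: R_def)
    then have "P r = P r'" "dir r = dir r'"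
      using inj_onD[OF \<beta>'(2)] dart_mapD(2)[OF P(1)] r dir_nonzero[OF s] dir_nonzero[OF t] by auto
    then show "r = r'" using dart_unique[OF r] by blast
  qed
  then have "dart_auto E \<alpha>"
    using \<alpha> dart_map_surj[OF \<alpha> E E dartsE_ne connected_surface_darts[OF conE]] by (simp add: dart_auto_def bij_betw_def)
  moreover have "\<alpha> s = t" using uniq[OF \<alpha>R[OF s], of t] t \<beta>(2) dir_nonzero[OF s] by (simp add: R_def)
  ultimately show thesis using that[of \<alpha> \<beta>] \<beta>(1) \<alpha>R by (simp add: R_def)
qed

text \<open>By rigidity an automorphism is the one constructed above for its value at a single dart,
  so it inherits the projection and the constant multiplier.\<close>

lemma auto_projects:
  assumes \<alpha>: "dart_auto E \<alpha>" and s: "s \<in> darts E"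
  obtains \<beta> where "dart_auto D \<beta>" "\<And>r. r \<in> darts E \<Longrightarrow> P (\<alpha> r) = \<beta> (P r)"
    "\<And>r. r \<in> darts E \<Longrightarrow> dir (\<alpha> r) = dir (\<alpha> s) / dir s * dir r"
proof -
  have m: "dart_map E E \<alpha>" using \<alpha> by (simp add: dart_auto_def)
  obtain \<alpha>' \<beta> where *: "dart_auto E \<alpha>'" "\<alpha>' s = \<alpha> s" "dart_auto D \<beta>" "\<And>r. r \<in> darts E \<Longrightarrow> P (\<alpha>' r) = \<beta> (P r)"
    "\<And>r. r \<in> darts E \<Longrightarrow> dir (\<alpha>' r) = dir (\<alpha> s) / dir s * dir r"
    using auto_exists[OF s dart_mapD(2)[OF m s]] by metis
  have m': "dart_map E E \<alpha>'" using *(1) by (simp add: dart_auto_def)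
  have "\<alpha>' r = \<alpha> r" if "r \<in> darts E" for r
    by (rule dart_map_eqI[OF connected_surface_darts[OF conE] E m' m s *(2) that])
  then show thesis using that[OF *(3)] *(4,5) by simp
qed

section \<open>The character on the rotations of the unfolding\<close>

definition base :: "'g \<times> nat" where
  "base = (SOME s. s \<in> darts E)"

lemma base: "base \<in> darts E"
  unfolding base_def using dartsE_ne by (simp add: some_in_eq)

definition dart_action :: "(('g \<times> complex) set \<Rightarrow> ('g \<times> complex) set) \<Rightarrow> 'g \<times> nat \<Rightarrow> 'g \<times> nat" where
  "dart_action \<phi> = (SOME \<alpha>. dart_auto E \<alpha> \<and> induces E E \<alpha> \<phi>)"

text \<open>The value at \<open>base\<close> stands for all darts, because an automorphism
  multiplies every direction by the same factor.\<close>

definition turning :: "(('g \<times> complex) set \<Rightarrow> ('g \<times> complex) set) \<Rightarrow> complex" where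
  "turning \<phi> = dir (dart_action \<phi> base) / dir base"

lemma dart_action:
  assumes "\<phi> \<in> Rot_set E"
  shows "dart_auto E (dart_action \<phi>)" "induces E E (dart_action \<phi>) \<phi>"
    "dart_map E E (dart_action \<phi>)"
proof -
  have "\<exists>\<alpha>. dart_auto E \<alpha> \<and> induces E E \<alpha> \<phi>" using assms Rot_set_iff[OF conE] by blast
  then have "dart_auto E (dart_action \<phi>) \<and> induces E E (dart_action \<phi>) \<phi>"
    unfolding dart_action_def by (rule someI_ex)
  then show "dart_auto E (dart_action \<phi>)" "induces E E (dart_action \<phi>) \<phi>" "dart_map E E (dart_action \<phi>)"
    by (auto simp: dart_auto_def)
qed

lemma dart_action_unique:
  assumes "\<phi> \<in> Rot_set E" "dart_map E E \<alpha>" "induces E E \<alpha> \<phi>" "s \<in> darts E"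
  shows "dart_action \<phi> s = \<alpha> s"
  using induces_dart_eq[OF E E dart_action(3,2)[OF assms(1)] assms(2,3) refl assms(4)] .

lemma dir_action:
  assumes "\<phi> \<in> Rot_set E" "s \<in> darts E"
  shows "dir (dart_action \<phi> s) = turning \<phi> * dir s"
  using auto_projects[OF dart_action(1)[OF assms(1)] base] assms(2) unfolding turning_def by metis

lemma turning_nonzero: "\<phi> \<in> Rot_set E \<Longrightarrow> turning \<phi> \<noteq> 0"
  using dir_nonzero[OF base] dir_nonzero[OF dart_mapD(2)[OF dart_action(3) base]] by (simp add: turning_def)

lemma turning_mult:
  assumes "\<phi> \<in> Rot_set E" "\<psi> \<in> Rot_set E"
  shows "turning (\<phi> \<otimes>\<^bsub>Rot E\<^esub> \<psi>) = turning \<phi> * turning \<psi>"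
proof -
  note a = dart_action[OF assms(1)] and b = dart_action[OF assms(2)]
  have "induces E E (dart_action \<phi> \<circ> dart_action \<psi>) (\<phi> \<circ> \<psi>)"
    using induces_compose[OF b(2) a(2) b(3) a(3) E E] .
  then have i: "induces E E (dart_action \<phi> \<circ> dart_action \<psi>) (compose (points E) \<phi> \<psi>)"
    by (rule induces_cong[OF _ E]) (simp_all add: compose_def)
  have "dart_action (compose (points E) \<phi> \<psi>) base = dart_action \<phi> (dart_action \<psi> base)"
    using dart_action_unique[OF compose_in_Rot[OF conE assms] dart_map_compose[OF b(3) a(3)] i base] by simp
  then have "turning (compose (points E) \<phi> \<psi>) * dir base = turning \<phi> * turning \<psi> * dir base"
    using dir_action[OF compose_in_Rot[OF conE assms] base] dir_action[OF assms(1) dart_mapD(2)[OF b(3) base]]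
      dir_action[OF assms(2) base] by (metis mult.assoc)
  then show ?thesis using dir_nonzero[OF base] Rot_mult[OF assms] by simp
qed

lemma Rot_moves:
  assumes s: "s \<in> darts E" and t: "t \<in> darts E"
  obtains \<phi> where "\<phi> \<in> Rot_set E" "dart_action \<phi> s = t" "turning \<phi> = dir t / dir s"
proof -
  obtain \<alpha> where \<alpha>: "dart_auto E \<alpha>" "\<alpha> s = t" using auto_exists[OF s t] by metis
  obtain \<phi> where \<phi>: "\<phi> \<in> Rot_set E" "induces E E \<alpha> \<phi>" using Rot_from_auto[OF conE \<alpha>(1)] .
  have a: "dart_action \<phi> s = t"
    using dart_action_unique[OF \<phi>(1) _ \<phi>(2) s] \<alpha> by (simp add: dart_auto_def)
  moreover have "turning \<phi> = dir t / dir s"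
    using dir_action[OF \<phi>(1) s] dir_nonzero[OF s] a by (simp add: field_simps)
  ultimately show thesis using that \<phi>(1) by blast
qed

section \<open>Rotations of the unfolding descend to the original surface\<close>

lemma \<pi>D_surj:
  assumes "y \<in> points D"
  obtains z where "z \<in> points E" "\<pi>D z = y"
  using induces_surj[OF P(2,1) E D dartsE_ne connected_surface_darts[OF conD] assms] by blast

lemma \<pi>D_points: "z \<in> points E \<Longrightarrow> \<pi>D z \<in> points D"
  using induces_points[OF P(2,1) E] .

definition descend :: "(('g \<times> complex) set \<Rightarrow> ('g \<times> complex) set) \<Rightarrow> (('f \<times> complex) set \<Rightarrow> ('f \<times> complex) set)" where
  "descend \<phi> = (SOME \<psi>. \<psi> \<in> Rot_set D \<and> (\<forall>z \<in> points E. \<psi> (\<pi>D z) = \<pi>D (\<phi> z)))"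

text \<open>Both composites from \<open>E\<close> to \<open>D\<close> are induced by dart maps, and
  a dart map and the point map it induces determine each other.\<close>

lemma descend_eq_iff_darts:
  assumes \<phi>: "\<phi> \<in> Rot_set E" and \<psi>: "induces D D \<beta> \<psi>" "dart_map D D \<beta>"
  shows "(\<forall>z \<in> points E. \<psi> (\<pi>D z) = \<pi>D (\<phi> z)) \<longleftrightarrow> (\<forall>r \<in> darts E. P (dart_action \<phi> r) = \<beta> (P r))"
proof -
  note a = dart_action[OF \<phi>]
  have 1: "induces E D (P \<circ> dart_action \<phi>) (\<pi>D \<circ> \<phi>)" "dart_map E D (P \<circ> dart_action \<phi>)"
    using induces_compose[OF a(2) P(2) a(3) P(1) E E] dart_map_compose[OF a(3) P(1)] .
  have 2: "induces E D (\<beta> \<circ> P) (\<psi> \<circ> \<pi>D)" "dart_map E D (\<beta> \<circ> P)"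
    using induces_compose[OF P(2) \<psi>(1) P(1) \<psi>(2) E D] dart_map_compose[OF P(1) \<psi>(2)] .
  show ?thesis
    using induces_agree[OF 2(1) 1(1) E] induces_dart_eq[OF E D 1(2,1) 2(2,1)] by auto
qed

lemma descend:
  assumes \<phi>: "\<phi> \<in> Rot_set E"
  shows "descend \<phi> \<in> Rot_set D" "z \<in> points E \<Longrightarrow> descend \<phi> (\<pi>D z) = \<pi>D (\<phi> z)"
proof -
  obtain \<beta> where \<beta>: "dart_auto D \<beta>" "\<And>r. r \<in> darts E \<Longrightarrow> P (dart_action \<phi> r) = \<beta> (P r)"
    using auto_projects[OF dart_action(1)[OF \<phi>] base] by metis
  obtain \<psi> where \<psi>: "\<psi> \<in> Rot_set D" "induces D D \<beta> \<psi>" using Rot_from_auto[OF conD \<beta>(1)] .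
  have "\<forall>z \<in> points E. \<psi> (\<pi>D z) = \<pi>D (\<phi> z)"
    using descend_eq_iff_darts[OF \<phi> \<psi>(2)] \<beta> by (simp add: dart_auto_def)
  then have "\<exists>\<psi>. \<psi> \<in> Rot_set D \<and> (\<forall>z \<in> points E. \<psi> (\<pi>D z) = \<pi>D (\<phi> z))" using \<psi>(1) by blast
  then have "descend \<phi> \<in> Rot_set D \<and> (\<forall>z \<in> points E. descend \<phi> (\<pi>D z) = \<pi>D (\<phi> z))"
    unfolding descend_def by (rule someI_ex)
  then show "descend \<phi> \<in> Rot_set D" "z \<in> points E \<Longrightarrow> descend \<phi> (\<pi>D z) = \<pi>D (\<phi> z)" by auto
qed

lemma descend_unique:
  assumes \<phi>: "\<phi> \<in> Rot_set E" and \<psi>: "\<psi> \<in> Rot_set D" "\<And>z. z \<in> points E \<Longrightarrow> \<psi> (\<pi>D z) = \<pi>D (\<phi> z)"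
  shows "descend \<phi> = \<psi>"
proof (rule extensionalityI[OF Rot_set_ext[OF descend(1)[OF \<phi>]] Rot_set_ext[OF \<psi>(1)]])
  fix y assume "y \<in> points D"
  then obtain z where "z \<in> points E" "\<pi>D z = y" by (rule \<pi>D_surj)
  then show "descend \<phi> y = \<psi> y" using descend(2)[OF \<phi>] \<psi>(2) by metis
qed

lemma descend_hom: "descend \<in> hom (Rot E) (Rot D)"
proof (rule homI)
  show "descend \<phi> \<in> carrier (Rot D)" if "\<phi> \<in> carrier (Rot E)" for \<phi> using descend(1) that by simp
  fix \<phi> \<psi> assume "\<phi> \<in> carrier (Rot E)" "\<psi> \<in> carrier (Rot E)"
  then have R: "\<phi> \<in> Rot_set E" "\<psi> \<in> Rot_set E" by simp_all
  have "descend (compose (points E) \<phi> \<psi>) = compose (points D) (descend \<phi>) (descend \<psi>)"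
  proof (rule descend_unique[OF compose_in_Rot[OF conE R] compose_in_Rot[OF conD descend(1)[OF R(1)] descend(1)[OF R(2)]]])
    fix z assume z: "z \<in> points E"
    show "compose (points D) (descend \<phi>) (descend \<psi>) (\<pi>D z) = \<pi>D (compose (points E) \<phi> \<psi> z)"
      using z \<pi>D_points[OF z] descend(2)[OF R(2) z] descend(2)[OF R(1) Rot_set_points[OF R(2) z]]
      by (simp add: compose_def)
  qed
  then show "descend (\<phi> \<otimes>\<^bsub>Rot E\<^esub> \<psi>) = descend \<phi> \<otimes>\<^bsub>Rot D\<^esub> descend \<psi>"
    using Rot_mult[OF R] Rot_mult[OF descend(1)[OF R(1)] descend(1)[OF R(2)]] by simp
qed

text \<open>Some dart lies over the image of \<open>P base\<close> under the given rotation, and a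
  rotation of \<open>E\<close> moves \<open>base\<close> there. The two resulting dart maps from
  \<open>E\<close> to \<open>D\<close> agree at \<open>base\<close>, hence everywhere.\<close>

lemma descend_surj: "descend ` carrier (Rot E) = carrier (Rot D)"
proof
  show "descend ` carrier (Rot E) \<subseteq> carrier (Rot D)" using descend(1) by auto
  show "carrier (Rot D) \<subseteq> descend ` carrier (Rot E)"
  proof
    fix \<psi> assume "\<psi> \<in> carrier (Rot D)"
    then have \<psi>: "\<psi> \<in> Rot_set D" by simp
    then obtain \<beta> where \<beta>: "dart_auto D \<beta>" "induces D D \<beta> \<psi>" using Rot_set_iff[OF conD] by blast
    then have \<beta>m: "dart_map D D \<beta>" by (simp add: dart_auto_def)
    have "\<beta> (P base) \<in> darts D" using dart_mapD(2)[OF \<beta>m] dart_mapD(2)[OF P(1) base] by blast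
    then obtain t where t: "t \<in> darts E" "P t = \<beta> (P base)" using P_surj by (metis imageE)
    obtain \<phi> where \<phi>: "\<phi> \<in> Rot_set E" "dart_action \<phi> base = t" using Rot_moves[OF base t(1)] by metis
    have m: "dart_map E D (P \<circ> dart_action \<phi>)" "dart_map E D (\<beta> \<circ> P)"
      using dart_map_compose[OF dart_action(3)[OF \<phi>(1)] P(1)] dart_map_compose[OF P(1) \<beta>m] .
    have e: "(P \<circ> dart_action \<phi>) base = (\<beta> \<circ> P) base" using \<phi>(2) t(2) by simp
    have "P (dart_action \<phi> r) = \<beta> (P r)" if "r \<in> darts E" for r
      using dart_map_eqI[OF connected_surface_darts[OF conE] E m base e that] by simp
    then have "descend \<phi> = \<psi>"
      using descend_unique[OF \<phi>(1) \<psi>] descend_eq_iff_darts[OF \<phi>(1) \<beta>(2) \<beta>m] by simp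
    then show "\<psi> \<in> descend ` carrier (Rot E)" using \<phi>(1) by auto
  qed
qed

text \<open>With multiplier 1 the directions are kept, so the images of a dart under two such
  rotations have the same direction; having also the same image in \<open>D\<close>, they are
  equal.\<close>

lemma descend_inj: "inj_on descend {\<phi> \<in> carrier (Rot E). turning \<phi> = 1}"
proof (rule inj_onI)
  fix \<phi> \<psi> assume "\<phi> \<in> {\<phi> \<in> carrier (Rot E). turning \<phi> = 1}" "\<psi> \<in> {\<phi> \<in> carrier (Rot E). turning \<phi> = 1}"
    and e: "descend \<phi> = descend \<psi>"
  then have R: "\<phi> \<in> Rot_set E" "\<psi> \<in> Rot_set E" and t: "turning \<phi> = 1" "turning \<psi> = 1" by auto
  note a = dart_action[OF R(1)] and b = dart_action[OF R(2)]
  have "(\<pi>D \<circ> \<phi>) z = (\<pi>D \<circ> \<psi>) z" if "z \<in> points E" for z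
    using descend(2)[OF R(1) that] descend(2)[OF R(2) that] e by simp
  then have "(P \<circ> dart_action \<phi>) r = (P \<circ> dart_action \<psi>) r" if "r \<in> darts E" for r
    using induces_dart_eq[OF E D dart_map_compose[OF a(3) P(1)] induces_compose[OF a(2) P(2) a(3) P(1) E E]
        dart_map_compose[OF b(3) P(1)] induces_compose[OF b(2) P(2) b(3) P(1) E E] _ that] by blast
  then have "dart_action \<phi> r = dart_action \<psi> r" if "r \<in> darts E" for r
    using dart_unique[OF dart_mapD(2)[OF a(3) that] dart_mapD(2)[OF b(3) that]] that
      dir_action[OF R(1) that] dir_action[OF R(2) that] t by simp
  then show "\<phi> = \<psi>"
    using induces_agree[OF a(2) b(2) E] by (intro extensionalityI[OF Rot_set_ext[OF R(1)] Rot_set_ext[OF R(2)]]) blast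
qed

text \<open>The group of all directions is generated by \<open>\<omega>\<close>, a primitive root of unity of order \<open>p\<close> for even
  \<open>p\<close> and \<open>2p\<close> for odd \<open>p\<close>.\<close>

lemma turning_generator:
  obtains \<phi>0 where "\<phi>0 \<in> Rot_set E" "\<And>\<phi>. \<phi> \<in> Rot_set E \<Longrightarrow> \<exists>n::nat. turning \<phi> = turning \<phi>0 ^ n"
proof -
  define \<omega> where "\<omega> = (if even p then zeta p else zeta (2 * p))"
  have z2: "zeta (2 * p) ^ 2 = zeta p" "zeta (2 * p) ^ p = -1"
    using p3 unfolding zeta_power by (simp_all add: zeta_def field_simps)
  have half: "zeta p ^ (p div 2) = -1" if ev: "even p"
  proof -
    obtain m where "p = 2 * m" using ev by blast
    then show ?thesis using p3 unfolding zeta_power by (simp add: field_simps)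
  qed
  \<comment> \<open>Turning contributes powers of \<open>zeta p\<close> and gluing contributes -1.
    Once both are powers of \<open>\<omega>\<close>, every direction is a power of
    \<open>\<omega>\<close> times that of \<open>base\<close>.\<close>
  obtain a b where ab: "zeta p = \<omega> ^ a" "-1 = \<omega> ^ b"
  proof (cases "even p")
    case True
    then show thesis using that[of 1 "p div 2"] half by (simp add: \<omega>_def)
  next
    case False
    then show thesis using that[of 2 p] z2 by (simp add: \<omega>_def)
  qed
  have pow: "\<exists>n::nat. dir s = \<omega> ^ n * dir base" if s: "s \<in> darts E" for s
  proof (rule dart_connectedD[where P="\<lambda>s. \<exists>n::nat. dir s = \<omega> ^ n * dir base",
        OF connected_surface_darts[OF conE] base _ s _ _ E])
    show "\<exists>n::nat. dir base = \<omega> ^ n * dir base" by (rule exI[of _ 0]) simp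
    fix s assume s: "s \<in> darts E" and "\<exists>n::nat. dir s = \<omega> ^ n * dir base"
    then obtain m :: nat where m: "dir s = \<omega> ^ m * dir base" by blast
    show "\<exists>n::nat. dir (glue E s) = \<omega> ^ n * dir base"
      using dir_glue[OF s] m ab(2) by (intro exI[of _ "b + m"]) (simp add: power_add flip: ab(2))
    show "\<exists>j::nat. dir (turn p n s) = \<omega> ^ j * dir base" for n
      using dir_turn[of n s] m ab(1) by (intro exI[of _ "a * n + m"]) (simp add: power_add power_mult)
  qed
  have "\<exists>t \<in> darts E. dir t = \<omega> * dir base"
  proof (cases "even p")
    case True
    then show ?thesis using turn_in_darts[OF base, of 1] dir_turn[of 1 base] by (intro bexI[of _ "turn p 1 base"]) (simp_all add: \<omega>_def)
  next
    case False
    then obtain m where m: "p = 2 * m + 1" by (elim oddE)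
    \<comment> \<open>For odd \<open>p\<close>, \<open>\<omega>\<close> itself is not a power of
      \<open>zeta p\<close>, but its negative is; the sign is supplied by one gluing.\<close>
    have "zeta p ^ (m + 1) = zeta (2 * p) ^ (p + 1)"
      unfolding z2(1)[symmetric] power_mult[symmetric] using m by (simp add: mult_2)
    also have "\<dots> = - \<omega>" using z2(2) False by (simp add: \<omega>_def)
    finally have "zeta p ^ (m + 1) = - \<omega>" .
    then have "dir (turn p (m + 1) (glue E base)) = \<omega> * dir base"
      using dir_turn[of "m + 1" "glue E base"] dir_glue[OF base] by simp
    then show ?thesis using turn_in_darts[OF glue_in_darts[OF base]] by blast
  qed
  then obtain t where t: "t \<in> darts E" "dir t = \<omega> * dir base" by blast
  obtain \<phi>0 where \<phi>0: "\<phi>0 \<in> Rot_set E" "turning \<phi>0 = dir t / dir base" using Rot_moves[OF base t(1)] by metis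
  have "turning \<phi>0 = \<omega>" using \<phi>0 t dir_nonzero[OF base] by simp
  moreover have "\<exists>n::nat. turning \<phi> = \<omega> ^ n" if \<phi>: "\<phi> \<in> Rot_set E" for \<phi>
  proof -
    obtain n :: nat where "dir (dart_action \<phi> base) = \<omega> ^ n * dir base"
      using pow[OF dart_mapD(2)[OF dart_action(3)[OF \<phi>] base]] by blast
    then show ?thesis using dir_nonzero[OF base] by (intro exI[of _ n]) (simp add: turning_def)
  qed
  ultimately show thesis using that \<phi>0(1) by simp
qed

section \<open>Action on the fibres of the translation covering\<close>

lemma turning_1_iff:
  assumes \<phi>: "\<phi> \<in> Rot_set E"
  shows "turning \<phi> = 1 \<longleftrightarrow> (\<forall>y \<in> points E. h (\<phi> y) = h y)"
proof -
  note a = dart_action[OF \<phi>]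
  have i: "induces E target (Q \<circ> dart_action \<phi>) (h \<circ> \<phi>)" and m: "dart_map E target (Q \<circ> dart_action \<phi>)"
    using induces_compose[OF a(2) Q(2) a(3) Q(1) E E] dart_map_compose[OF a(3) Q(1)] .
  show ?thesis
  proof
    assume "turning \<phi> = 1"
    then have "(Q \<circ> dart_action \<phi>) s = Q s" if "s \<in> darts E" for s
      using dir_action[OF \<phi> that] Q_eq_iff[OF dart_mapD(2)[OF a(3) that] that] by simp
    then show "\<forall>y \<in> points E. h (\<phi> y) = h y"
      using induces_agree[OF i Q(2) E] by simp
  next
    assume "\<forall>y \<in> points E. h (\<phi> y) = h y"
    then have "Q (dart_action \<phi> base) = Q base"
      using induces_dart_eq[OF E target m i Q(1,2) _ base] by simp
    then have "dir (dart_action \<phi> base) = dir base"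
      using Q_eq_iff[OF dart_mapD(2)[OF a(3) base] base] by simp
    then show "turning \<phi> = 1" using dir_nonzero[OF base] by (simp add: turning_def)
  qed
qed

text \<open>A representative of \<open>y\<close> and one of \<open>z\<close> can be chosen with the
  same image in the target, by lifting a gluing chain. In their faces there are darts with the same
  image under \<open>Q\<close>, hence with the same direction; the rotation between them has
  multiplier 1 and matches the representatives. Vertices are included.\<close>

lemma fibre_transitive:
  assumes y: "y \<in> points E" and z: "z \<in> points E" and e: "h y = h z"
  obtains \<phi> where "\<phi> \<in> Rot_set E" "turning \<phi> = 1" "\<phi> y = z"
proof -
  obtain f x where f: "f \<in> faces E" "x \<in> poly_of E" "y = pt E f x" using y by (auto simp: points_eq)
  have c: "(f, x) \<in> cells E" using f by (simp add: cells_def)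
  have "face_map Q f \<in> faces target" "rot_of p Q f * x \<in> poly_of target"
    using act_in_cells[OF Q(1) E c] by (simp_all add: act_def cells_def)
  then have "(face_map Q f, rot_of p Q f * x) \<in> pt target (face_map Q f) (rot_of p Q f * x)"
    using pt_eq[OF target] by blast
  then have "(face_map Q f, rot_of p Q f * x) \<in> h z"
    using inducesD[OF Q(2) f(1,2)] e f(3) by simp
  then obtain f' x' where f': "(f', x') \<in> z" "f' \<in> faces E" "x' \<in> poly_of E" "face_map Q f' = face_map Q f"
      "rot_of p Q f' * x' = rot_of p Q f * x"
    by (rule induces_lift[OF Q(2,1) E target z])
  have zf: "z = pt E f' x'"
  proof -
    obtain g w where g: "g \<in> faces E" "w \<in> poly_of E" "z = pt E g w" using z by (auto simp: points_eq)
    then show ?thesis using f'(1) in_pt_iff[OF E g(1,2), of f' x'] by simp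
  qed
  have s: "(f, 0) \<in> darts E" using f p3 by (simp add: darts_def)
  have m: "snd (Q (f, 0)) < p" using dart_map_rot(2)[OF Q(1) E f(1), of 0] p3 by simp
  obtain k where k: "k < p" "Q (f', k) = (face_map Q f', snd (Q (f, 0)))"
    using dart_map_index[OF Q(1) E f'(2) m] .
  have t: "(f', k) \<in> darts E" using f' k by (simp add: darts_def)
  have Qst: "Q (f, 0) = Q (f', k)" using k f'(4) by (simp add: face_map_def prod_eq_iff)
  obtain \<phi> where \<phi>: "\<phi> \<in> Rot_set E" "dart_action \<phi> (f, 0) = (f', k)" "turning \<phi> = dir (f', k) / dir (f, 0)"
    using Rot_moves[OF s t] .
  have "turning \<phi> = 1" using \<phi>(3) Q_eq_iff[OF s t] Qst dir_nonzero[OF s] by simp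
  moreover have "\<phi> y = z"
  proof -
    have "rot_of p Q f = rot_of p Q f' * zeta p ^ k"
      using dart_map_rot(3)[OF Q(1) E f'(2) k(1)] Qst by (simp add: rot_of_def)
    then have "rot_of p Q f' * x' = rot_of p Q f' * (zeta p ^ k * x)" using f'(5) by (simp add: mult.assoc)
    then have "x' = zeta p ^ k * x" by simp
    then show ?thesis
      using inducesD[OF dart_action(2)[OF \<phi>(1)] f(1,2)] \<phi>(2) f(3) zf by (simp add: face_map_def rot_of_def)
  qed
  ultimately show thesis using that \<phi>(1) by blast
qed

text \<open>The two images of a representative are representatives of one point with the same image
  under \<open>Q\<close>, so off the vertices they coincide, and with the directions this gives
  agreement at a dart. At a vertex the statement can fail, as a deck transformation may turn the
  surface about a vertex through a multiple of 2\<pi>.\<close>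

lemma fibre_free:
  assumes R: "\<phi> \<in> Rot_set E" "\<psi> \<in> Rot_set E" and t: "turning \<phi> = 1" "turning \<psi> = 1"
    and y: "y \<in> points E" "y \<notin> vertices E" and e: "\<phi> y = \<psi> y"
  shows "\<phi> = \<psi>"
proof -
  note a = dart_action[OF R(1)] and b = dart_action[OF R(2)]
  obtain f x where f: "f \<in> faces E" "x \<in> poly_of E" "y = pt E f x" using y by (auto simp: points_eq)
  have x: "x \<notin> corners p" using y f pt_in_vertices_iff[OF E] by simp
  have c: "(f, x) \<in> cells E" using f by (simp add: cells_def)
  have s: "(f, 0) \<in> darts E" using f p3 by (simp add: darts_def)
  let ?q = "act p (dart_action \<phi>) (f, x)" and ?r = "act p (dart_action \<psi>) (f, x)"
  have q: "?q \<in> cells E" and r: "?r \<in> cells E" using act_in_cells[OF a(3) E c] act_in_cells[OF b(3) E c] .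
  have rel: "(?q, ?r) \<in> (glue_rel E)\<^sup>*"
    using e inducesD[OF a(2) f(1,2)] inducesD[OF b(2) f(1,2)] f(3) q r
      pt_eq_iff[OF E, of "fst ?q" "snd ?q" "fst ?r" "snd ?r"] by (simp add: act_def cells_def)
  have "snd ?q \<notin> corners p" using x by (simp add: act_def rot_of_corner_iff[OF p3])
  moreover have Qact: "Q (dart_action \<phi> (f, 0)) = Q (dart_action \<psi> (f, 0))"
    using dir_action[OF R(1) s] dir_action[OF R(2) s] t
      Q_eq_iff[OF dart_mapD(2)[OF a(3) s] dart_mapD(2)[OF b(3) s]] by simp
  moreover have "act p Q ?q = act p Q ?r"
  proof -
    have "(Q \<circ> dart_action \<phi>) (f, 0) = (Q \<circ> dart_action \<psi>) (f, 0)" using Qact by simp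
    then have "face_map (Q \<circ> dart_action \<phi>) f = face_map (Q \<circ> dart_action \<psi>) f"
      "rot_of p (Q \<circ> dart_action \<phi>) f = rot_of p (Q \<circ> dart_action \<psi>) f"
      by (simp_all add: face_map_def rot_of_def)
    then show ?thesis
      using face_map_compose[OF a(3) Q(1) E E f(1)] face_map_compose[OF b(3) Q(1) E E f(1)]
      by (simp add: act_def mult.assoc[symmetric])
  qed
  ultimately have "?q = ?r" using act_inj_on_class[OF Q(1) E target q _ rel] by blast
  then have F: "fst (dart_action \<phi> (f, 0)) = fst (dart_action \<psi> (f, 0))" by (simp add: act_def face_map_def)
  have "dir (dart_action \<phi> (f, 0)) = dir (dart_action \<psi> (f, 0))"
    using dir_action[OF R(1) s] dir_action[OF R(2) s] t by simp
  then have "zeta p ^ snd (dart_action \<phi> (f, 0)) = zeta p ^ snd (dart_action \<psi> (f, 0))"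
    using F d_nonzero[of "fst (dart_action \<psi> (f, 0))"] dart_mapD(2)[OF b(3) s] by (auto simp: dir_def darts_def)
  then have "snd (dart_action \<phi> (f, 0)) = snd (dart_action \<psi> (f, 0))"
    using zeta_power_inj dart_map_rot(2)[OF a(3) E f(1), of 0] dart_map_rot(2)[OF b(3) E f(1), of 0] p3 by simp
  with F have "dart_action \<phi> (f, 0) = dart_action \<psi> (f, 0)" by (simp add: prod_eq_iff)
  then have "dart_action \<phi> r = dart_action \<psi> r" if "r \<in> darts E" for r
    using dart_map_eqI[OF connected_surface_darts[OF conE] E a(3) b(3) s _ that] by blast
  then show ?thesis
    using induces_agree[OF a(2) b(2) E] by (intro extensionalityI[OF Rot_set_ext[OF R(1)] Rot_set_ext[OF R(2)]]) blast
qed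

section \<open>Deck transformations\<close>

lemma covering: "covering_map (punctured E) (punctured target) h"
  using induces_covering[OF Q(2,1) E target dartsE_ne dart_connected_Pi_surface[OF p3]] .

lemma h_vertices: "y \<in> points E \<Longrightarrow> h y \<in> vertices target \<longleftrightarrow> y \<in> vertices E"
  using induces_vertices[OF Q(2,1) E target] .

lemma continuous_punctured:
  assumes "continuous_map (surf_top E) (surf_top E) \<phi>" "\<And>y. y \<in> points E \<Longrightarrow> \<phi> y \<in> points E"
    "\<And>y. y \<in> points E \<Longrightarrow> h (\<phi> y) = h y"
  shows "continuous_map (punctured E) (punctured E) \<phi>"
  unfolding punctured_def continuous_map_in_subtopology
proof
  show "continuous_map (subtopology (surf_top E) (points E - vertices E)) (surf_top E) \<phi>"
    using assms(1) by (rule continuous_map_from_subtopology)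
  have "\<phi> y \<notin> vertices E" if "y \<in> points E" "y \<notin> vertices E" for y
    using h_vertices[OF that(1)] h_vertices[OF assms(2)[OF that(1)]] assms(3)[OF that(1)] that(2) by simp
  then show "\<phi> \<in> topspace (subtopology (surf_top E) (points E - vertices E)) \<rightarrow> points E - vertices E"
    using assms(2) by (auto simp: topspace_surf_top[OF E])
qed

text \<open>No separation property of \<open>surf_top\<close> is invoked, so closedness is checked
  in charts: the trace of the spoke is the compact segment itself in the face \<open>g\<close>, plus
  finitely many corners in any face.\<close>

lemma spoke_closed:
  assumes g: "g \<in> faces E"
  shows "closedin (surf_top E) {pt E g (of_real r * vert p k) | r. r \<in> {0..1}}" (is "closedin _ ?C")
proof -
  have in_poly: "of_real r * vert p k \<in> poly_of E" if "r \<in> {0..1}" for r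
    using that p3 by (intro scale_in_polygon polygon_vert) auto
  have "?C \<subseteq> points E" using in_poly pt_in_points[OF g] by blast
  moreover have "openin (surf_top E) (points E - ?C)"
    unfolding openin_surf_top[OF E]
  proof (intro conjI ballI)
    show "points E - ?C \<subseteq> points E" by blast
    fix e assume e: "e \<in> faces E"
    define A where "A = (if e = g then (\<lambda>r. of_real r * vert p k) ` {0..1} else {})"
    define B where "B = {x \<in> corners p. pt E e x = pt E g (vert p k)}"
    have "compact ((\<lambda>r. of_real r * vert p k :: complex) ` {0..1})"
      by (intro compact_continuous_image continuous_intros) auto
    then have "closed A" by (auto simp: A_def compact_imp_closed)
    moreover have "finite B" by (simp add: B_def corners_def)
    then have "closed B" by (rule finite_imp_closed)
    ultimately have cl: "closed (A \<union> B)" by (rule closed_Un)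
    have "pt E e x \<in> ?C \<longleftrightarrow> x \<in> A \<union> B" if x: "x \<in> poly_of E" for x
    proof
      assume "pt E e x \<in> ?C"
      then obtain r where r: "r \<in> {0..1}" "pt E e x = pt E g (of_real r * vert p k)" by blast
      show "x \<in> A \<union> B"
      proof (cases "r = 1")
        case True
        then have "pt E e x = pt E g (vert p k)" using r by simp
        moreover from this have "x \<in> corners p"
          using pt_in_vertices_iff[OF E e x] pt_in_vertices_iff[OF E g polygon_vert[of p k]] corner_vert[of p k] p3 by simp
        ultimately show ?thesis by (simp add: B_def)
      next
        case False
        then have "of_real r * vert p k \<notin> side p j" for j
          using spoke_notin_side[OF p3, of r k j] r by auto
        then have "g = e" "of_real r * vert p k = x"
          using pt_eq_offside[OF E g in_poly[OF r(1)] _ e x r(2)[symmetric]] by blast+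
        then show ?thesis using r(1) by (auto simp: A_def)
      qed
    next
      assume "x \<in> A \<union> B"
      then show "pt E e x \<in> ?C"
      proof
        assume "x \<in> A"
        then obtain r where "e = g" "r \<in> {0..1}" "x = of_real r * vert p k"
          unfolding A_def by (cases "e = g") auto
        then show ?thesis by blast
      next
        assume "x \<in> B"
        then show ?thesis by (intro CollectI exI[of _ 1]) (simp add: B_def)
      qed
    qed
    then have set_eq: "{x \<in> poly_of E. pt E e x \<in> points E - ?C} = poly_of E \<inter> - (A \<union> B)"
      using pt_in_points[OF e] by blast
    show "openin (top_of_set (poly_of E)) {x \<in> poly_of E. pt E e x \<in> points E - ?C}"
      unfolding set_eq by (rule openin_open_Int) (rule open_Compl[OF cl])
  qed
  ultimately show ?thesis by (simp add: closedin_def topspace_surf_top[OF E])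
qed

text \<open>A deck transformation agrees with a rotation off the vertices by uniqueness of lifts. At a vertex
  it is the limit along a spoke, and the image of the spoke is closed and contains a single vertex.\<close>

lemma deck_is_rotation:
  assumes B: "\<phi> \<in> Bij (points E)" and hom: "homeomorphic_map (surf_top E) (surf_top E) \<phi>"
    and deck: "\<And>y. y \<in> points E \<Longrightarrow> h (\<phi> y) = h y"
  shows "\<phi> \<in> Rot_set E" "turning \<phi> = 1"
proof -
  have \<phi>p: "\<phi> y \<in> points E" if "y \<in> points E" for y using B that by (auto simp: Bij_def bij_betw_def)
  have \<phi>c: "continuous_map (surf_top E) (surf_top E) \<phi>" using hom by (rule homeomorphic_imp_continuous_map)
  obtain f0 where f0: "f0 \<in> faces E" using dartsE_ne by (auto simp: darts_def)
  define y0 where "y0 = pt E f0 0"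
  have y0: "y0 \<in> topspace (punctured E)" "y0 \<in> points E"
    using pt_center(2)[OF E f0] by (simp_all add: y0_def topspace_punctured[OF E])
  \<comment> \<open>The comparison starts at the centre of a face, which belongs to the punctured
    surface, where lifts are unique.\<close>
  obtain \<psi> where \<psi>: "\<psi> \<in> Rot_set E" "turning \<psi> = 1" "\<psi> y0 = \<phi> y0"
    using fibre_transitive[OF y0(2) \<phi>p[OF y0(2)] deck[OF y0(2), symmetric]] .
  note a = dart_action[OF \<psi>(1)]
  have h\<psi>: "h (\<psi> y) = h y" if "y \<in> points E" for y using turning_1_iff[OF \<psi>(1)] \<psi>(2) that by blast
  have cE: "connected_space (punctured E)"
    using punctured_path_connected[OF conE] by (rule path_connected_imp_connected_space)
  have c\<phi>: "continuous_map (punctured E) (punctured E) \<phi>" by (rule continuous_punctured[OF \<phi>c \<phi>p deck])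
  have c\<psi>: "continuous_map (punctured E) (punctured E) \<psi>"
    by (rule continuous_punctured[OF induces_continuous[OF a(2,3) E E] Rot_set_points[OF \<psi>(1)] h\<psi>])
  have hh: "h (\<phi> y) = h (\<psi> y)" if "y \<in> topspace (punctured E)" for y
    using that deck h\<psi> by (simp add: topspace_punctured[OF E])
  have agree: "\<phi> y = \<psi> y" if "y \<in> points E" "y \<notin> vertices E" for y
    using covering_map_lift_unique[OF covering cE c\<phi> c\<psi> hh y0(1) \<psi>(3)[symmetric]] that
    by (simp add: topspace_punctured[OF E])
  have "\<phi> v = \<psi> v" if v: "v \<in> vertices E" for v
  proof -
    obtain f k where fk: "f \<in> faces E" "k < p" "v = pt E f (vert p k)" using v by (auto simp: vertices_def)
    define g where "g = face_map (dart_action \<psi>) f"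
    have g: "g \<in> faces E" unfolding g_def using face_map_in[OF a(3) E fk(1)] .
    obtain j where j: "rot_of p (dart_action \<psi>) f * vert p k = vert p j"
      by (metis rot_of_def vert_add)
    let ?C = "{pt E g (of_real r * vert p j) | r. r \<in> {0..1}}"
    have in_poly: "of_real r * vert p i \<in> poly_of E" if "r \<in> {0..1}" for r i
      using that p3 by (intro scale_in_polygon polygon_vert) auto
    have \<psi>s: "\<psi> (pt E f (of_real r * vert p k)) = pt E g (of_real r * vert p j)" if "r \<in> {0..1}" for r
      using inducesD[OF a(2) fk(1) in_poly[OF that]] j by (simp add: g_def mult.left_commute)
    have vert_iff: "pt E e (of_real r * vert p i) \<in> vertices E \<longleftrightarrow> r = 1" if e: "e \<in> faces E" and r: "r \<in> {0..1}" for e r i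
    proof -
      have "of_real r * vert p i \<in> corners p \<longleftrightarrow> r = 1"
      proof
        assume "of_real r * vert p i \<in> corners p"
        then have "cmod (of_real r * vert p i) = 1" by (auto simp: corners_def simp del: norm_of_real)
        then show "r = 1" using r by (simp add: norm_mult)
      qed (use corner_vert[of p i] p3 in auto)
      then show ?thesis using pt_in_vertices_iff[OF E e in_poly[OF r]] by simp
    qed
    define c where "c = \<phi> \<circ> (pt E f \<circ> (\<lambda>r. of_real r * vert p k))"
    have "continuous_map (top_of_set {0..1}) (top_of_set (poly_of E)) (\<lambda>r. of_real r * vert p k)"
      using in_poly by (auto simp: continuous_map_in_subtopology intro!: continuous_intros)
    then have "continuous_map (top_of_set {0..1}) (surf_top E) c"
      unfolding c_def using continuous_map_pt[OF E fk(1)] \<phi>c by (intro continuous_map_compose)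
    then have "closedin (top_of_set {0..1}) {r \<in> {0..1}. c r \<in> ?C}"
      using closedin_continuous_map_preimage[OF _ spoke_closed[OF g, of j]] by fastforce
    then have "closed {r \<in> {0..1}. c r \<in> ?C}"
      by (rule closedin_closed_trans) simp
    moreover have "{0..<1} \<subseteq> {r \<in> {0..1}. c r \<in> ?C}"
    proof
      fix r :: real assume r: "r \<in> {0..<1}"
      then have r': "r \<in> {0..1}" "r \<noteq> 1" by auto
      have "c r = \<psi> (pt E f (of_real r * vert p k))"
        using agree[OF pt_in_points[OF fk(1) in_poly[OF r'(1)]]] vert_iff[OF fk(1) r'(1)] r'(2) by (simp add: c_def)
      then show "r \<in> {r \<in> {0..1}. c r \<in> ?C}" using \<psi>s[OF r'(1)] r'(1) by auto
    qed
    ultimately have "closure {0..<1} \<subseteq> {r \<in> {0..1}. c r \<in> ?C}" by (rule closure_minimal[rotated])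
    moreover have "1 \<in> closure {0..<1::real}" by simp
    ultimately have "c 1 \<in> ?C" by blast
    then obtain r where r: "r \<in> {0..1}" "\<phi> v = pt E g (of_real r * vert p j)" by (auto simp: c_def fk(3))
    have vp: "v \<in> points E" using fk pt_in_points[OF fk(1) in_poly[of 1 k]] by simp
    have "\<phi> v \<in> vertices E"
      using h_vertices[OF vp] h_vertices[OF \<phi>p[OF vp]] deck[OF vp] v by simp
    then have "r = 1" using r vert_iff[OF g r(1)] by simp
    then show ?thesis using r \<psi>s[of 1] fk(3) by simp
  qed
  with agree have "\<phi> = \<psi>"
    using B by (intro extensionalityI[OF _ Rot_set_ext[OF \<psi>(1)]]) (auto simp: Bij_def)
  with \<psi> show "\<phi> \<in> Rot_set E" "turning \<phi> = 1" by simp_all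
qed

text \<open>Both sides restrict the multiplication of \<open>BijGroup (points E)\<close>, so
  equality of the carriers suffices, and whatever is known of the kernel of \<open>turning\<close>
  carries over by rewriting.\<close>

lemma Deck_eq: "Deck E h = (Rot E)\<lparr>carrier := {\<phi> \<in> carrier (Rot E). turning \<phi> = 1}\<rparr>"
proof -
  have "{\<phi> \<in> Bij (points E). homeomorphic_map (surf_top E) (surf_top E) \<phi> \<and> (\<forall>y \<in> points E. h (\<phi> y) = h y)} =
      {\<phi> \<in> Rot_set E. turning \<phi> = 1}"
    (is "?L = ?R")
  proof (intro subset_antisym subsetI)
    show "\<phi> \<in> ?R" if "\<phi> \<in> ?L" for \<phi> using deck_is_rotation[of \<phi>] that by blast
    fix \<phi> assume \<phi>: "\<phi> \<in> ?R"
    then have "\<phi> \<in> Bij (points E)" "homeomorphic_map (surf_top E) (surf_top E) \<phi>"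
      by (simp_all add: Rot_set_def Aut_set_def)
    moreover have "\<forall>y \<in> points E. h (\<phi> y) = h y" using turning_1_iff[of \<phi>] \<phi> by blast
    ultimately show "\<phi> \<in> ?L" by simp
  qed
  then show ?thesis by (simp add: Deck_def Rot_def)
qed

text \<open>A deck transformation carries a lift of a loop to the lift from the moved starting
  point, so monodromy is equivariant. It is transitive on the fibre since a path joining two points
  of the fibre projects to a loop. Together with simple transitivity of the deck group off the
  vertices, this meets the conditions of \<open>equivariant_maps_iso\<close>.\<close>

lemma Mon_iso:
  assumes x0: "x0 \<in> topspace (punctured target)" and K: "group (Deck E h)"
  shows "group (Mon E target h x0)" "Mon E target h x0 \<cong> Deck E h"
proof -
  let ?F = "fibre E h x0"
  let ?M = "{\<lambda>y \<in> ?F. lift_end E h \<gamma> y | \<gamma>. pathin (punctured target) \<gamma> \<and> \<gamma> 0 = x0 \<and> \<gamma> 1 = x0}"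
  have x0': "x0 \<in> points target" "x0 \<notin> vertices target" using x0 by (auto simp: topspace_punctured[OF target])
  have F: "y \<in> points E" "y \<notin> vertices E" "h y = x0" "y \<in> topspace (punctured E)" if "y \<in> ?F" for y
    using that x0' h_vertices[of y] by (auto simp: fibre_def topspace_punctured[OF E])
  have Kc: "\<phi> \<in> Rot_set E" "turning \<phi> = 1" if "\<phi> \<in> carrier (Deck E h)" for \<phi>
    using that by (auto simp: Deck_eq)
  have Kh: "h (\<phi> y) = h y" if "\<phi> \<in> carrier (Deck E h)" "y \<in> points E" for \<phi> y
    using turning_1_iff[OF Kc(1)[OF that(1)]] Kc(2)[OF that(1)] that(2) by simp
  have KF: "\<phi> y \<in> ?F" if "\<phi> \<in> carrier (Deck E h)" "y \<in> ?F" for \<phi> y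
    using F(1,3)[OF that(2)] Kh[OF that(1) F(1)[OF that(2)]] Rot_set_points[OF Kc(1)[OF that(1)] F(1)[OF that(2)]]
    by (simp add: fibre_def)
  have lift: "\<exists>c. pathin (punctured E) c \<and> (\<forall>t \<in> {0..1}. h (c t) = \<gamma> t) \<and> c 0 = y"
    if "pathin (punctured target) \<gamma>" "\<gamma> 0 = x0" "y \<in> ?F" for \<gamma> y
    using covering_map_path_lift[OF covering that(1) F(4)[OF that(3)]] F(3)[OF that(3)] that(2) by metis
  have MF: "lift_end E h \<gamma> y \<in> ?F" if \<gamma>: "pathin (punctured target) \<gamma>" "\<gamma> 0 = x0" "\<gamma> 1 = x0" and y: "y \<in> ?F" for \<gamma> y
  proof -
    obtain c where c: "pathin (punctured E) c" "\<And>t. t \<in> {0..1} \<Longrightarrow> h (c t) = \<gamma> t" "c 0 = y"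
      using lift[OF \<gamma>(1,2) y] by blast
    have "lift_end E h \<gamma> y = c 1" using lift_end_eq[OF covering c(1,2)] c(3) by simp
    moreover have "c 1 \<in> topspace (punctured E)" using c(1) by (auto simp: pathin_def continuous_map_def)
    moreover have "h (c 1) = x0" using c(2)[of 1] \<gamma>(3) by simp
    ultimately show ?thesis by (simp add: fibre_def topspace_punctured[OF E])
  qed
  have eqv: "lift_end E h \<gamma> (\<phi> y) = \<phi> (lift_end E h \<gamma> y)"
    if \<gamma>: "pathin (punctured target) \<gamma>" "\<gamma> 0 = x0" and \<phi>: "\<phi> \<in> carrier (Deck E h)" and y: "y \<in> ?F" for \<gamma> \<phi> y
  proof -
    obtain c where c: "pathin (punctured E) c" "\<And>t. t \<in> {0..1} \<Longrightarrow> h (c t) = \<gamma> t" "c 0 = y"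
      using lift[OF \<gamma> y] by blast
    have cp: "c t \<in> points E" if "t \<in> {0..1}" for t
    proof -
      have "c t \<in> topspace (punctured E)" using c(1) that by (auto simp: pathin_def continuous_map_def)
      then show ?thesis by (simp add: topspace_punctured[OF E])
    qed
    have "continuous_map (punctured E) (punctured E) \<phi>"
      using continuous_punctured[OF induces_continuous[OF dart_action(2,3)[OF Kc(1)[OF \<phi>]] E E]
          Rot_set_points[OF Kc(1)[OF \<phi>]] Kh[OF \<phi>]] .
    then have p\<phi>: "pathin (punctured E) (\<phi> \<circ> c)" by (rule pathin_compose[OF c(1)])
    have "h ((\<phi> \<circ> c) t) = \<gamma> t" if "t \<in> {0..1}" for t using Kh[OF \<phi> cp[OF that]] c(2)[OF that] by simp
    then have "lift_end E h \<gamma> ((\<phi> \<circ> c) 0) = (\<phi> \<circ> c) 1" by (rule lift_end_eq[OF covering p\<phi>])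
    then show ?thesis using lift_end_eq[OF covering c(1,2)] c(3) by simp
  qed
  have tr: "\<exists>m \<in> ?M. m y = z" if y: "y \<in> ?F" and z: "z \<in> ?F" for y z
  proof -
    obtain c where c: "pathin (punctured E) c" "c 0 = y" "c 1 = z"
      using punctured_path_connected[OF conE, unfolded path_connected_space_def, rule_format, OF F(4)[OF y] F(4)[OF z]] by blast
    have "continuous_map (punctured E) (punctured target) h" using covering by (simp add: covering_map_def)
    then have \<gamma>: "pathin (punctured target) (h \<circ> c)" by (rule pathin_compose[OF c(1)])
    have "lift_end E h (h \<circ> c) y = z" using lift_end_eq[OF covering c(1), of "h \<circ> c"] c by simp
    then show ?thesis
      using \<gamma> c F(3)[OF y] F(3)[OF z] y by (intro bexI[of _ "\<lambda>y \<in> ?F. lift_end E h (h \<circ> c) y"]) auto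
  qed
  have mult: "(\<phi> \<otimes>\<^bsub>Deck E h\<^esub> \<psi>) y = \<phi> (\<psi> y)"
    if "\<phi> \<in> carrier (Deck E h)" "\<psi> \<in> carrier (Deck E h)" "y \<in> ?F" for \<phi> \<psi> y
  proof -
    have "\<phi> \<otimes>\<^bsub>Deck E h\<^esub> \<psi> = \<phi> \<otimes>\<^bsub>Rot E\<^esub> \<psi>" by (simp add: Deck_eq)
    then show ?thesis using Rot_mult[OF Kc(1)[OF that(1)] Kc(1)[OF that(2)]] F(1)[OF that(3)] by (simp add: compose_def)
  qed
  have ktr: "\<exists>\<phi> \<in> carrier (Deck E h). \<phi> y = z" if y: "y \<in> ?F" and z: "z \<in> ?F" for y z
  proof -
    have "h y = h z" using F(3)[OF y] F(3)[OF z] by simp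
    then obtain \<phi> where "\<phi> \<in> Rot_set E" "turning \<phi> = 1" "\<phi> y = z"
      by (rule fibre_transitive[OF F(1)[OF y] F(1)[OF z]])
    then show ?thesis by (intro bexI[of _ \<phi>]) (simp_all add: Deck_eq)
  qed
  have ne: "?F \<noteq> {}"
  proof -
    obtain z where "z \<in> points E" "h z = x0"
      using induces_surj[OF Q(2,1) E target dartsE_ne dart_connected_Pi_surface[OF p3] x0'(1)] .
    then show ?thesis by (auto simp: fibre_def)
  qed
  have free: "\<phi> = \<psi>" if "\<phi> \<in> carrier (Deck E h)" "\<psi> \<in> carrier (Deck E h)" "y \<in> ?F" "\<phi> y = \<psi> y" for \<phi> \<psi> y
    using fibre_free[OF Kc(1)[OF that(1)] Kc(1)[OF that(2)] Kc(2)[OF that(1)] Kc(2)[OF that(2)] F(1,2)[OF that(3)] that(4)] .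
  have Mext: "m \<in> extensional ?F" if "m \<in> ?M" for m using that by auto
  have M_F: "m y \<in> ?F" if m: "m \<in> ?M" and y: "y \<in> ?F" for m y
  proof -
    obtain \<gamma> where "pathin (punctured target) \<gamma>" "\<gamma> 0 = x0" "\<gamma> 1 = x0" "m = (\<lambda>y \<in> ?F. lift_end E h \<gamma> y)"
      using m by blast
    then show ?thesis using MF[of \<gamma> y] y by simp
  qed
  have M_eqv: "m (\<phi> y) = \<phi> (m y)" if m: "m \<in> ?M" and \<phi>: "\<phi> \<in> carrier (Deck E h)" and y: "y \<in> ?F" for m \<phi> y
  proof -
    obtain \<gamma> where "pathin (punctured target) \<gamma>" "\<gamma> 0 = x0" "m = (\<lambda>y \<in> ?F. lift_end E h \<gamma> y)"
      using m by blast
    then show ?thesis using eqv[of \<gamma> \<phi> y] \<phi> y KF[OF \<phi> y] by simp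
  qed
  note iso = equivariant_maps_iso[where K="Deck E h" and F="?F" and M="?M" and a="\<lambda>\<phi>. \<phi>"]
  have "group ((BijGroup ?F)\<lparr>carrier := ?M\<rparr>)"
    by (rule iso(1)) (fact K KF mult ktr free ne Mext M_F M_eqv tr)+
  moreover have "(BijGroup ?F)\<lparr>carrier := ?M\<rparr> \<cong> Deck E h"
    by (rule iso(2)) (fact K KF mult ktr free ne Mext M_F M_eqv tr)+
  ultimately show "group (Mon E target h x0)" "Mon E target h x0 \<cong> Deck E h"
    by (simp_all add: Mon_def)
qed

end

theorem theorem1p1:
  fixes D :: "'f polysurf" and E :: "'g polysurf"
    and \<pi>\<^sub>D :: "('g \<times> complex) set \<Rightarrow> ('f \<times> complex) set"
    and d :: "'g \<Rightarrow> complex"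
    and \<pi>\<^sub>\<Pi> :: "('g \<times> complex) set \<Rightarrow> (complex \<times> complex) set"
    and x\<^sub>0 :: "(complex \<times> complex) set"
  assumes "platonic_surface D"
    and "is_unfolding D E \<pi>\<^sub>D"
    and "horizontal_directions E d"
    and "is_translation_cover E d \<pi>\<^sub>\<Pi>"
    and "x\<^sub>0 \<in> topspace (punctured (Pi_surface (gon D)))"
  shows "\<exists>N. N \<lhd> Rot D \<and>
    group (Mon E (Pi_surface (gon D)) \<pi>\<^sub>\<Pi> x\<^sub>0) \<and>
    Mon E (Pi_surface (gon D)) \<pi>\<^sub>\<Pi> x\<^sub>0 \<cong> (Rot D)\<lparr>carrier := N\<rparr> \<and>
    group (Deck E \<pi>\<^sub>\<Pi>) \<and> Deck E \<pi>\<^sub>\<Pi> \<cong> (Rot D)\<lparr>carrier := N\<rparr> \<and>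
    cyclic_group (Rot D Mod N)"
proof -
  have con: "connected_surface E" "connected_surface D" and gon: "gon E = gon D"
    using assms(1,2) by (auto simp: is_unfolding_def platonic_surface_def)
  note E = connected_surface_gluing[OF con(1)] and D = connected_surface_gluing[OF con(2)]
  have "\<exists>g A. carries E D \<pi>\<^sub>D f g A \<and> orientation_preserving_on (poly_of E) A" if "f \<in> faces E" for f
    using assms(2) that by (auto simp: is_unfolding_def)
  then obtain P where P: "dart_map E D P" "induces E D P \<pi>\<^sub>D"
    using carries_dart_map[OF E D gon] by metis
  have d: "\<And>f. f \<in> faces E \<Longrightarrow> cmod (d f) = 1"
    and d_glue: "\<And>f k g l. f \<in> faces E \<Longrightarrow> k < gon E \<Longrightarrow> glue E (f, k) = (g, l) \<Longrightarrow>
      d g * side_vec (gon E) l = - (d f * side_vec (gon E) k)"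
    using assms(3) by (auto simp: horizontal_directions_def)
  obtain Q where Q: "dart_map E (Pi_surface (gon E)) Q" "induces E (Pi_surface (gon E)) Q \<pi>\<^sub>\<Pi>"
      "\<And>f. f \<in> faces E \<Longrightarrow> d f = face_map Q f * rot_of (gon E) Q f"
    using translation_cover_dart_map[OF E assms(4) d] by metis
  interpret platonic_unfolding D E \<pi>\<^sub>D d \<pi>\<^sub>\<Pi> P Q
    using assms(1,2) d_glue P Q by unfold_locales
  obtain \<phi>0 where \<phi>0: "\<phi>0 \<in> Rot_set E" "\<And>\<phi>. \<phi> \<in> Rot_set E \<Longrightarrow> \<exists>n::nat. turning \<phi> = turning \<phi>0 ^ n"
    using turning_generator by blast
  let ?N = "descend ` {\<phi> \<in> carrier (Rot E). turning \<phi> = 1}"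
  \<comment> \<open>Here \<open>H\<close> is \<open>Rot E\<close>, \<open>G\<close> is
    \<open>Rot D\<close>, \<open>\<Psi>\<close> is \<open>descend\<close>, \<open>\<xi>\<close> is
    \<open>turning\<close>, and \<open>\<phi>0\<close> generates modulo the kernel.\<close>
  note N = kernel_image_cyclic_quotient[OF group_Rot[OF con(2)] group_Rot[OF con(1)] descend_hom descend_surj,
      of turning \<phi>0, unfolded carrier_Rot, OF turning_mult turning_nonzero descend_inj[unfolded carrier_Rot] \<phi>0]
  have K: "group (Deck E \<pi>\<^sub>\<Pi>)" "Deck E \<pi>\<^sub>\<Pi> \<cong> (Rot D)\<lparr>carrier := ?N\<rparr>"
    using N(2,3) by (simp_all add: Deck_eq)
  have x0: "x\<^sub>0 \<in> topspace (punctured (Pi_surface (gon E)))" using assms(5) gon by simp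
  have M: "group (Mon E (Pi_surface (gon D)) \<pi>\<^sub>\<Pi> x\<^sub>0)" "Mon E (Pi_surface (gon D)) \<pi>\<^sub>\<Pi> x\<^sub>0 \<cong> Deck E \<pi>\<^sub>\<Pi>"
    using Mon_iso[OF x0 K(1)] gon by simp_all
  have "Mon E (Pi_surface (gon D)) \<pi>\<^sub>\<Pi> x\<^sub>0 \<cong> (Rot D)\<lparr>carrier := ?N\<rparr>" using M(2) K(2) by (rule iso_trans)
  then show ?thesis using N(1,4) M(1) K by (intro exI[of _ ?N]) simp
qed

end
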